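(* Let $f:\mathbb{T}^2\to\mathbb{T}^2$ be a Katok diffeomorphism with associated measure $\nu_0$ (as constructed in the context), and let $m$ be a finite Borel measure on $\mathbb{T}^2$. Let $0<\epsilon\ll\beta$ be such that there is a neighborhood $U$ of $\nu_0$ in $\mathscr{M}_{\rm inv}(\mathbb{T}^2,f)$ (weak* topology) with the property that every ergodic $\nu\in U$ belongs to $\mathscr{M}_{\rm inv}(\widetilde\Lambda(\beta,\beta,\epsilon),f)$, where $\widetilde\Lambda(\beta,\beta,\epsilon)=\bigcup_{k\ge1}\operatorname{supp}(\nu_0|\Lambda_k(\beta,\beta,\epsilon))$. Then for every $\varphi\in C^0(\mathbb{T}^2)$ and $c\in\mathbb{R}$ the following hold. (1) For every $\psi\in\mathcal{V}^+$, $$\limsup_{n\to\infty}\frac1n\log m\Big\{x\in\mathbb{T}^2:\frac1n S_n\varphi(x)\in[c,\infty)\Big\}\le\sup\Big\{h_\nu(f)-\int\psi\,d\nu:\ \nu\in\mathscr{M}_{\rm inv}(\mathbb{T}^2,f),\ \int\varphi\,d\nu\ge c\Big\}.$$ (2) For every $\psi\in\mathcal{V}^-$, $$\liminf_{n\to\infty}\frac1n\log m\Big\{x\in\mathbb{T}^2:\frac1n S_n\varphi(x)\in(c,\infty)\Big\}\ge\sup\Big\{h_\nu(f)-\int\psi\,d\nu:\ \nu\in\mathscr{M}_{\rm inv}(\widetilde\Lambda(\beta,\beta,\epsilon),f),\ \int\varphi\,d\nu>c\Big\}.$$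
   Context: Katok diffeomorphism. Let $f_0$ be the linear automorphism of $\mathbb{T}^2$ given by $A=\begin{pmatrix}2&1\\1&1\end{pmatrix}$, with eigenvalues $\lambda^{-1}<1<\lambda$, and let $\mu_1$ be its measure of maximal entropy. Let $D_r$ be the disk of small radius $r$ centered at $(0,0)$ with coordinates $(s_1,s_2)$ along the eigendirections of $A$, so $A(s_1,s_2)=(\lambda s_1,\lambda^{-1}s_2)$; $A$ is the time-1 map of the local flow of $\dot s_1=s_1\log\lambda$, $\dot s_2=-s_2\log\lambda$. Let $\kappa:[0,1]\to\mathbb{R}$ satisfy: $\kappa$ is $C^\infty$ except at $0$; $\kappa(0)=0$ and $\kappa(u)=1$ for $u\ge r_0$, where $0<r_0<1$; $\kappa'(u)>0$ for $0<u<r_0$; $\int_0^1 du/\kappa(u)<\infty$. Fix sufficiently small $r_0<r_1$ and let $g$ be the time-1 map generated in $D_{r_1}$ by $\dot s_1=s_1\kappa(s_1^2+s_2^2)\log\lambda$, $\dot s_2=-s_2\kappa(s_1^2+s_2^2)\log\lambda$. Define $f(x)=g(x)$ for $x\in D_{r_1}$ and $f(x)=A(x)$ otherwise. This is a homeomorphism of $\mathbb{T}^2$ which is a $C^\infty$ diffeomorphism away from the origin; $\kappa$ is assumed to satisfy in addition Katok's conditions (the integral $\int_0^1du/\kappa$ converges sufficiently slowly near $0$) guaranteeing that $f$ is smooth, so that $f$ is a diffeomorphism of $\mathbb{T}^2$. There is a homeomorphism $\pi:\mathbb{T}^2\to\mathbb{T}^2$ with $\pi\circ f_0=f\circ\pi$,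 and $\nu_0=\pi_*\mu_1$. Notation. $C^0(\mathbb{T}^2)$: continuous functions $\mathbb{T}^2\to\mathbb{R}$; $S_n\varphi(x)=\sum_{i=0}^{n-1}\varphi(f^ix)$; $B_n(x,r)=\{y: d(f^ix,f^iy)<r,\ 0\le i\le n-1\}$; $h_\nu(f)$ is measure-theoretic entropy; $\mathscr{M}_{\rm inv}(\mathbb{T}^2,f)$ is the set of $f$-invariant Borel probability measures, and $\mathscr{M}_{\rm inv}(Z,f)$ those with $\nu(Z)=1$. Conventions: $\log0=-\infty$, $\sup\emptyset=-\infty$. $\mathcal{V}^+$ is the set of $\psi\in C^0(\mathbb{T}^2)$ for which there exist $C,r>0$ with $m(B_n(x,r))\le Ce^{-S_n\psi(x)}$ for all $x$ and all $n\ge0$. $\mathcal{V}^-$ is the set of $\psi\in C^0(\mathbb{T}^2)$ for which there exist arbitrarily small $r>0$ and $C=C(r)>0$ with $m(B_n(x,r))\ge Ce^{-S_n\psi(x)}$ for all $x$ and all $n\ge0$. Pesin blocks: for $k\in\mathbb{Z}^+$, $\Lambda_k(\beta_1,\beta_2,\epsilon)$ is the set of all $x$ for which there is a decomposition $T_x\mathbb{T}^2=E^s_x\oplus E^u_x$ such that, with $Df^t(E^s_x)=E^s_{f^tx}$ and $Df^t(E^u_x)=E^u_{f^tx}$: $\|Df^n|E^s_{f^tx}\|\le e^{\epsilon k}e^{-(\beta_1-\epsilon)n}e^{\epsilon|t|}$ and $\|Df^{-n}|E^u_{f^tx}\|\le e^{\epsilon k}e^{-(\beta_2-\epsilon)n}e^{\epsilon|t|}$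 for all $t\in\mathbb{Z}$, $n\ge1$, and $\tan(\angle(E^s_{f^tx},E^u_{f^tx}))\ge e^{-\epsilon k}e^{-\epsilon|t|}$ for all $t\in\mathbb{Z}$. $\nu_0|\Lambda_k$ is the conditional measure of $\nu_0$ on $\Lambda_k$ (empty support if $\nu_0(\Lambda_k)=0$). The notation $\epsilon\ll\beta$ means that $\epsilon>0$ is sufficiently small compared with $\beta$ (smaller than some threshold depending only on $f,\beta$). *)

theory Defs
  imports "HOL-Probability.Probability"
begin

section \<open>The torus\<close>

quotient_type torus = "real ^ 2" / "\<lambda>v w. \<forall>i. v $ i - w $ i \<in> \<int>"
  morphisms rep_torus tor
proof (rule equivpI)
  show "reflp (\<lambda>v w :: real ^ 2. \<forall>i. v $ i - w $ i \<in> \<int>)"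
    by (simp add: reflp_def)
  show "symp (\<lambda>v w :: real ^ 2. \<forall>i. v $ i - w $ i \<in> \<int>)"
    by (auto simp: symp_def) (metis Ints_minus minus_diff_eq)
  show "transp (\<lambda>v w :: real ^ 2. \<forall>i. v $ i - w $ i \<in> \<int>)"
  proof (rule transpI, rule allI)
    fix u v w :: "real ^ 2" and i
    assume "\<forall>i. u $ i - v $ i \<in> \<int>" "\<forall>i. v $ i - w $ i \<in> \<int>"
    then have "(u $ i - v $ i) + (v $ i - w $ i) \<in> \<int>" by (intro Ints_add) auto
    then show "u $ i - w $ i \<in> \<int>" by simp
  qed
qed

lemma tor_eq_iff: "tor v = tor w \<longleftrightarrow> (\<forall>i. v $ i - w $ i \<in> \<int>)"
  by (rule torus.abs_eq_iff)

lemma tor_rep [simp]: "tor (rep_torus x) = x"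
  using Quotient_torus by (rule Quotient_abs_rep)

lemma tor_translate: "tor v = tor w \<Longrightarrow> tor (u + (v - w)) = tor u"
  by (simp add: tor_eq_iff)

text \<open>The flat metric: the distance of two points is the distance of their fibres in the plane.\<close>

instantiation torus :: metric_space
begin

definition dist_torus :: "torus \<Rightarrow> torus \<Rightarrow> real" where
  "dist_torus x y = setdist (tor -` {x}) (tor -` {y})"

definition uniformity_torus :: "(torus \<times> torus) filter" where
  "uniformity_torus = (INF e\<in>{0<..}. principal {(x, y). dist x y < e})"

definition open_torus :: "torus set \<Rightarrow> bool" where
  "open_torus U \<longleftrightarrow> (\<forall>x\<in>U. eventually (\<lambda>(x', y). x' = x \<longrightarrow> y \<in> U) uniformity)"

lemma dist_torus_less_iff:
  fixes x y :: torus
  shows "dist x y < e \<longleftrightarrow> (\<exists>v w. tor v = x \<and> tor w = y \<and> dist v w < e)"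
proof
  let ?D = "{dist v w |v w. v \<in> tor -` {x} \<and> w \<in> tor -` {y}}"
  have ne: "tor -` {x} \<noteq> {}" "tor -` {y} \<noteq> {}"
    using tor_rep by (metis empty_iff singletonI vimageI)+
  then have D: "?D \<noteq> {}" by blast
  have eq: "dist x y = Inf ?D"
    using ne by (simp add: dist_torus_def setdist_def)
  show "\<exists>v w. tor v = x \<and> tor w = y \<and> dist v w < e" if "dist x y < e"
  proof -
    have "Inf ?D < e" using that by (simp only: eq)
    then obtain d where "d \<in> ?D" "d < e" using D by (meson cInf_lessD)
    then show ?thesis by auto
  qed
  show "dist x y < e" if ex: "\<exists>v w. tor v = x \<and> tor w = y \<and> dist v w < e"
  proof -
    obtain v w where "tor v = x" "tor w = y" "dist v w < e" using ex by blast
    moreover have "setdist (tor -` {x}) (tor -` {y}) \<le> dist v w"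
      using calculation by (intro setdist_le_dist) auto
    ultimately show ?thesis by (simp add: dist_torus_def)
  qed
qed

instance
proof
  fix x y z :: torus
  show "uniformity = (INF e\<in>{0<..}. principal {(x :: torus, y). dist x y < e})"
    by (rule uniformity_torus_def)
  show "open U \<longleftrightarrow> (\<forall>x\<in>U. \<forall>\<^sub>F (x', y) in uniformity. x' = x \<longrightarrow> y \<in> U)" for U :: "torus set"
    by (rule open_torus_def)
  have refl: "dist x x = 0" for x :: torus
    using dist_torus_less_iff[of x x] unfolding dist_torus_def
    by (metis dist_self setdist_pos_le setdist_sing_in_set setdist_eq_0I vimage_singleton_eq tor_rep IntI empty_iff)
  show "dist x y = 0 \<longleftrightarrow> x = y"
  proof
    assume 0: "dist x y = 0"
    define p where "p = rep_torus x"
    have near: "\<exists>w. tor w = y \<and> dist p w < e" if "e > 0" for e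
    proof -
      obtain v w where vw: "tor v = x" "tor w = y" "dist v w < e"
        using 0 \<open>e > 0\<close> dist_torus_less_iff[of x y e] by auto
      have "tor (w + (p - v)) = y"
        using tor_translate[of p v w] vw by (simp add: p_def)
      moreover have "dist p (w + (p - v)) = dist v w"
        by (simp add: dist_norm)
      ultimately show ?thesis using vw by metis
    qed
    obtain w where w: "tor w = y" "dist p w < 1/2" using near[of "1/2"] by auto
    have "p = w"
    proof (rule ccontr)
      assume "p \<noteq> w"
      then obtain u where u: "tor u = y" "dist p u < dist p w"
        using near[of "dist p w"] by auto
      have "dist u w < 1"
        using dist_triangle[of u w p] w u by (simp add: dist_commute)
      then have *: "\<bar>u $ i - w $ i\<bar> < 1" for i
        using component_le_norm_cart[of "u - w" i] by (simp add: dist_norm)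
      have "u $ i = w $ i" for i
        using * u w by (metis tor_eq_iff Ints_nonzero_abs_less1 right_minus_eq)
      then have "u = w" by (simp add: vec_eq_iff)
      with u show False by simp
    qed
    with w show "x = y" using tor_rep[of x] by (metis p_def)
  qed (simp add: refl)
  show "dist x y \<le> dist x z + dist y z"
  proof (rule field_le_epsilon)
    fix e :: real assume "e > 0"
    obtain u w where uw: "tor u = x" "tor w = z" "dist u w < dist x z + e/2"
      using dist_torus_less_iff[of x z "dist x z + e/2"] \<open>e > 0\<close> by auto
    obtain v w' where vw: "tor v = y" "tor w' = z" "dist v w' < dist y z + e/2"
      using dist_torus_less_iff[of y z "dist y z + e/2"] \<open>e > 0\<close> by auto
    have "tor (v + (w - w')) = y"
      using tor_translate[of w w' v] uw vw by simp
    moreover have "dist u (v + (w - w')) \<le> dist u w + dist v w'"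
      using dist_triangle[of u "v + (w - w')" w] by (simp add: dist_norm norm_minus_commute algebra_simps)
    ultimately have "dist x y < dist x z + dist y z + e"
      using uw vw dist_torus_less_iff[of x y "dist x z + dist y z + e"] by force
    then show "dist x y \<le> dist x z + dist y z + e" by simp
  qed
qed

end

section \<open>Differentiable maps of the torus\<close>

text \<open>
  All tangent spaces are identified with the plane by translation. The derivative of a map at
  \<open>tor p\<close> is the derivative at \<open>p\<close> of a lift of the map to the plane near \<open>p\<close>.
\<close>

definition has_torus_derivative ::
  "(torus \<Rightarrow> torus) \<Rightarrow> (real ^ 2 \<Rightarrow> real ^ 2) \<Rightarrow> torus \<Rightarrow> bool" where
  "has_torus_derivative f L x \<longleftrightarrow>
     (\<exists>p F. tor p = x \<and> (\<forall>\<^sub>F v in nhds p. f (tor v) = tor (F v)) \<and> (F has_derivative L) (at p))"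

definition torus_derivative :: "(torus \<Rightarrow> torus) \<Rightarrow> torus \<Rightarrow> real ^ 2 \<Rightarrow> real ^ 2" where
  "torus_derivative f x = (SOME L. has_torus_derivative f L x)"

definition torus_C1 :: "(torus \<Rightarrow> torus) \<Rightarrow> bool" where
  "torus_C1 f \<longleftrightarrow>
     (\<exists>D :: torus \<Rightarrow> ((real ^ 2) \<Rightarrow>\<^sub>L (real ^ 2)).
        continuous_on UNIV D \<and> (\<forall>x. has_torus_derivative f (blinfun_apply (D x)) x))"

definition torus_diffeo :: "(torus \<Rightarrow> torus) \<Rightarrow> bool" where
  "torus_diffeo f \<longleftrightarrow> bij f \<and> torus_C1 f \<and> torus_C1 (inv f)"

definition iter :: "('a \<Rightarrow> 'a) \<Rightarrow> int \<Rightarrow> 'a \<Rightarrow> 'a" where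
  "iter f t = (if t \<ge> 0 then f ^^ nat t else inv f ^^ nat (- t))"

section \<open>Invariant measures and entropy\<close>

definition M_inv :: "('a::topological_space \<Rightarrow> 'a) \<Rightarrow> 'a measure set" where
  "M_inv f = {\<nu>. prob_space \<nu> \<and> sets \<nu> = sets borel \<and> distr \<nu> borel f = \<nu>}"

definition M_inv_on :: "'a::topological_space set \<Rightarrow> ('a \<Rightarrow> 'a) \<Rightarrow> 'a measure set" where
  "M_inv_on Z f = {\<nu> \<in> M_inv f. measure \<nu> Z = 1}"

definition ergodic :: "('a::topological_space \<Rightarrow> 'a) \<Rightarrow> 'a measure \<Rightarrow> bool" where
  "ergodic f \<nu> \<longleftrightarrow>
     \<nu> \<in> M_inv f \<and> (\<forall>A \<in> sets borel. f -` A = A \<longrightarrow> measure \<nu> A = 0 \<or> measure \<nu> A = 1)"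

definition weak_star :: "('a::topological_space \<Rightarrow> 'a) \<Rightarrow> 'a measure topology" where
  "weak_star f = topology_generated_by
     {{\<nu> \<in> M_inv f. (\<integral>x. \<phi> x \<partial>\<nu>) \<in> V} |(\<phi> :: 'a \<Rightarrow> real) V. continuous_on UNIV \<phi> \<and> open V}"

definition partition_entropy :: "'a measure \<Rightarrow> 'a set set \<Rightarrow> real" where
  "partition_entropy \<nu> P = - (\<Sum>A\<in>P. measure \<nu> A * ln (measure \<nu> A))"

definition join_partition :: "('a \<Rightarrow> 'a) \<Rightarrow> 'a set set \<Rightarrow> nat \<Rightarrow> 'a set set" where
  "join_partition f P n = {\<Inter>i<n. (f ^^ i) -` a i |a. \<forall>i<n. a i \<in> P} - {{}}"

definition entropy_wrt :: "('a \<Rightarrow> 'a) \<Rightarrow> 'a measure \<Rightarrow> 'a set set \<Rightarrow> real" where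
  "entropy_wrt f \<nu> P = lim (\<lambda>n. partition_entropy \<nu> (join_partition f P n) / n)"

definition ks_entropy :: "('a::topological_space \<Rightarrow> 'a) \<Rightarrow> 'a measure \<Rightarrow> ereal" where
  "ks_entropy f \<nu> =
     (SUP P \<in> {P. finite P \<and> P \<subseteq> sets borel \<and> partition_on UNIV P}. ereal (entropy_wrt f \<nu> P))"

definition maximal_entropy_measure :: "('a::topological_space \<Rightarrow> 'a) \<Rightarrow> 'a measure \<Rightarrow> bool" where
  "maximal_entropy_measure f \<mu> \<longleftrightarrow> \<mu> \<in> M_inv f \<and> (\<forall>\<nu> \<in> M_inv f. ks_entropy f \<nu> \<le> ks_entropy f \<mu>)"

definition supp :: "'a::topological_space measure \<Rightarrow> 'a set" where
  "supp \<mu> = {x. \<forall>U. open U \<and> x \<in> U \<longrightarrow> emeasure \<mu> U > 0}"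

section \<open>Katok diffeomorphisms\<close>

definition cat_matrix :: "real ^ 2 ^ 2" where
  "cat_matrix = vector [vector [2, 1], vector [1, 1]]"

lift_definition cat_map :: "torus \<Rightarrow> torus" is "\<lambda>v. cat_matrix *v v"
proof -
  fix v w :: "real ^ 2"
  assume *: "\<And>i. v $ i - w $ i \<in> \<int>"
  have "2 * (v $ 1 - w $ 1) + (v $ 2 - w $ 2) \<in> \<int>" "(v $ 1 - w $ 1) + (v $ 2 - w $ 2) \<in> \<int>"
    using * by (intro Ints_add Ints_mult; simp)+
  then show "(cat_matrix *v v) $ i - (cat_matrix *v w) $ i \<in> \<int>" for i
    using exhaust_2[of i]
    by (auto simp: cat_matrix_def matrix_vector_mult_def sum_2 algebra_simps)
qed

definition cat_lambda :: real where
  "cat_lambda = (3 + sqrt 5) / 2"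

definition golden :: real where
  "golden = (1 + sqrt 5) / 2"

definition e_unstable :: "real ^ 2" where
  "e_unstable = (1 / sqrt (golden\<^sup>2 + 1)) *\<^sub>R vector [golden, 1]"

definition e_stable :: "real ^ 2" where
  "e_stable = (1 / sqrt (golden\<^sup>2 + 1)) *\<^sub>R vector [- 1, golden]"

lemma golden_sq: "golden\<^sup>2 = golden + 1"
proof -
  have "sqrt 5 * sqrt 5 = (5::real)" by simp
  then show ?thesis unfolding golden_def by (simp add: power2_eq_square field_simps)
qed

lemma cat_lambda_golden: "cat_lambda = golden + 1" "inverse cat_lambda = 2 - golden"
proof -
  show 1: "cat_lambda = golden + 1"
    by (simp add: cat_lambda_def golden_def field_simps)
  have "cat_lambda * (2 - golden) = 1"
    using golden_sq by (simp add: 1 power2_eq_square algebra_simps)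
  then show "inverse cat_lambda = 2 - golden"
    by (rule inverse_unique)
qed

lemma eigenvectors:
  "cat_matrix *v e_unstable = cat_lambda *\<^sub>R e_unstable"
  "cat_matrix *v e_stable = inverse cat_lambda *\<^sub>R e_stable"
proof -
  have sq: "golden * golden = golden + 1" using golden_sq by (simp add: power2_eq_square)
  define u s :: "real ^ 2" where "u = vector [golden, 1]" and "s = vector [- 1, golden]"
  have u: "cat_matrix *v u = cat_lambda *\<^sub>R u"
    unfolding cat_lambda_golden(1) using sq
    by (simp add: u_def vec_eq_iff forall_2 cat_matrix_def matrix_vector_mult_def sum_2 algebra_simps)
  have s: "cat_matrix *v s = inverse cat_lambda *\<^sub>R s"
    unfolding cat_lambda_golden(2) using sq
    by (simp add: s_def vec_eq_iff forall_2 cat_matrix_def matrix_vector_mult_def sum_2 algebra_simps)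
  show "cat_matrix *v e_unstable = cat_lambda *\<^sub>R e_unstable"
    using u by (simp add: e_unstable_def u_def matrix_vector_mult_scaleR)
  show "cat_matrix *v e_stable = inverse cat_lambda *\<^sub>R e_stable"
    using s by (simp add: e_stable_def s_def matrix_vector_mult_scaleR)
qed

lemma eigenvectors_orthonormal:
  "norm e_unstable = 1" "norm e_stable = 1" "e_unstable \<bullet> e_stable = 0"
proof -
  have "golden\<^sup>2 + 1 > 0" by (simp add: add_nonneg_pos)
  then show "norm e_unstable = 1" "norm e_stable = 1" "e_unstable \<bullet> e_stable = 0"
    by (simp_all add: e_unstable_def e_stable_def norm_eq_sqrt_inner inner_vec_def sum_2
        power2_eq_square flip: add_divide_distrib)
qed

definition eigen_chart :: "real \<times> real \<Rightarrow> torus" where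
  "eigen_chart s = tor (fst s *\<^sub>R e_unstable + snd s *\<^sub>R e_stable)"

text \<open>For \<open>r < 1/2\<close> the chart is injective on \<open>cball 0 r\<close>.\<close>

definition eigen_disk :: "real \<Rightarrow> torus set" where
  "eigen_disk r = eigen_chart ` cball 0 r"

definition katok_field :: "(real \<Rightarrow> real) \<Rightarrow> real \<times> real \<Rightarrow> real \<times> real" where
  "katok_field \<kappa> = (\<lambda>(s1, s2).
     (s1 * \<kappa> (s1\<^sup>2 + s2\<^sup>2) * ln cat_lambda, - s2 * \<kappa> (s1\<^sup>2 + s2\<^sup>2) * ln cat_lambda))"

text \<open>\<open>q\<close> is the position at time 1 of a solution of \<open>s' = X s\<close> that starts at \<open>p\<close>.\<close>

definition time_one :: "('a::real_normed_vector \<Rightarrow> 'a) \<Rightarrow> 'a \<Rightarrow> 'a \<Rightarrow> bool" where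
  "time_one X p q \<longleftrightarrow>
     (\<exists>\<sigma>. \<sigma> 0 = p \<and> \<sigma> 1 = q \<and>
          (\<forall>t\<in>{0..1}. (\<sigma> has_vector_derivative X (\<sigma> t)) (at t within {0..1})))"

text \<open>
  Only the values of \<open>\<kappa>\<close> on the unit interval are used. Smoothness on the open interval suffices,
  as \<open>\<kappa>\<close> is constant near \<open>1\<close>; the function is understood to be continuous at its exceptional
  point \<open>0\<close>.
\<close>

definition katok_profile :: "real \<Rightarrow> (real \<Rightarrow> real) \<Rightarrow> bool" where
  "katok_profile r0 \<kappa> \<longleftrightarrow>
     0 < r0 \<and> r0 < 1 \<and>
     continuous_on {0..1} \<kappa> \<and>
     (\<forall>n. \<forall>u\<in>{0<..<1}. (deriv ^^ n) \<kappa> differentiable (at u)) \<and>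
     \<kappa> 0 = 0 \<and> (\<forall>u\<in>{r0..1}. \<kappa> u = 1) \<and>
     (\<forall>u\<in>{0<..<r0}. deriv \<kappa> u > 0) \<and>
     set_integrable lborel {0..1} (\<lambda>u. 1 / \<kappa> u)"

text \<open>
  The bound on \<open>r1\<close> makes the chart injective on \<open>cball 0 (cat_lambda * r1)\<close>, which contains every
  orbit segment of time length 1 that starts in \<open>cball 0 r1\<close>. That \<open>r0\<close> is small relative to \<open>r1\<close>
  is implied by the last conjunct: for \<open>cat_lambda * sqrt r0 > r1\<close> the two branches do not match on
  the boundary of the disk.

  The last conjunct is what Katok's conditions on the convergence of the integral of \<open>1 / \<kappa>\<close> are
  imposed for. Infinite differentiability at the origin cannot be meant here: on an eigendirection
  \<open>f\<close> is odd with derivative 1 at \<open>0\<close>, so three derivatives at the origin would give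
  \<open>\<kappa> u \<le> C * u\<close> near \<open>0\<close>, and \<open>1 / \<kappa>\<close> would not be integrable.
\<close>

definition katok_diffeo :: "(torus \<Rightarrow> torus) \<Rightarrow> bool" where
  "katok_diffeo f \<longleftrightarrow>
     (\<exists>\<kappa> r0 r1 g.
        katok_profile r0 \<kappa> \<and> r0 < r1 \<and> cat_lambda * r1 < 1/2 \<and>
        (\<forall>s\<in>cball 0 r1. time_one (katok_field \<kappa>) s (g s)) \<and>
        (\<forall>s\<in>cball 0 r1. f (eigen_chart s) = eigen_chart (g s)) \<and>
        (\<forall>x. x \<notin> eigen_disk r1 \<longrightarrow> f x = cat_map x) \<and>
        torus_diffeo f)"

definition katok_measure :: "(torus \<Rightarrow> torus) \<Rightarrow> torus measure \<Rightarrow> bool" where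
  "katok_measure f \<nu>\<^sub>0 \<longleftrightarrow>
     (\<exists>\<mu> \<pi> \<pi>'. maximal_entropy_measure cat_map \<mu> \<and> homeomorphism UNIV UNIV \<pi> \<pi>' \<and>
        \<pi> \<circ> cat_map = f \<circ> \<pi> \<and> \<nu>\<^sub>0 = distr \<mu> borel \<pi>)"

section \<open>Pesin blocks\<close>

definition restr_norm :: "('a::real_normed_vector \<Rightarrow> 'b::real_normed_vector) \<Rightarrow> 'a set \<Rightarrow> real" where
  "restr_norm L E = (SUP v \<in> {v \<in> E. norm v \<le> 1}. norm (L v))"

text \<open>
  Angles between subspaces lie between \<open>0\<close> and \<open>pi / 2\<close>; adding \<open>pi / 2\<close> to the set only matters
  when one of the subspaces is trivial, and then there is no constraint on the angle.
\<close>

definition subspace_angle :: "'a::real_inner set \<Rightarrow> 'a set \<Rightarrow> real" where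
  "subspace_angle E F = Inf (insert (pi / 2)
     {arccos ((v \<bullet> w) / (norm v * norm w)) |v w. v \<in> E - {0} \<and> w \<in> F - {0}})"

text \<open>\<open>tan (pi / 2)\<close> is \<open>0\<close> in HOL.\<close>

definition tan_ereal :: "real \<Rightarrow> ereal" where
  "tan_ereal \<theta> = (if \<theta> = pi / 2 then \<infinity> else ereal (tan \<theta>))"

definition pesin_block :: "(torus \<Rightarrow> torus) \<Rightarrow> real \<Rightarrow> real \<Rightarrow> real \<Rightarrow> nat \<Rightarrow> torus set" where
  "pesin_block f \<beta>\<^sub>1 \<beta>\<^sub>2 \<epsilon> k = {x. \<exists>Es Eu.
     subspace Es \<and> subspace Eu \<and> Es \<inter> Eu = {0} \<and> {v + w |v w. v \<in> Es \<and> w \<in> Eu} = UNIV \<and>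
     (\<forall>t :: int.
        let y = iter f t x;
            Est = torus_derivative (iter f t) x ` Es;
            Eut = torus_derivative (iter f t) x ` Eu
        in (\<forall>n :: nat. n \<ge> 1 \<longrightarrow>
              restr_norm (torus_derivative (iter f (int n)) y) Est
                \<le> exp (\<epsilon> * k) * exp (- (\<beta>\<^sub>1 - \<epsilon>) * n) * exp (\<epsilon> * \<bar>t\<bar>) \<and>
              restr_norm (torus_derivative (iter f (- int n)) y) Eut
                \<le> exp (\<epsilon> * k) * exp (- (\<beta>\<^sub>2 - \<epsilon>) * n) * exp (\<epsilon> * \<bar>t\<bar>)) \<and>
           tan_ereal (subspace_angle Est Eut) \<ge> ereal (exp (- \<epsilon> * k) * exp (- \<epsilon> * \<bar>t\<bar>)))}"

text \<open>
  The library's \<open>uniform_measure\<close> is the conditional measure; it is the zero measure, with empty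
  support, when the block is a null set.
\<close>

definition pesin_set :: "(torus \<Rightarrow> torus) \<Rightarrow> torus measure \<Rightarrow> real \<Rightarrow> real \<Rightarrow> real \<Rightarrow> torus set" where
  "pesin_set f \<nu> \<beta>\<^sub>1 \<beta>\<^sub>2 \<epsilon> = (\<Union>k\<in>{1..}. supp (uniform_measure \<nu> (pesin_block f \<beta>\<^sub>1 \<beta>\<^sub>2 \<epsilon> k)))"

section \<open>Birkhoff sums and Bowen balls\<close>

definition birkhoff_sum :: "('a \<Rightarrow> 'a) \<Rightarrow> ('a \<Rightarrow> real) \<Rightarrow> nat \<Rightarrow> 'a \<Rightarrow> real" where
  "birkhoff_sum f \<phi> n x = (\<Sum>i<n. \<phi> ((f ^^ i) x))"

definition bowen_ball :: "('a::metric_space \<Rightarrow> 'a) \<Rightarrow> nat \<Rightarrow> 'a \<Rightarrow> real \<Rightarrow> 'a set" where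
  "bowen_ball f n x r = {y. \<forall>i<n. dist ((f ^^ i) x) ((f ^^ i) y) < r}"

definition V_plus :: "('a::metric_space \<Rightarrow> 'a) \<Rightarrow> 'a measure \<Rightarrow> ('a \<Rightarrow> real) set" where
  "V_plus f m = {\<psi>. continuous_on UNIV \<psi> \<and>
     (\<exists>C>0. \<exists>r>0. \<forall>x n. measure m (bowen_ball f n x r) \<le> C * exp (- birkhoff_sum f \<psi> n x))}"

definition V_minus :: "('a::metric_space \<Rightarrow> 'a) \<Rightarrow> 'a measure \<Rightarrow> ('a \<Rightarrow> real) set" where
  "V_minus f m = {\<psi>. continuous_on UNIV \<psi> \<and>
     (\<forall>\<delta>>0. \<exists>r>0. r < \<delta> \<and>
        (\<exists>C>0. \<forall>x n. measure m (bowen_ball f n x r) \<ge> C * exp (- birkhoff_sum f \<psi> n x)))}"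

text \<open>Needed because \<open>ln 0\<close> is \<open>0\<close> in HOL.\<close>

definition log_ereal :: "real \<Rightarrow> ereal" where
  "log_ereal x = (if x = 0 then - \<infinity> else ereal (ln x))"

end

theory Submission
  imports Defs
begin

text \<open>
  The map \<open>f\<close> is conjugate to the cat map \<open>A\<close> by a homeomorphism \<open>\<pi>\<close>. Hence \<open>f\<close> is
  continuous and inherits from \<open>A\<close> the gluing of orbit segments: finitely many orbit segments of
  a common length are followed, one after the other, by one orbit, with gaps that depend only on
  the accuracy (\<open>block_specification\<close>). For \<open>A\<close> this is linear algebra. A point is moved along the
  unstable direction, which is harmless in the past, until the future orbit lands on the stable
  line of the next segment; to find such a crossing, the displacement between the two
  segments is pulled back by \<open>n\<close> steps, rounded to the integer lattice, which \<open>A ^^ n\<close> maps into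
  itself, and pushed forward again, which makes the stable part of the rounding error
  exponentially small (\<open>cat_map_crossing\<close>). The two inequalities are instances of general ones: the upper bound is
  proved for continuous maps of spaces that are continuous images of the unit interval, the lower
  bound for continuous maps of compact spaces with the gluing property.

  Upper bound (\<open>large_deviation_upper_bound\<close>). This is the variational principle of
  Misiurewicz, with weights. Cover \<open>{S\<^sub>n \<phi> \<ge> c n}\<close> by Bowen balls around a maximal separated
  subset \<open>E\<close>; by the definition of \<open>V_plus\<close> the measure of the set is at most a constant times
  \<open>\<Sum>x\<in>E. exp (- S\<^sub>n \<psi> x)\<close>. The probability on \<open>E\<close> with these weights has entropy equal to the
  logarithm of that sum plus the mean of \<open>S\<^sub>n \<psi>\<close>. Averaging along the orbit and passing to a
  weak limit gives an invariant \<open>\<nu>\<close> with \<open>\<integral>\<phi> d\<nu> \<ge> c\<close> for which \<open>h - \<integral>\<psi> d\<nu>\<close> is at least the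
  growth rate. Weak limits on the torus are pulled back from Helly's theorem on the line by a
  space-filling curve: measures on the torus are lifted to \<open>[0, 1]\<close> through a section of the
  curve, and a limit on the line is pushed forward.

  Lower bound (\<open>large_deviation_lower_bound\<close>). Fix an invariant \<open>\<nu>\<close>, a long time \<open>M\<close>, and code
  points by the centre of a Bowen ball of length \<open>M\<close> that contains them, the centres being
  separated. The code is a random variable whose entropy is at least about \<open>M * h\<close>
  (\<open>itinerary_entropy_le_code\<close>). Words of \<open>K\<close> independent codes satisfy the weak law of large
  numbers, so there are enough words with nearly the right averages of \<open>\<phi>\<close> and \<open>\<psi>\<close>
  (\<open>typical_words\<close>). Gluing the orbit segments of a word yields a point; points of different
  words are separated, their Bowen balls are disjoint and lie in \<open>{S\<^sub>n \<phi> > c n}\<close>, and the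
  definition of \<open>V_minus\<close> bounds the measure of each ball from below. As the codes are
  concatenated independently, the estimate applies to an invariant \<open>\<nu>\<close> directly, without passing
  through its ergodic components.
\<close>

section \<open>Entropy of finite observables\<close>

text \<open>
  Shannon entropy of a finite-valued map, in nats. Ranging over maps instead of partitions makes
  the join of two partitions a pair and refinement a factorization; the sum over \<open>range X\<close>
  is meaningful only when that range is finite.
\<close>

definition obs_entropy :: "'a measure \<Rightarrow> ('a \<Rightarrow> 'b) \<Rightarrow> real" where
  "obs_entropy M X = (\<Sum>v\<in>range X. - (measure M (X -` {v}) * ln (measure M (X -` {v}))))"

lemma obs_entropy_eq_entropy:
  assumes "prob_space M" "space M = UNIV" "simple_function M X"
  shows "obs_entropy M X = prob_space.entropy M (exp 1) (count_space (X ` space M)) X"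
proof -
  interpret prob_space M by fact
  interpret information_space M "exp 1" by unfold_locales simp
  have "entropy (exp 1) (count_space (X ` space M)) X
      = - (\<Sum>x\<in>X ` space M. prob (X -` {x} \<inter> space M) * log (exp 1) (prob (X -` {x} \<inter> space M)))"
    by (rule entropy_simple_distributed[OF simple_distributedI[OF assms(3) measure_nonneg refl]])
  then show ?thesis
    by (simp add: obs_entropy_def assms(2) log_def sum_negf)
qed

text \<open>
  A coarser observable is a function of a finer one, and processing data loses information.
\<close>

lemma obs_entropy_factor_le:
  assumes M: "prob_space M" "space M = UNIV" "simple_function M Y"
    and XY: "\<And>x y. Y x = Y y \<Longrightarrow> X x = X y"
  shows "obs_entropy M X \<le> obs_entropy M Y"
proof -
  interpret prob_space M by fact
  interpret information_space M "exp 1" by unfold_locales simp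
  have X: "X = (\<lambda>v. X (SOME x. Y x = v)) \<circ> Y"
  proof
    fix x
    have "Y (SOME z. Y z = Y x) = Y x" by (rule someI) simp
    then show "X x = ((\<lambda>v. X (SOME x. Y x = v)) \<circ> Y) x"
      using XY by (metis comp_apply)
  qed
  have "obs_entropy M ((\<lambda>v. X (SOME x. Y x = v)) \<circ> Y) \<le> obs_entropy M Y"
    using entropy_data_processing[OF M(3), of "\<lambda>v. X (SOME x. Y x = v)"]
    by (subst (1 2) obs_entropy_eq_entropy) (use M in \<open>auto intro: simple_function_compose[unfolded comp_def]\<close>)
  then show ?thesis by (subst X)
qed

lemma obs_entropy_Pair_le:
  assumes M: "prob_space M" "space M = UNIV" "simple_function M X" "simple_function M Y"
  shows "obs_entropy M (\<lambda>x. (X x, Y x)) \<le> obs_entropy M X + obs_entropy M Y"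
proof -
  interpret prob_space M by fact
  interpret information_space M "exp 1" by unfold_locales simp
  show ?thesis
    using entropy_chain_rule[OF M(3,4)] conditional_entropy_less_eq_entropy[OF M(4,3)]
    by (simp add: obs_entropy_eq_entropy[OF M(1,2)] M simple_function_Pair)
qed

lemma obs_entropy_nonneg:
  assumes "prob_space M"
  shows "0 \<le> obs_entropy M X"
proof -
  interpret prob_space M by fact
  have "prob A * ln (prob A) \<le> 0" for A
    using prob_le_1[of A] by (cases "prob A = 0") (auto simp: mult_le_0_iff zero_less_measure_iff)
  then show ?thesis
    unfolding obs_entropy_def by (intro sum_nonneg) simp
qed

lemma obs_entropy_le_ln_card:
  assumes "prob_space M" "space M = UNIV" "simple_function M X"
  shows "obs_entropy M X \<le> ln (card (range X))"
proof -
  interpret prob_space M by fact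
  interpret information_space M "exp 1" by unfold_locales simp
  show ?thesis
    using entropy_le_card[OF simple_distributedI[OF assms(3) measure_nonneg refl]] assms
    by (simp add: obs_entropy_eq_entropy log_def)
qed

lemma obs_entropy_sum_superset:
  assumes "finite V" "range X \<subseteq> V"
  shows "obs_entropy M X = (\<Sum>v\<in>V. - (measure M (X -` {v}) * ln (measure M (X -` {v}))))"
  unfolding obs_entropy_def
proof (rule sum.mono_neutral_left)
  show "\<forall>v\<in>V - range X. - (measure M (X -` {v}) * ln (measure M (X -` {v}))) = 0"
  proof
    fix v assume "v \<in> V - range X"
    then have "X -` {v} = {}" by auto
    then show "- (measure M (X -` {v}) * ln (measure M (X -` {v}))) = 0" by simp
  qed
qed (use assms in auto)

lemma obs_entropy_comp_invariant:
  assumes T: "T \<in> measurable M M" "distr M M T = M" and sp: "space M = UNIV"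
    and X: "simple_function M X"
  shows "obs_entropy M (X \<circ> T) = obs_entropy M X"
proof -
  have fin: "finite (range X)" and meas: "X -` {v} \<in> sets M" for v
    using X sp simple_functionD[OF X] by auto
  have "measure M ((X \<circ> T) -` {v}) = measure M (X -` {v})" for v
    using measure_distr[OF T(1) meas[of v]] T(2) sp by (simp add: vimage_comp)
  then show ?thesis
    by (subst (1 2) obs_entropy_sum_superset[of "range X"]) (use fin in auto)
qed

text \<open>
  Used with \<open>v\<close> as a symbol for "no error". Every other value has probability at most \<open>\<eta>\<close> and
  contributes at most \<open>2 * sqrt \<eta>\<close>, because \<open>- t * ln t \<le> 2 * sqrt t\<close>; the value \<open>v\<close>
  contributes at most \<open>1 - p\<close>, where \<open>p\<close> is its probability, because \<open>- p * ln p \<le> 1 - p\<close>.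
\<close>

lemma obs_entropy_rare_le:
  assumes M: "prob_space M" "space M = UNIV" "simple_function M X"
    and rare: "measure M (X -` (- {v})) \<le> \<eta>" and card: "card (range X) \<le> k"
  shows "obs_entropy M X \<le> 2 * k * sqrt \<eta> + \<eta>"
proof -
  interpret prob_space M by fact
  have fin: "finite (range X)" and meas: "X -` V \<in> sets M" for V
    using M simple_functionD[OF M(3)] simple_functionD(2)[OF M(3), of V] by auto
  have \<eta>: "0 \<le> \<eta>" using rare measure_nonneg[of M] by (rule order_trans[rotated])
  let ?h = "\<lambda>w. - (prob (X -` {w}) * ln (prob (X -` {w})))"
  have other: "?h w \<le> 2 * sqrt \<eta>" if "w \<noteq> v" for w
  proof (cases "prob (X -` {w}) = 0")
    case False
    define t where "t = sqrt (prob (X -` {w}))"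
    have t: "t > 0" "prob (X -` {w}) = t * t" using False by (auto simp: t_def zero_less_measure_iff)
    have "prob (X -` {w}) \<le> prob (X -` (- {v}))"
      using that by (intro finite_measure_mono meas) auto
    then have "t \<le> sqrt \<eta>" using rare by (simp add: t_def)
    have "- ln t \<le> 1 / t" using ln_le_minus_one[of "1 / t"] t by (simp add: ln_div)
    then have "2 * (t * t) * (- ln t) \<le> 2 * (t * t) * (1 / t)"
      using t by (intro mult_left_mono) auto
    then show ?thesis using t \<open>t \<le> sqrt \<eta>\<close> by (simp add: ln_mult)
  qed (use \<eta> in auto)
  have main: "?h v \<le> \<eta>"
  proof (cases "prob (X -` {v}) = 0")
    case False
    define p where "p = prob (X -` {v})"
    have p: "p > 0" using False by (auto simp: p_def zero_less_measure_iff)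
    have "prob (X -` (- {v})) = 1 - p"
      using prob_compl[OF meas[of "{v}"]] M(2) by (simp add: p_def vimage_Diff Compl_eq_Diff_UNIV)
    moreover have "- ln p \<le> 1 / p - 1"
      using ln_le_minus_one[of "1 / p"] p by (simp add: ln_div)
    then have "p * (- ln p) \<le> p * (1 / p - 1)" using p by (intro mult_left_mono) auto
    ultimately show ?thesis using p rare by (simp add: p_def[symmetric] algebra_simps)
  qed (use \<eta> in auto)
  have "obs_entropy M X \<le> (\<Sum>w\<in>insert v (range X). ?h w)"
    by (subst obs_entropy_sum_superset[of "insert v (range X)"]) (use fin in auto)
  also have "\<dots> = ?h v + (\<Sum>w\<in>range X - {v}. ?h w)"
    using fin by (simp add: sum.insert_remove)
  also have "\<dots> \<le> \<eta> + (\<Sum>w\<in>range X - {v}. 2 * sqrt \<eta>)"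
    by (intro add_mono main sum_mono other) auto
  also have "(\<Sum>w\<in>range X - {v}. 2 * sqrt \<eta>) = card (range X - {v}) * (2 * sqrt \<eta>)" by simp
  also have "\<dots> \<le> k * (2 * sqrt \<eta>)"
    using card card_Diff1_le[of "range X" v] \<eta> by (intro mult_right_mono) auto
  finally show ?thesis by (simp add: algebra_simps)
qed

section \<open>Itineraries\<close>

definition itinerary :: "('a \<Rightarrow> 'a) \<Rightarrow> ('a \<Rightarrow> 'b) \<Rightarrow> nat \<Rightarrow> 'a \<Rightarrow> 'b list" where
  "itinerary f a n x = map (\<lambda>i. a ((f ^^ i) x)) [0..<n]"

lemma length_itinerary [simp]: "length (itinerary f a n x) = n"
  by (simp add: itinerary_def)

lemma nth_itinerary [simp]: "i < n \<Longrightarrow> itinerary f a n x ! i = a ((f ^^ i) x)"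
  by (simp add: itinerary_def)

lemma itinerary_eq_iff:
  "itinerary f a n x = itinerary f a n y \<longleftrightarrow> (\<forall>i<n. a ((f ^^ i) x) = a ((f ^^ i) y))"
  by (auto simp: list_eq_iff_nth_eq)

lemma itinerary_vimage:
  "length w = n \<Longrightarrow> itinerary f a n -` {w} = (\<Inter>i<n. (f ^^ i) -` (a -` {w ! i}))"
  by (auto simp: list_eq_iff_nth_eq)

lemma finite_range_itinerary:
  assumes "finite (range a)"
  shows "finite (range (itinerary f a n))" "card (range (itinerary f a n)) \<le> card (range a) ^ n"
proof -
  have sub: "range (itinerary f a n) \<subseteq> {w. set w \<subseteq> range a \<and> length w = n}"
    by (auto simp: itinerary_def)
  have fin: "finite {w. set w \<subseteq> range a \<and> length w = n}"
    using assms by (rule finite_lists_length_eq)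
  show "finite (range (itinerary f a n))"
    using sub fin by (rule finite_subset)
  show "card (range (itinerary f a n)) \<le> card (range a) ^ n"
    using card_mono[OF fin sub] by (simp add: card_lists_length_eq assms)
qed

lemma measurable_funpow [measurable (raw)]: "f \<in> measurable M M \<Longrightarrow> f ^^ n \<in> measurable M M"
  by (induction n) (auto simp: id_def intro: measurable_comp)

lemma distr_funpow:
  assumes f: "f \<in> measurable M M" "distr M M f = M"
  shows "distr M M (f ^^ n) = M"
proof (induction n)
  case (Suc n)
  have "distr (distr M M (f ^^ n)) M f = distr M M (f ^^ Suc n)"
    by (subst distr_distr[OF f(1) measurable_funpow[OF f(1)]]) simp
  then show ?case by (simp only: Suc f(2))
qed (simp add: id_def distr_id2)

lemma simple_function_itinerary:
  assumes sp: "space M = UNIV" and f: "f \<in> measurable M M" and a: "simple_function M a"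
  shows "simple_function M (itinerary f a n)"
  unfolding simple_function_def
proof (intro conjI ballI)
  have fin: "finite (range a)" and meas: "a -` {v} \<in> sets M" for v
    using a sp simple_functionD[OF a] by auto
  show "finite (itinerary f a n ` space M)"
    using finite_range_itinerary(1)[OF fin] sp by simp
  fix w assume "w \<in> itinerary f a n ` space M"
  then have l: "length w = n" by auto
  have "(f ^^ i) -` (a -` {w ! i}) \<in> sets M" for i
    using measurable_sets[OF measurable_funpow[OF f] meas] sp by simp
  then have "space M \<inter> (\<Inter>i<n. (f ^^ i) -` (a -` {w ! i})) \<in> sets M"
    by (cases "n = 0") (auto simp: sp simp flip: INT_extend_simps intro!: sets.finite_INT sets.top[of M, simplified sp])
  then show "itinerary f a n -` {w} \<inter> space M \<in> sets M"
    by (simp add: itinerary_vimage[OF l] sp)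
qed

lemma obs_entropy_itinerary_add:
  assumes M: "prob_space M" "space M = UNIV" and f: "f \<in> measurable M M" and a: "simple_function M a"
  shows "obs_entropy M (itinerary f a (m + n) \<circ> (f ^^ s))
      \<le> obs_entropy M (itinerary f a m \<circ> (f ^^ s)) + obs_entropy M (itinerary f a n \<circ> (f ^^ (s + m)))"
proof -
  have sf: "simple_function M (itinerary f a l \<circ> (f ^^ i))" for l i
    using simple_function_comp[OF measurable_funpow[OF f] simple_function_itinerary[OF M(2) f a]]
    by (simp add: comp_def)
  let ?Z = "\<lambda>x. ((itinerary f a m \<circ> (f ^^ s)) x, (itinerary f a n \<circ> (f ^^ (s + m))) x)"
  have "obs_entropy M (itinerary f a (m + n) \<circ> (f ^^ s)) \<le> obs_entropy M ?Z"
  proof (rule obs_entropy_factor_le[OF M simple_function_Pair[OF sf sf]])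
    fix x y assume "?Z x = ?Z y"
    then have 1: "a ((f ^^ i) ((f ^^ s) x)) = a ((f ^^ i) ((f ^^ s) y))" if "i < m" for i
      using that by (simp_all add: itinerary_eq_iff)
    from \<open>?Z x = ?Z y\<close> have 2: "a ((f ^^ i) ((f ^^ (s + m)) x)) = a ((f ^^ i) ((f ^^ (s + m)) y))" if "i < n" for i
      using that by (simp_all add: itinerary_eq_iff)
    have "a ((f ^^ i) ((f ^^ s) x)) = a ((f ^^ i) ((f ^^ s) y))" if "i < m + n" for i
      using 1[of i] 2[of "i - m"] that
      by (cases "i < m") (simp_all add: funpow_add[symmetric, THEN fun_cong, simplified comp_def] add.commute)
    then show "(itinerary f a (m + n) \<circ> (f ^^ s)) x = (itinerary f a (m + n) \<circ> (f ^^ s)) y"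
      by (simp add: itinerary_eq_iff)
  qed
  also have "\<dots> \<le> obs_entropy M (itinerary f a m \<circ> (f ^^ s)) + obs_entropy M (itinerary f a n \<circ> (f ^^ (s + m)))"
    by (rule obs_entropy_Pair_le[OF M sf sf])
  finally show ?thesis .
qed

section \<open>Entropy of a partition through itineraries\<close>

text \<open>
  Fekete's subadditive lemma: the limit is the infimum.
\<close>

lemma subadditive_limit:
  fixes u :: "nat \<Rightarrow> real"
  assumes sub: "\<And>m n. u (m + n) \<le> u m + u n" and nonneg: "\<And>n. 0 \<le> u n"
  obtains L where "(\<lambda>n. u n / n) \<longlonglongrightarrow> L" "\<And>n. n > 0 \<Longrightarrow> L \<le> u n / n"
proof
  let ?S = "(\<lambda>n. u n / n) ` {0<..}"
  define L where "L = Inf ?S"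
  have bdd: "bdd_below ?S" using nonneg by (intro bdd_belowI[of _ 0]) auto
  show low: "L \<le> u n / n" if "n > 0" for n
    unfolding L_def using that by (intro cInf_lower bdd) auto
  have mult: "u (q * m + r) \<le> q * u m + u r" for q m r
  proof (induction q)
    case (Suc q)
    have "u (Suc q * m + r) \<le> u m + u (q * m + r)"
      using sub[of m "q * m + r"] by (simp add: algebra_simps)
    with Suc show ?case by (simp add: algebra_simps)
  qed simp
  show "(\<lambda>n. u n / n) \<longlonglongrightarrow> L"
  proof (rule order_tendstoI)
    fix a assume "a < L"
    then show "\<forall>\<^sub>F n in sequentially. a < u n / n"
    proof (intro eventually_sequentiallyI[of 1])
      fix n :: nat assume "1 \<le> n"
      then show "a < u n / n" using low[of n] \<open>a < L\<close> by simp
    qed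
  next
    fix a assume "L < a"
    then obtain m where m: "m > 0" "u m / m < a"
      unfolding L_def using cInf_lessD[of ?S a] by auto
    define B where "B = (\<Sum>r<m. u r)"
    have "(\<lambda>n. u m / m + B / real n) \<longlonglongrightarrow> u m / m + 0"
      by (intro tendsto_intros lim_const_over_n)
    then have ev: "\<forall>\<^sub>F n in sequentially. u m / m + B / real n < a"
      using m by (intro order_tendstoD) auto
    have bound: "u n / n \<le> u m / m + B / n" if "n > 0" for n
    proof -
      have "u n \<le> (n div m) * u m + u (n mod m)"
        using mult[of "n div m" m "n mod m"] by simp
      also have "u (n mod m) \<le> B"
        unfolding B_def using m nonneg by (intro member_le_sum) auto
      also have "(n div m) * u m \<le> (n / m) * u m"
        using nonneg by (intro mult_right_mono) (auto simp: floor_divide_of_nat_eq[symmetric] intro: of_nat_div_le_of_nat)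
      finally show ?thesis using that by (simp add: field_simps)
    qed
    show "\<forall>\<^sub>F n in sequentially. u n / n < a"
      using ev eventually_gt_at_top[of 0] by eventually_elim (use bound in \<open>auto intro: le_less_trans\<close>)
  qed
qed

lemma partition_entropy_fibres:
  "partition_entropy \<nu> ((\<lambda>v. X -` {v}) ` range X) = obs_entropy \<nu> X"
proof -
  have "inj_on (\<lambda>v. X -` {v}) (range X)"
    by (rule inj_onI) (metis (mono_tags) rangeE vimage_singleton_eq)
  then show ?thesis
    by (simp add: partition_entropy_def obs_entropy_def sum.reindex sum_negf)
qed

text \<open>
  The empty set has to be removed from the joined partition exactly because some words are the
  itinerary of no point.
\<close>

lemma join_partition_fibres:
  "join_partition f ((\<lambda>v. a -` {v}) ` range a) n
     = (\<lambda>w. itinerary f a n -` {w}) ` range (itinerary f a n)" (is "join_partition f ?P n = ?R")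
proof
  show "?R \<subseteq> join_partition f ?P n"
  proof
    fix A assume "A \<in> ?R"
    then obtain x where x: "A = itinerary f a n -` {itinerary f a n x}" by auto
    then have "A = (\<Inter>i<n. (f ^^ i) -` (a -` {a ((f ^^ i) x)}))"
      by (subst (asm) itinerary_vimage) auto
    moreover have "A \<noteq> {}" using x by auto
    ultimately show "A \<in> join_partition f ?P n"
      unfolding join_partition_def
      by (intro DiffI CollectI exI[of _ "\<lambda>i. a -` {a ((f ^^ i) x)}"]) auto
  qed
  show "join_partition f ?P n \<subseteq> ?R"
  proof
    fix A assume "A \<in> join_partition f ?P n"
    then obtain c where c: "A = (\<Inter>i<n. (f ^^ i) -` c i)" "\<forall>i<n. c i \<in> ?P" and "A \<noteq> {}"
      unfolding join_partition_def by (elim DiffE CollectE exE conjE) auto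
    then obtain x where x: "x \<in> A" by auto
    have "c i = a -` {a ((f ^^ i) x)}" if "i < n" for i
    proof -
      have "(f ^^ i) x \<in> c i" using x c that by blast
      moreover obtain y where "c i = a -` {a y}" using c(2) \<open>i < n\<close> by blast
      ultimately show ?thesis by simp
    qed
    then have "A = (\<Inter>i<n. (f ^^ i) -` (a -` {itinerary f a n x ! i}))"
      unfolding c(1) by (intro INF_cong refl) (simp only: lessThan_iff nth_itinerary)
    then have "A = itinerary f a n -` {itinerary f a n x}"
      by (simp only: itinerary_vimage length_itinerary)
    then show "A \<in> ?R" by (rule image_eqI[OF _ rangeI])
  qed
qed

text \<open>
  Invariance makes the entropy of itineraries subadditive in their length. So the limit in the
  definition of \<open>entropy_wrt\<close> exists, and it bounds every quotient from below.
\<close>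

lemma entropy_wrt_fibres:
  assumes M: "prob_space \<nu>" "space \<nu> = UNIV" and f: "f \<in> measurable \<nu> \<nu>" "distr \<nu> \<nu> f = \<nu>"
    and a: "simple_function \<nu> a"
  defines "h \<equiv> entropy_wrt f \<nu> ((\<lambda>v. a -` {v}) ` range a)"
  shows "(\<lambda>n. obs_entropy \<nu> (itinerary f a n) / n) \<longlonglongrightarrow> h"
    and "n > 0 \<Longrightarrow> h \<le> obs_entropy \<nu> (itinerary f a n) / n"
proof -
  let ?u = "\<lambda>n. obs_entropy \<nu> (itinerary f a n)"
  have "?u (m + n) \<le> ?u m + ?u n" for m n
    using obs_entropy_itinerary_add[OF M f(1) a, of m n 0]
      obs_entropy_comp_invariant[OF measurable_funpow[OF f(1)] distr_funpow[OF f] M(2) simple_function_itinerary[OF M(2) f(1) a], of n m]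
    by (simp add: id_def comp_def)
  from subadditive_limit[of ?u, OF this obs_entropy_nonneg[OF M(1)]]
  obtain L where L: "(\<lambda>n. ?u n / n) \<longlonglongrightarrow> L" "\<And>n. n > 0 \<Longrightarrow> L \<le> ?u n / n"
    by blast
  have "h = lim (\<lambda>n. ?u n / n)"
    by (simp add: h_def entropy_wrt_def join_partition_fibres partition_entropy_fibres)
  then have "h = L" using L(1) by (simp add: limI)
  then show "(\<lambda>n. ?u n / n) \<longlonglongrightarrow> h" "n > 0 \<Longrightarrow> h \<le> ?u n / n"
    using L by auto
qed

lemma partition_eq_fibres:
  assumes "partition_on UNIV P"
  obtains a :: "'a \<Rightarrow> 'a set" where "P = (\<lambda>v. a -` {v}) ` range a" "range a = P" "\<And>v. v \<in> P \<Longrightarrow> a -` {v} = v"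
proof
  define a where "a x = (THE A. A \<in> P \<and> x \<in> A)" for x
  have a: "a x = A" if "A \<in> P" "x \<in> A" for x A
    unfolding a_def using assms that by (intro the_equality) (auto simp: partition_on_def disjoint_def)
  have ex: "\<exists>A\<in>P. x \<in> A" for x using assms by (auto simp: partition_on_def)
  show fib: "a -` {v} = v" if "v \<in> P" for v
    using a ex that by (auto, metis)
  show ran: "range a = P"
  proof
    show "range a \<subseteq> P" using a ex by (metis image_subsetI)
    show "P \<subseteq> range a"
    proof
      fix A assume A: "A \<in> P"
      then have "A \<noteq> {}" using assms by (auto simp: partition_on_def)
      then obtain x where "x \<in> A" by auto
      then show "A \<in> range a" using a[OF A] by (metis rangeI)
    qed
  qed
  show "P = (\<lambda>v. a -` {v}) ` range a" unfolding ran using image_cong[of P P "\<lambda>v. a -` {v}" "\<lambda>v. v"] fib by simp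
qed

section \<open>Entropy of orbit averages\<close>

text \<open>
  Think of \<open>H n s\<close> as the entropy of the itinerary of length \<open>n\<close> that starts at time \<open>s\<close>. Cut it
  into blocks of length \<open>q\<close>; the last block may overshoot, which only increases the entropy.
\<close>

lemma subadditive_blocks:
  fixes H :: "nat \<Rightarrow> nat \<Rightarrow> real"
  assumes sub: "\<And>m n s. H (m + n) s \<le> H m s + H n (s + m)"
    and mono: "\<And>m n s. m \<le> n \<Longrightarrow> H m s \<le> H n s" and zero: "\<And>s. H 0 s = 0" and "q > 0"
  shows "H n s \<le> (\<Sum>i | i < n \<and> q dvd i. H q (s + i))"
proof (induction n arbitrary: s rule: less_induct)
  case (less n)
  consider "n = 0" | "0 < n" "n \<le> q" | "q < n" by linarith
  then show ?case
  proof cases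
    case 1
    then show ?thesis using zero by simp
  next
    case 2
    have "\<not> q dvd i" if "i < n" "i > 0" for i
      using that 2 dvd_imp_le[of q i] by auto
    then have "{i. i < n \<and> q dvd i} \<subseteq> {0}" by fastforce
    then have "{i. i < n \<and> q dvd i} = {0}" using 2 by auto
    then show ?thesis using mono[OF 2(2)] by simp
  next
    case 3
    have "H n s \<le> H q s + H (n - q) (s + q)"
      using sub[of q "n - q" s] 3 by simp
    also have "\<dots> \<le> H q s + (\<Sum>i | i < n - q \<and> q dvd i. H q (s + q + i))"
      using less.IH[of "n - q" "s + q"] 3 \<open>q > 0\<close> by simp
    also have "(\<Sum>i | i < n - q \<and> q dvd i. H q (s + q + i))
        = (\<Sum>i\<in>(+) q ` {i. i < n - q \<and> q dvd i}. H q (s + i))"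
      by (subst sum.reindex) (auto simp: add.assoc)
    also have "H q s + \<dots> = (\<Sum>i\<in>insert 0 ((+) q ` {i. i < n - q \<and> q dvd i}). H q (s + i))"
      using \<open>q > 0\<close> by (subst sum.insert) auto
    also have "insert 0 ((+) q ` {i. i < n - q \<and> q dvd i}) = {i. i < n \<and> q dvd i}"
    proof (intro set_eqI iffI)
      fix i assume i: "i \<in> {i. i < n \<and> q dvd i}"
      show "i \<in> insert 0 ((+) q ` {i. i < n - q \<and> q dvd i})"
      proof (cases "i = 0")
        case False
        then have "q \<le> i" using i by (auto dest: dvd_imp_le)
        then have "i = q + (i - q)" "i - q \<in> {i. i < n - q \<and> q dvd i}" using i 3 by auto
        then show ?thesis by (intro insertI2 image_eqI[of _ _ "i - q"])
      qed simp
    next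
      fix i assume "i \<in> insert 0 ((+) q ` {i. i < n - q \<and> q dvd i})"
      then show "i \<in> {i. i < n \<and> q dvd i}" using 3 \<open>q > 0\<close> by auto
    qed
    finally show ?thesis .
  qed
qed

text \<open>
  Cut \<open>[0, n)\<close> into blocks of length \<open>q\<close> in \<open>q\<close> ways, one for each residue \<open>j\<close> of the starting
  times. Over all residues every starting time occurs at most once, and the initial piece of
  length \<open>j\<close> costs at most \<open>B\<close>.
\<close>

lemma subadditive_average:
  fixes H :: "nat \<Rightarrow> nat \<Rightarrow> real"
  assumes sub: "\<And>m n s. H (m + n) s \<le> H m s + H n (s + m)"
    and mono: "\<And>m n s. m \<le> n \<Longrightarrow> H m s \<le> H n s" and zero: "\<And>s. H 0 s = 0"
    and nonneg: "\<And>n s. 0 \<le> H n s"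
    and q: "q > 0" "q \<le> n" and B: "H q 0 \<le> B"
  shows "q * H n 0 \<le> (\<Sum>i<n. H q i) + q * B"
proof -
  let ?I = "\<lambda>j. {i. i < n - j \<and> q dvd i}"
  let ?S = "SIGMA j:{..<q}. ?I j"
  have one: "H n 0 \<le> B + (\<Sum>i\<in>?I j. H q (j + i))" if "j < q" for j
    using sub[of j "n - j" 0] subadditive_blocks[OF sub mono zero q(1), of "n - j" j] mono[of j q 0] that q B
    by simp
  have inj: "inj_on (\<lambda>p. fst p + snd p) ?S"
  proof (rule inj_onI)
    fix x y assume x: "x \<in> ?S" and y: "y \<in> ?S" and e: "fst x + snd x = fst y + snd y"
    have *: "(fst z + snd z) mod q = fst z" if "z \<in> ?S" for z
    proof -
      have "snd z mod q = 0" "fst z < q" using that by auto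
      then show ?thesis by (metis add.right_neutral mod_add_right_eq mod_less)
    qed
    have "fst x = fst y" using *[OF x] *[OF y] e by simp
    then show "x = y" using e by (simp add: prod_eq_iff)
  qed
  have "q * H n 0 = (\<Sum>j<q. H n 0)" by simp
  also have "\<dots> \<le> (\<Sum>j<q. B + (\<Sum>i\<in>?I j. H q (j + i)))"
    by (intro sum_mono one) simp
  also have "\<dots> = q * B + (\<Sum>j<q. \<Sum>i\<in>?I j. H q (j + i))"
    by (simp add: sum.distrib)
  also have "(\<Sum>j<q. \<Sum>i\<in>?I j. H q (j + i)) = (\<Sum>p\<in>?S. H q (fst p + snd p))"
    by (subst sum.Sigma) (auto simp: case_prod_beta)
  also have "\<dots> = (\<Sum>i\<in>(\<lambda>p. fst p + snd p) ` ?S. H q i)"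
    using sum.reindex[OF inj, of "H q"] by simp
  also have "\<dots> \<le> (\<Sum>i<n. H q i)"
    by (rule sum_mono2) (auto simp: nonneg)
  finally show ?thesis by simp
qed

lemma obs_entropy_itinerary_average:
  assumes M: "prob_space M" "space M = UNIV" and f: "f \<in> measurable M M" and a: "simple_function M a"
    and q: "q > 0" "q \<le> n"
  shows "q * obs_entropy M (itinerary f a n)
      \<le> (\<Sum>i<n. obs_entropy M (itinerary f a q \<circ> (f ^^ i))) + (real q)\<^sup>2 * ln (card (range a))"
proof -
  define H where "H l s = obs_entropy M (itinerary f a l \<circ> (f ^^ s))" for l s
  have sf: "simple_function M (itinerary f a l \<circ> (f ^^ i))" for l i
    using simple_function_comp[OF measurable_funpow[OF f] simple_function_itinerary[OF M(2) f a]]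
    by (simp add: comp_def)
  have fin: "finite (range a)" using simple_functionD(1)[OF a] M(2) by simp
  then have k: "card (range a) > 0" by (simp add: card_gt_0_iff)
  have sub: "H (m + l) s \<le> H m s + H l (s + m)" for m l s
    unfolding H_def by (rule obs_entropy_itinerary_add[OF M f a])
  have mono: "H m s \<le> H l s" if "m \<le> l" for m l s
    unfolding H_def using that by (intro obs_entropy_factor_le[OF M sf]) (auto simp: itinerary_eq_iff)
  have zero: "H 0 s = 0" for s
  proof -
    interpret prob_space M by fact
    have "itinerary f a 0 \<circ> (f ^^ s) = (\<lambda>_. [])" by (auto simp: itinerary_def)
    then show ?thesis using prob_space M(2) by (simp add: H_def obs_entropy_def)
  qed
  have nonneg: "0 \<le> H l s" for l s
    unfolding H_def by (rule obs_entropy_nonneg[OF M(1)])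
  have H0: "H l 0 = obs_entropy M (itinerary f a l)" for l
    by (simp add: H_def comp_def)
  have "H q 0 \<le> ln (card (range (itinerary f a q)))"
    unfolding H0 by (rule obs_entropy_le_ln_card[OF M simple_function_itinerary[OF M(2) f a]])
  also have "\<dots> \<le> ln (real (card (range a)) ^ q)"
    using finite_range_itinerary[OF fin, of f q]
    by (intro ln_mono) (auto simp: card_gt_0_iff simp flip: of_nat_power)
  also have "\<dots> = q * ln (card (range a))" using k by (simp add: ln_realpow)
  finally have B: "H q 0 \<le> q * ln (card (range a))" .
  show ?thesis
    using subadditive_average[OF sub mono zero nonneg q B]
    by (simp only: H0) (simp add: H_def power2_eq_square mult.assoc)
qed

definition orbit_average :: "('a \<Rightarrow> 'a) \<Rightarrow> nat \<Rightarrow> 'a pmf \<Rightarrow> 'a pmf" where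
  "orbit_average f n \<sigma> = bind_pmf (pmf_of_set {..<n}) (\<lambda>i. map_pmf (f ^^ i) \<sigma>)"

lemma expectation_orbit_average:
  fixes h :: "'a \<Rightarrow> real"
  assumes "n > 0" "finite (set_pmf \<sigma>)"
  shows "measure_pmf.expectation (orbit_average f n \<sigma>) h
      = measure_pmf.expectation \<sigma> (birkhoff_sum f h n) / n"
proof -
  have "measure_pmf.expectation (orbit_average f n \<sigma>) h
      = (\<Sum>i<n. measure_pmf.expectation \<sigma> (\<lambda>x. h ((f ^^ i) x)) /\<^sub>R n)"
    unfolding orbit_average_def
    by (subst pmf_expectation_bind_pmf_of_set) (use assms in auto)
  also have "\<dots> = (\<Sum>i<n. measure_pmf.expectation \<sigma> (\<lambda>x. h ((f ^^ i) x))) / n"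
    by (simp add: sum_distrib_left divide_inverse mult.commute)
  also have "(\<Sum>i<n. measure_pmf.expectation \<sigma> (\<lambda>x. h ((f ^^ i) x)))
      = measure_pmf.expectation \<sigma> (birkhoff_sum f h n)"
    unfolding birkhoff_sum_def
    by (subst Bochner_Integration.integral_sum) (auto intro: integrable_measure_pmf_finite assms)
  finally show ?thesis .
qed

lemma prob_orbit_average:
  assumes "n > 0" "finite (set_pmf \<sigma>)"
  shows "measure_pmf.prob (orbit_average f n \<sigma>) A = (\<Sum>i<n. measure_pmf.prob \<sigma> ((f ^^ i) -` A)) / n"
proof -
  have "measure_pmf.prob (orbit_average f n \<sigma>) A = measure_pmf.expectation (orbit_average f n \<sigma>) (indicator A)"
    by simp
  also have "\<dots> = measure_pmf.expectation \<sigma> (\<lambda>x. \<Sum>i<n. indicator ((f ^^ i) -` A) x) / n"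
    by (subst expectation_orbit_average[OF assms]) (simp add: birkhoff_sum_def[abs_def] indicator_vimage)
  also have "measure_pmf.expectation \<sigma> (\<lambda>x. \<Sum>i<n. indicator ((f ^^ i) -` A) x)
     = (\<Sum>i<n. measure_pmf.prob \<sigma> ((f ^^ i) -` A))"
    by (subst Bochner_Integration.integral_sum) (auto intro: integrable_measure_pmf_finite assms)
  finally show ?thesis .
qed

lemma simple_function_measure_pmf: "simple_function (measure_pmf p) X \<longleftrightarrow> finite (range X)"
  by (auto simp: simple_function_def)

text \<open>
  Concavity of entropy in the measure. With \<open>t\<close> the mean of numbers \<open>t\<^sub>i\<close>, the tangent inequality
  \<open>- t\<^sub>i * ln t\<^sub>i \<le> - t\<^sub>i * ln t + t - t\<^sub>i\<close> is summed over \<open>i\<close>, and the last two terms cancel.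
\<close>

lemma obs_entropy_orbit_average:
  assumes n: "n > 0" "finite (set_pmf \<sigma>)" and X: "finite (range X)"
  shows "(\<Sum>i<n. obs_entropy (measure_pmf \<sigma>) (X \<circ> (f ^^ i)))
      \<le> n * obs_entropy (measure_pmf (orbit_average f n \<sigma>)) X"
proof -
  let ?t = "\<lambda>v i. measure_pmf.prob \<sigma> ((f ^^ i) -` X -` {v})"
  let ?m = "\<lambda>v. measure_pmf.prob (orbit_average f n \<sigma>) (X -` {v})"
  have avg: "?m v = (\<Sum>i<n. ?t v i) / n" for v
    by (rule prob_orbit_average[OF n])
  have conc: "(\<Sum>i<n. - (?t v i * ln (?t v i))) \<le> n * - (?m v * ln (?m v))" for v
  proof -
    have "- (?t v i * ln (?t v i)) \<le> - (?t v i * ln (?m v)) + ?m v - ?t v i" if "i < n" for i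
    proof (cases "?t v i = 0")
      case False
      then have t: "?t v i > 0" by (simp add: zero_less_measure_iff)
      have "?t v i \<le> (\<Sum>i<n. ?t v i)" using that by (intro member_le_sum) auto
      then have m: "?m v > 0" using t n by (simp add: avg)
      have "ln (?m v / ?t v i) \<le> ?m v / ?t v i - 1"
        using t m by (intro ln_le_minus_one) auto
      then have "?t v i * ln (?m v / ?t v i) \<le> ?t v i * (?m v / ?t v i - 1)"
        using t by (intro mult_left_mono) auto
      then show ?thesis using t m by (simp add: ln_div algebra_simps)
    qed simp
    then have "(\<Sum>i<n. - (?t v i * ln (?t v i))) \<le> (\<Sum>i<n. - (?t v i * ln (?m v)) + ?m v - ?t v i)"
      by (intro sum_mono) simp
    also have "\<dots> = - ((\<Sum>i<n. ?t v i) * ln (?m v)) + n * ?m v - (\<Sum>i<n. ?t v i)"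
      by (simp add: sum.distrib sum_subtractf sum_negf sum_distrib_right)
    also have "(\<Sum>i<n. ?t v i) = n * ?m v" using n by (simp add: avg)
    finally show ?thesis by simp
  qed
  have "(\<Sum>i<n. obs_entropy (measure_pmf \<sigma>) (X \<circ> (f ^^ i)))
      = (\<Sum>i<n. \<Sum>v\<in>range X. - (?t v i * ln (?t v i)))"
    by (intro sum.cong refl, subst obs_entropy_sum_superset[of "range X"]) (auto simp: X vimage_comp)
  also have "\<dots> = (\<Sum>v\<in>range X. \<Sum>i<n. - (?t v i * ln (?t v i)))"
    by (rule sum.swap)
  also have "\<dots> \<le> (\<Sum>v\<in>range X. n * - (?m v * ln (?m v)))"
    by (intro sum_mono conc)
  also have "\<dots> = n * obs_entropy (measure_pmf (orbit_average f n \<sigma>)) X"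
    by (simp add: obs_entropy_def sum_distrib_left)
  finally show ?thesis .
qed

section \<open>Weak limits\<close>

text \<open>
  The indicator of a closed set is the pointwise limit of continuous functions of the distance
  to it.
\<close>

lemma borel_measure_eqI:
  fixes M N :: "'a::metric_space measure"
  assumes M: "finite_measure M" "sets M = sets borel" and N: "finite_measure N" "sets N = sets borel"
    and eq: "\<And>\<phi> :: 'a \<Rightarrow> real. continuous_on UNIV \<phi> \<Longrightarrow> (\<And>x. \<bar>\<phi> x\<bar> \<le> 1) \<Longrightarrow> (\<integral>x. \<phi> x \<partial>M) = (\<integral>x. \<phi> x \<partial>N)"
  shows "M = N"
proof -
  interpret M: finite_measure M by fact
  interpret N: finite_measure N by fact
  have closed: "emeasure M C = emeasure N C" if "closed C" for C
  proof (cases "C = {}")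
    case False
    define \<phi> where "\<phi> n x = max 0 (1 - real n * infdist x C)" for n x
    have cont: "continuous_on UNIV (\<phi> n)" for n
      unfolding \<phi>_def by (intro continuous_intros)
    have bound: "\<bar>\<phi> n x\<bar> \<le> 1" for n x
      using infdist_nonneg[of x C] by (simp add: \<phi>_def)
    have lim: "(\<lambda>n. \<phi> n x) \<longlonglongrightarrow> indicat_real C x" for x
    proof (cases "x \<in> C")
      case True
      then show ?thesis by (simp add: \<phi>_def)
    next
      case notin: False
      then have "infdist x C > 0"
        using in_closed_iff_infdist_zero[OF \<open>closed C\<close> False, of x] infdist_nonneg[of x C] by linarith
      then obtain k :: nat where k: "1 < k * infdist x C" using reals_Archimedean3 by blast
      have "\<phi> n x = 0" if "n \<ge> k" for n
      proof -
        have "k * infdist x C \<le> n * infdist x C" using that by (intro mult_right_mono) (auto simp: infdist_nonneg)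
        then show ?thesis using k by (simp add: \<phi>_def)
      qed
      then have "\<forall>\<^sub>F n in sequentially. \<phi> n x = 0" by (rule eventually_sequentiallyI)
      then show ?thesis using notin by (simp add: tendsto_eventually)
    qed
    have *: "(\<lambda>n. \<integral>x. \<phi> n x \<partial>K) \<longlonglongrightarrow> measure K C"
      if "finite_measure K" "sets K = sets borel" for K :: "'a measure"
    proof -
      interpret finite_measure K by fact
      have [measurable]: "\<phi> n \<in> borel_measurable K" for n
        using borel_measurable_continuous_onI[OF cont] measurable_cong_sets[OF that(2) refl] by blast
      have CK: "C \<in> sets K" using \<open>closed C\<close> that by simp
      have "(\<lambda>n. \<integral>x. \<phi> n x \<partial>K) \<longlonglongrightarrow> (\<integral>x. indicat_real C x \<partial>K)"
        by (rule integral_dominated_convergence[where w="\<lambda>_. 1"]) (use lim bound CK in auto)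
      moreover have "C \<inter> space K = C" using CK sets.sets_into_space by blast
      ultimately show ?thesis by simp
    qed
    have "(\<lambda>n. \<integral>x. \<phi> n x \<partial>M) = (\<lambda>n. \<integral>x. \<phi> n x \<partial>N)" using eq[OF cont bound] by simp
    then have "measure M C = measure N C" using *[OF M] *[OF N] LIMSEQ_unique by metis
    then show ?thesis by (simp add: M.emeasure_eq_measure N.emeasure_eq_measure)
  qed simp
  show ?thesis
  proof (rule measure_eqI_generator_eq)
    show "Int_stable (Collect closed)" by (auto simp: Int_stable_def)
    show "sets M = sigma_sets UNIV (Collect closed)" "sets N = sigma_sets UNIV (Collect closed)"
      using M N by (auto simp: borel_eq_closed)
    show "emeasure M (UNIV :: 'a set) \<noteq> \<infinity>" by simp
  qed (use closed in auto)
qed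

lemma frontier_vimage_subset:
  assumes "continuous_on UNIV q"
  shows "frontier (q -` A) \<subseteq> q -` frontier A"
proof -
  have "closure (q -` A) \<subseteq> q -` closure A"
    by (intro closure_minimal vimage_mono closure_subset closed_vimage closed_closure assms)
  moreover have "q -` interior A \<subseteq> interior (q -` A)"
    by (intro interior_maximal vimage_mono interior_subset open_vimage assms) auto
  ultimately show ?thesis by (auto simp: frontier_def)
qed

text \<open>
  Choose a section of \<open>q\<close> with values in the unit interval and move the measures to the line.
  There they are tight, and Helly's theorem provides a limit, which \<open>q\<close> pushes forward. A
  continuous function on the target becomes a bounded continuous function on the line, and the
  preimage of a set with null boundary has null boundary. The measures are discrete, so the
  section need not be measurable.
\<close>

lemma pmf_weak_limit:
  fixes q :: "real \<Rightarrow> 'a::metric_space" and p :: "nat \<Rightarrow> 'a pmf"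
  assumes q: "continuous_on UNIV q" "q ` {0..1} = UNIV"
  obtains s \<nu> where "strict_mono (s :: nat \<Rightarrow> nat)" "prob_space \<nu>" "sets \<nu> = sets borel"
    "\<And>A. A \<in> sets borel \<Longrightarrow> measure \<nu> (frontier A) = 0 \<Longrightarrow>
       (\<lambda>n. measure_pmf.prob (p (s n)) A) \<longlonglongrightarrow> measure \<nu> A"
    "\<And>\<phi> :: 'a \<Rightarrow> real. continuous_on UNIV \<phi> \<Longrightarrow>
       (\<lambda>n. measure_pmf.expectation (p (s n)) \<phi>) \<longlonglongrightarrow> (\<integral>x. \<phi> x \<partial>\<nu>)"
proof -
  have "\<exists>t. t \<in> {0..1} \<and> q t = x" for x using q(2) by (metis UNIV_I imageE)
  then obtain g where g: "\<And>x. g x \<in> {0..1}" "\<And>x. q (g x) = x" by metis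
  define M where "M n = distr (measure_pmf (p n)) borel g" for n
  have rd: "real_distribution (M n)" for n
    unfolding M_def by (rule prob_space.real_distribution_distr[OF prob_space_measure_pmf]) simp
  have "measure (M n) {-1<..2} = 1" for n
  proof -
    have "g x \<in> {-1<..2}" for x using g(1)[of x] by auto
    then have "g -` {-1<..2} = UNIV" by auto
    then show ?thesis by (simp add: M_def measure_distr)
  qed
  then have "- 1 < (2 :: real) \<and> (\<forall>n. measure (M n) {-1<..2} > 1 - \<epsilon>)" if "\<epsilon> > 0" for \<epsilon>
    using that by simp
  then have "tight M" using rd unfolding tight_def by blast
  from tight_imp_convergent_subsubsequence[OF this strict_mono_id]
  obtain s N where s: "strict_mono s" and N: "real_distribution N" and w: "weak_conv_m (M \<circ> s) N"
    by (auto simp: comp_def)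
  interpret N: real_distribution N by fact
  have qm [measurable]: "q \<in> borel_measurable borel" by (rule borel_measurable_continuous_onI[OF q(1)])
  have qN: "q \<in> borel_measurable N" using qm by simp
  define \<nu> where "\<nu> = distr N borel q"
  show ?thesis
  proof
    show "strict_mono s" by fact
    show "prob_space \<nu>" unfolding \<nu>_def by (rule N.prob_space_distr[OF qN])
    show "sets \<nu> = sets borel" by (simp add: \<nu>_def)
  next
    fix A :: "'a set" assume A: "A \<in> sets borel" and null: "measure \<nu> (frontier A) = 0"
    have meas: "measure \<nu> B = measure N (q -` B)" if "B \<in> sets borel" for B
      using measure_distr[OF qN that] by (simp add: \<nu>_def)
    have qA: "q -` B \<in> sets borel" if "B \<in> sets borel" for B
      using measurable_sets[OF qm that] by simp
    have "measure N (frontier (q -` A)) \<le> measure N (q -` frontier A)"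
      using qA[of "frontier A"] by (intro N.finite_measure_mono frontier_vimage_subset[OF q(1)]) auto
    also have "\<dots> = 0" using null by (simp add: meas)
    finally have "emeasure N (frontier (q -` A)) = 0"
      by (simp add: N.emeasure_eq_measure measure_le_0_iff)
    then have "(\<lambda>n. measure ((M \<circ> s) n) (q -` A)) \<longlonglongrightarrow> measure N (q -` A)"
      using rd by (intro weak_conv_imp_continuity_set_conv[OF _ N w] qA A) auto
    moreover have "measure (M n) (q -` A) = measure_pmf.prob (p n) A" for n
    proof -
      have "g -` q -` A = A" using g(2) by auto
      then show ?thesis using qA[OF A] by (simp add: M_def measure_distr)
    qed
    ultimately show "(\<lambda>n. measure_pmf.prob (p (s n)) A) \<longlonglongrightarrow> measure \<nu> A"
      by (simp add: meas[OF A])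
  next
    fix \<phi> :: "'a \<Rightarrow> real" assume \<phi>: "continuous_on UNIV \<phi>"
    have cont: "continuous_on UNIV (\<lambda>t. \<phi> (q t))"
      using continuous_on_compose2[OF \<phi> q(1)] by auto
    have "compact ((\<lambda>t. \<phi> (q t)) ` {0..1})"
      by (intro compact_continuous_image continuous_on_subset[OF cont]) auto
    moreover have "(\<lambda>t. \<phi> (q t)) ` {0..1} = range \<phi>" using q(2) by (metis image_image)
    ultimately have "bounded (range \<phi>)" by (simp add: compact_imp_bounded)
    then obtain B where "\<And>x. norm (\<phi> x) \<le> B" by (auto simp: bounded_iff)
    then have "(\<lambda>n. \<integral>t. \<phi> (q t) \<partial>(M \<circ> s) n) \<longlonglongrightarrow> (\<integral>t. \<phi> (q t) \<partial>N)"
      using rd cont by (intro weak_conv_imp_integral_bdd_continuous_conv[OF _ N w])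
        (auto simp: continuous_on_eq_continuous_at)
    moreover have [measurable]: "\<phi> \<in> borel_measurable borel" by (rule borel_measurable_continuous_onI[OF \<phi>])
    have "(\<integral>t. \<phi> (q t) \<partial>M n) = measure_pmf.expectation (p n) \<phi>" for n
      by (simp add: M_def integral_distr g(2))
    moreover have "(\<integral>x. \<phi> x \<partial>\<nu>) = (\<integral>t. \<phi> (q t) \<partial>N)"
      unfolding \<nu>_def by (rule integral_distr[OF qN]) simp
    ultimately show "(\<lambda>n. measure_pmf.expectation (p (s n)) \<phi>) \<longlonglongrightarrow> (\<integral>x. \<phi> x \<partial>\<nu>)"
      by simp
  qed
qed

section \<open>Sets with null boundary\<close>

definition null_boundary :: "'a::topological_space measure \<Rightarrow> 'a set \<Rightarrow> bool" where
  "null_boundary \<nu> A \<longleftrightarrow> A \<in> sets borel \<and> measure \<nu> (frontier A) = 0"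

lemma null_boundary_UNIV: "null_boundary \<nu> UNIV"
  by (simp add: null_boundary_def)

lemma null_boundary_Compl: "null_boundary \<nu> A \<Longrightarrow> null_boundary \<nu> (- A)"
  by (auto simp: null_boundary_def)

lemma null_boundary_Int:
  assumes "finite_measure \<nu>" "sets \<nu> = sets borel" "null_boundary \<nu> A" "null_boundary \<nu> B"
  shows "null_boundary \<nu> (A \<inter> B)"
proof -
  interpret finite_measure \<nu> by fact
  have "measure \<nu> (frontier (A \<inter> B)) \<le> measure \<nu> (frontier A \<union> frontier B)"
    by (intro finite_measure_mono frontier_Int_subset) (simp add: assms(2))
  also have "\<dots> \<le> measure \<nu> (frontier A) + measure \<nu> (frontier B)"
    by (intro measure_Un_le) (simp_all add: assms(2))
  finally show ?thesis using assms by (auto simp: null_boundary_def measure_le_0_iff)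
qed

lemma null_boundary_INT:
  assumes "finite_measure \<nu>" "sets \<nu> = sets borel" "finite I" "\<And>i. i \<in> I \<Longrightarrow> null_boundary \<nu> (A i)"
  shows "null_boundary \<nu> (\<Inter>i\<in>I. A i)"
  using assms(3,4)
  by (induction I rule: finite_induct) (auto simp: null_boundary_UNIV intro!: null_boundary_Int[OF assms(1,2)])

lemma null_boundary_vimage:
  assumes \<nu>: "finite_measure \<nu>" "sets \<nu> = sets borel" "distr \<nu> borel T = \<nu>"
    and T: "continuous_on UNIV T" and A: "null_boundary \<nu> A"
  shows "null_boundary \<nu> (T -` A)"
proof -
  interpret finite_measure \<nu> by fact
  have [measurable]: "T \<in> borel_measurable borel" by (rule borel_measurable_continuous_onI[OF T])
  have T': "T \<in> borel_measurable \<nu>" using \<nu>(2) by (simp cong: measurable_cong_sets)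
  have sp: "space \<nu> = UNIV" using sets_eq_imp_space_eq[OF \<nu>(2)] by simp
  have m: "T -` B \<in> sets borel" if "B \<in> sets borel" for B
    using measurable_sets[OF \<open>T \<in> borel_measurable borel\<close> that] by simp
  have "measure \<nu> (frontier (T -` A)) \<le> measure \<nu> (T -` frontier A)"
    using m[of "frontier A"] by (intro finite_measure_mono frontier_vimage_subset[OF T]) (auto simp: \<nu>(2))
  also have "\<dots> = measure (distr \<nu> borel T) (frontier A)"
    using measure_distr[OF T', of "frontier A"] sp by simp
  also have "\<dots> = 0" using A by (simp add: \<nu>(3) null_boundary_def)
  finally show ?thesis using m A by (auto simp: null_boundary_def measure_le_0_iff)
qed

text \<open>
  Spheres of different radii are disjoint, so only countably many of them carry mass.
\<close>

lemma null_boundary_ball: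
  fixes x :: "'a::metric_space"
  assumes "finite_measure \<nu>" "sets \<nu> = sets borel" "r > 0"
  obtains \<rho> where "0 < \<rho>" "\<rho> < r" "null_boundary \<nu> (ball x \<rho>)"
proof -
  interpret finite_measure \<nu> by fact
  have d [measurable]: "dist x \<in> borel_measurable \<nu>"
    using borel_measurable_continuous_onI[of "dist x"] assms(2)
    by (simp add: continuous_on_dist cong: measurable_cong_sets)
  interpret D: finite_measure "distr \<nu> borel (dist x)" by (rule finite_measure_distr[OF d])
  have sp: "space \<nu> = UNIV" using sets_eq_imp_space_eq[OF assms(2)] by simp
  have "uncountable {0<..<r}" using assms(3) by (simp add: uncountable_open_interval)
  then have "\<not> {0<..<r} \<subseteq> {t. measure (distr \<nu> borel (dist x)) {t} \<noteq> 0}"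
    using D.countable_support countable_subset by blast
  then obtain \<rho> where \<rho>: "0 < \<rho>" "\<rho> < r" "measure (distr \<nu> borel (dist x)) {\<rho>} = 0" by auto
  have "frontier (ball x \<rho>) \<subseteq> dist x -` {\<rho>}"
  proof -
    have "closure (ball x \<rho>) \<subseteq> cball x \<rho>" by (simp add: closure_minimal ball_subset_cball)
    then show ?thesis by (auto simp: frontier_def interior_open)
  qed
  moreover have "dist x -` {\<rho>} \<in> sets \<nu>"
    using measurable_sets[OF d, of "{\<rho>}"] sp by simp
  ultimately have "measure \<nu> (frontier (ball x \<rho>)) \<le> measure \<nu> (dist x -` {\<rho>})"
    by (rule finite_measure_mono)
  also have "\<dots> = 0" using \<rho>(3) measure_distr[OF d, of "{\<rho>}"] sp by simp
  finally have "null_boundary \<nu> (ball x \<rho>)" by (simp add: null_boundary_def measure_le_0_iff)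
  with \<rho> show ?thesis by (intro that)
qed

text \<open>
  Enumerate \<open>E\<close> and map a point to the first element whose set contains it. The fibres are finite
  Boolean combinations of the covering sets, so they inherit measurability or null boundaries.
\<close>

lemma cover_selection:
  assumes "finite E" and cover: "UNIV \<subseteq> (\<Union>c\<in>E. U c)"
  obtains e :: "'a \<Rightarrow> 'b" and J where "\<And>x. e x \<in> E" "\<And>x. x \<in> U (e x)" "\<And>c. finite (J c)"
    "\<And>c. c \<in> E \<Longrightarrow> e -` {c} = U c \<inter> (\<Inter>j\<in>J c. - U j)"
proof -
  obtain xs where xs: "set xs = E" "distinct xs" using finite_distinct_list[OF assms(1)] by auto
  define idx where "idx x = (LEAST j. j < length xs \<and> x \<in> U (xs ! j))" for x
  have "\<exists>j. j < length xs \<and> x \<in> U (xs ! j)" for x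
  proof -
    obtain c where "c \<in> E" and c: "x \<in> U c" using cover by blast
    then obtain j where "j < length xs" "xs ! j = c" using xs(1) by (metis in_set_conv_nth)
    then show ?thesis using c by (intro exI[of _ j]) simp
  qed
  from LeastI_ex[OF this]
  have idx: "idx x < length xs" "x \<in> U (xs ! idx x)" for x by (simp_all add: idx_def)
  have min: "idx x \<le> j" if "j < length xs" "x \<in> U (xs ! j)" for x j
    unfolding idx_def using that by (intro Least_le) simp
  have fib: "idx x = j \<longleftrightarrow> x \<in> U (xs ! j) \<inter> (\<Inter>c\<in>set (take j xs). - U c)" if j: "j < length xs" for x j
  proof
    assume e: "idx x = j"
    have "x \<notin> U c" if mem: "c \<in> set (take j xs)" for c
    proof
      assume "x \<in> U c"
      obtain l where "l < j" "xs ! l = c" using mem j by (auto simp: in_set_conv_nth)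
      then show False using min[of l x] j e \<open>x \<in> U c\<close> by simp
    qed
    then show "x \<in> U (xs ! j) \<inter> (\<Inter>c\<in>set (take j xs). - U c)" using idx(2)[of x] e by simp
  next
    assume x: "x \<in> U (xs ! j) \<inter> (\<Inter>c\<in>set (take j xs). - U c)"
    have "\<not> idx x < j"
    proof
      assume "idx x < j"
      then have "xs ! idx x \<in> set (take j xs)" using j by (auto simp: in_set_conv_nth intro!: exI[of _ "idx x"])
      then show False using x idx(2)[of x] by blast
    qed
    then show "idx x = j" using min[OF j, of x] x by simp
  qed
  define pos where "pos c = (THE j. j < length xs \<and> xs ! j = c)" for c
  have pos: "pos c < length xs" "xs ! pos c = c" if "c \<in> E" for c
  proof -
    have "\<exists>!j. j < length xs \<and> xs ! j = c"
      using that xs by (metis distinct_Ex1)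
    from theI'[OF this] show "pos c < length xs" "xs ! pos c = c" by (simp_all add: pos_def)
  qed
  show ?thesis
  proof
    show "xs ! idx x \<in> E" "x \<in> U (xs ! idx x)" for x using idx[of x] xs(1) by auto
    show "finite (set (take (pos c) xs))" for c by simp
    show "(\<lambda>x. xs ! idx x) -` {c} = U c \<inter> (\<Inter>j\<in>set (take (pos c) xs). - U j)" if "c \<in> E" for c
    proof -
      have "xs ! idx x = c \<longleftrightarrow> idx x = pos c" for x
        using nth_eq_iff_index_eq[OF xs(2) idx(1)[of x] pos(1)[OF that]] pos(2)[OF that] by simp
      then show ?thesis using fib[OF pos(1)[OF that]] pos(2)[OF that] by auto
    qed
  qed
qed

lemma null_boundary_partition:
  fixes \<nu> :: "'a::metric_space measure"
  assumes compact: "compact (UNIV :: 'a set)"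
    and \<nu>: "finite_measure \<nu>" "sets \<nu> = sets borel" and "r > 0"
  obtains a :: "'a \<Rightarrow> 'a" where "finite (range a)" "\<And>v. null_boundary \<nu> (a -` {v})"
    "\<And>x y. a x = a y \<Longrightarrow> dist x y < r"
proof -
  have "\<exists>\<rho>. 0 < \<rho> \<and> \<rho> < r / 2 \<and> null_boundary \<nu> (ball x \<rho>)" for x
    using null_boundary_ball[OF \<nu>, of "r / 2" x] \<open>r > 0\<close> by auto
  then obtain \<rho> where \<rho>: "\<And>x. 0 < \<rho> x" "\<And>x. \<rho> x < r / 2" "\<And>x. null_boundary \<nu> (ball x (\<rho> x))"
    by metis
  have "UNIV \<subseteq> (\<Union>x\<in>UNIV. ball x (\<rho> x))" using \<rho>(1) by auto
  from compactE_image[of UNIV UNIV "\<lambda>x. ball x (\<rho> x)", OF compact open_ball this]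
  obtain F where F: "finite F" "UNIV \<subseteq> (\<Union>x\<in>F. ball x (\<rho> x))" by metis
  show ?thesis
  proof (rule cover_selection[OF F])
    fix a :: "'a \<Rightarrow> 'a" and J
    assume a: "\<And>x. a x \<in> F" "\<And>x. x \<in> ball (a x) (\<rho> (a x))" and J: "\<And>c. finite (J c)"
      "\<And>c. c \<in> F \<Longrightarrow> a -` {c} = ball c (\<rho> c) \<inter> (\<Inter>j\<in>J c. - ball j (\<rho> j))"
    show ?thesis
    proof (rule that[of a])
      show "finite (range a)" using a(1) by (intro finite_subset[OF _ F(1)]) auto
      show "null_boundary \<nu> (a -` {v})" for v
      proof (cases "v \<in> F")
        case True
        then show ?thesis
          unfolding J(2)[OF True] by (intro null_boundary_Int null_boundary_INT null_boundary_Compl \<rho>(3) \<nu> J(1))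
      next
        case False
        then have "a -` {v} = {}" using a(1) by auto
        then show ?thesis using null_boundary_Compl[OF null_boundary_UNIV] by simp
      qed
      show "dist x y < r" if "a x = a y" for x y
      proof -
        have "dist (a x) x < r / 2" "dist (a x) y < r / 2"
          using a(2)[of x] a(2)[of y] \<rho>(2)[of "a x"] that by auto
        then show ?thesis by (rule dist_triangle_half_r)
      qed
    qed
  qed
qed

section \<open>Separated sets\<close>

definition bowen_separated :: "('a::metric_space \<Rightarrow> 'a) \<Rightarrow> nat \<Rightarrow> real \<Rightarrow> 'a set \<Rightarrow> bool" where
  "bowen_separated f n r E \<longleftrightarrow> (\<forall>x\<in>E. \<forall>y\<in>E. x \<noteq> y \<longrightarrow> y \<notin> bowen_ball f n x r)"

lemma continuous_on_funpow:
  assumes "continuous_on UNIV (f :: 'a::topological_space \<Rightarrow> 'a)"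
  shows "continuous_on UNIV (f ^^ n)"
proof (induction n)
  case (Suc n)
  then show ?case using continuous_on_compose2[OF assms Suc] by (simp add: comp_def)
qed (simp add: id_def)

lemma continuous_on_birkhoff_sum:
  assumes "continuous_on UNIV f" "continuous_on UNIV \<phi>"
  shows "continuous_on UNIV (birkhoff_sum f \<phi> n)"
  unfolding birkhoff_sum_def[abs_def]
  by (intro continuous_on_sum continuous_on_compose2[OF assms(2) continuous_on_funpow[OF assms(1)]]) auto

lemma open_bowen_ball:
  fixes f :: "'a::metric_space \<Rightarrow> 'a"
  assumes "continuous_on UNIV f"
  shows "open (bowen_ball f n x r)"
proof -
  have "bowen_ball f n x r = (\<Inter>i\<in>{..<n}. (f ^^ i) -` ball ((f ^^ i) x) r)"
    by (auto simp: bowen_ball_def)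
  then show ?thesis
    by (auto intro!: open_INT open_vimage continuous_on_funpow assms)
qed

lemma self_in_bowen_ball: "r > 0 \<Longrightarrow> x \<in> bowen_ball f n x r"
  by (simp add: bowen_ball_def)

text \<open>
  By compactness finitely many Bowen balls of radius \<open>r / 2\<close> cover the space, and each of them
  contains at most one point of a separated set. So a separated subset of largest size exists, and
  its maximality is the covering property.
\<close>

lemma maximal_bowen_separated:
  fixes f :: "'a::metric_space \<Rightarrow> 'a"
  assumes compact: "compact (UNIV :: 'a set)" and f: "continuous_on UNIV f" and r: "r > 0"
  obtains E where "finite E" "E \<subseteq> X" "bowen_separated f n r E" "X \<subseteq> (\<Union>x\<in>E. bowen_ball f n x r)"
proof -
  have "UNIV \<subseteq> (\<Union>x\<in>UNIV. bowen_ball f n x (r / 2))"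
    using self_in_bowen_ball[of "r / 2" _ f n] r by auto
  from compactE_image[of UNIV UNIV "\<lambda>x. bowen_ball f n x (r / 2)", OF compact open_bowen_ball[OF f] this]
  obtain F where F: "finite F" "UNIV \<subseteq> (\<Union>x\<in>F. bowen_ball f n x (r / 2))" by metis
  have "\<exists>c. c \<in> F \<and> x \<in> bowen_ball f n c (r / 2)" for x using F(2) by blast
  then obtain c where c: "\<And>x. c x \<in> F" "\<And>x. x \<in> bowen_ball f n (c x) (r / 2)" by metis
  let ?S = "\<lambda>E. finite E \<and> E \<subseteq> X \<and> bowen_separated f n r E"
  have bound: "card E \<le> card F" if E: "?S E" for E
  proof -
    have "inj_on c E"
    proof (rule inj_onI, rule ccontr)
      fix x y assume xy: "x \<in> E" "y \<in> E" "c x = c y" "x \<noteq> y"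
      have "dist ((f ^^ i) x) ((f ^^ i) y) < r" if "i < n" for i
        using c(2)[of x] c(2)[of y] that xy(3) dist_triangle_half_r[of "(f ^^ i) (c x)" "(f ^^ i) x" r "(f ^^ i) y"]
        by (simp add: bowen_ball_def)
      then have "y \<in> bowen_ball f n x r" by (simp add: bowen_ball_def)
      then show False using E xy unfolding bowen_separated_def by blast
    qed
    then show ?thesis using c(1) F(1) by (intro card_inj_on_le) auto
  qed
  have "?S {}" by (simp add: bowen_separated_def)
  moreover have "\<forall>E. ?S E \<longrightarrow> card E < Suc (card F)" using bound by (simp add: less_Suc_eq_le)
  ultimately have "\<exists>E. ?S E \<and> (\<forall>E'. ?S E' \<longrightarrow> card E' \<le> card E)"
    by (rule ex_has_greatest_nat)
  then obtain E where E: "?S E" and max: "\<And>E'. ?S E' \<Longrightarrow> card E' \<le> card E" by metis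
  have "X \<subseteq> (\<Union>x\<in>E. bowen_ball f n x r)"
  proof (rule subsetI, rule ccontr)
    fix y assume y: "y \<in> X" "y \<notin> (\<Union>x\<in>E. bowen_ball f n x r)"
    then have "y \<notin> E" using self_in_bowen_ball[OF r] by blast
    have "?S (insert y E)"
      using E y by (auto simp: bowen_separated_def bowen_ball_def dist_commute)
    then have "card (insert y E) \<le> card E" by (rule max)
    then show False using E \<open>y \<notin> E\<close> by simp
  qed
  with E show ?thesis using that by blast
qed

section \<open>Gibbs weights on separated sets\<close>

lemma weighted_pmf:
  fixes w :: "'a \<Rightarrow> real"
  assumes "finite E" "E \<noteq> {}" "\<And>x. x \<in> E \<Longrightarrow> w x > 0"
  obtains \<sigma> where "set_pmf \<sigma> = E" "\<And>x. x \<in> E \<Longrightarrow> pmf \<sigma> x = w x / (\<Sum>y\<in>E. w y)"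
proof -
  let ?Z = "\<Sum>y\<in>E. w y"
  have Z: "?Z > 0" using assms by (intro sum_pos) auto
  define p where "p x = (if x \<in> E then w x / ?Z else 0)" for x
  have nn: "0 \<le> p x" for x using assms Z by (auto simp: p_def less_imp_le)
  have "(\<integral>\<^sup>+x. ennreal (p x) \<partial>count_space UNIV) = (\<Sum>x\<in>E. ennreal (p x))"
    by (intro nn_integral_count_space'[OF assms(1)]) (auto simp: p_def)
  also have "\<dots> = ennreal (\<Sum>x\<in>E. p x)" using nn by (simp add: sum_ennreal)
  also have "(\<Sum>x\<in>E. p x) = 1"
    using Z by (simp add: p_def flip: sum_divide_distrib)
  finally have 1: "(\<integral>\<^sup>+x. ennreal (p x) \<partial>count_space UNIV) = 1" by simp
  show ?thesis
  proof
    show "set_pmf (embed_pmf p) = E"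
      using assms Z by (subst set_embed_pmf[OF nn 1]) (auto simp: p_def dest: assms(3))
    show "pmf (embed_pmf p) x = w x / ?Z" if "x \<in> E" for x
      using that by (simp add: pmf_embed_pmf[OF nn 1] p_def)
  qed
qed

lemma obs_entropy_pmf_inj:
  assumes "finite (set_pmf \<sigma>)" "finite (range X)" "inj_on X (set_pmf \<sigma>)"
  shows "obs_entropy (measure_pmf \<sigma>) X = - (\<Sum>x\<in>set_pmf \<sigma>. pmf \<sigma> x * ln (pmf \<sigma> x))"
proof -
  let ?h = "\<lambda>v. - (measure_pmf.prob \<sigma> (X -` {v}) * ln (measure_pmf.prob \<sigma> (X -` {v})))"
  have "obs_entropy (measure_pmf \<sigma>) X = (\<Sum>v\<in>range X. ?h v)" by (simp add: obs_entropy_def)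
  also have "\<dots> = (\<Sum>v\<in>X ` set_pmf \<sigma>. ?h v)"
  proof (rule sum.mono_neutral_right)
    show "\<forall>v\<in>range X - X ` set_pmf \<sigma>. ?h v = 0"
    proof
      fix v assume "v \<in> range X - X ` set_pmf \<sigma>"
      then have "v \<notin> X ` set_pmf \<sigma>" by simp
      then have "set_pmf \<sigma> \<inter> X -` {v} = {}" by auto
      then have "measure_pmf.prob \<sigma> (X -` {v}) = 0" by (simp add: measure_pmf_zero_iff)
      then show "?h v = 0" by simp
    qed
  qed (use assms in auto)
  also have "\<dots> = (\<Sum>x\<in>set_pmf \<sigma>. ?h (X x))"
    by (rule sum.reindex[OF assms(3), unfolded comp_def])
  also have "\<dots> = (\<Sum>x\<in>set_pmf \<sigma>. - (pmf \<sigma> x * ln (pmf \<sigma> x)))"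
  proof (intro sum.cong refl)
    fix x assume x: "x \<in> set_pmf \<sigma>"
    have "X -` {X x} \<inter> set_pmf \<sigma> = {x} \<inter> set_pmf \<sigma>" using assms(3) x by (auto dest: inj_onD)
    then have "measure_pmf.prob \<sigma> (X -` {X x}) = measure_pmf.prob \<sigma> {x}"
      by (metis measure_Int_set_pmf)
    then show "?h (X x) = - (pmf \<sigma> x * ln (pmf \<sigma> x))" by (simp add: measure_pmf_single)
  qed
  finally show ?thesis by (simp add: sum_negf)
qed

text \<open>
  Misiurewicz's estimate at a finite time. On \<open>E\<close> take the probability \<open>\<sigma>\<close> proportional to
  \<open>exp (- S\<^sub>n \<psi>)\<close>. As \<open>E\<close> is separated and the fibres of \<open>a\<close> have diameter less than \<open>r\<close>, the
  points of \<open>E\<close> have different itineraries, whence the entropy of the itinerary under \<open>\<sigma>\<close> is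
  \<open>ln (\<Sum>x\<in>E. exp (- S\<^sub>n \<psi> x))\<close> plus the mean of \<open>S\<^sub>n \<psi>\<close>. Subadditivity reduces the itinerary of
  length \<open>n\<close> to those of length \<open>q\<close>, and concavity replaces \<open>\<sigma>\<close> by its orbit average.
\<close>

lemma gibbs_average:
  fixes f :: "'a::metric_space \<Rightarrow> 'a" and \<psi> :: "'a \<Rightarrow> real"
  assumes E: "finite E" "E \<noteq> {}" "bowen_separated f n r E" and "n > 0"
  obtains \<sigma> where "set_pmf \<sigma> = E"
    "\<And>(a :: 'a \<Rightarrow> 'b) q. finite (range a) \<Longrightarrow> (\<And>x y. a x = a y \<Longrightarrow> dist x y < r) \<Longrightarrow> 0 < q \<Longrightarrow> q \<le> n \<Longrightarrow>
      q * ln (\<Sum>x\<in>E. exp (- birkhoff_sum f \<psi> n x)) / n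
        \<le> obs_entropy (measure_pmf (orbit_average f n \<sigma>)) (itinerary f a q)
          - q * measure_pmf.expectation (orbit_average f n \<sigma>) \<psi> + (real q)\<^sup>2 * ln (card (range a)) / n"
proof -
  let ?S = "birkhoff_sum f \<psi> n"
  define Z where "Z = (\<Sum>x\<in>E. exp (- ?S x))"
  have Z: "Z > 0" unfolding Z_def using E by (intro sum_pos) auto
  obtain \<sigma> where \<sigma>: "set_pmf \<sigma> = E" "\<And>x. x \<in> E \<Longrightarrow> pmf \<sigma> x = exp (- ?S x) / Z"
    using weighted_pmf[of E "\<lambda>x. exp (- ?S x)"] E(1,2) unfolding Z_def by auto
  have fin: "finite (set_pmf \<sigma>)" using E \<sigma> by simp
  show ?thesis
  proof (rule that[OF \<sigma>(1)])
    fix a :: "'a \<Rightarrow> 'b" and q :: nat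
    assume a: "finite (range a)" "\<And>x y. a x = a y \<Longrightarrow> dist x y < r" and q: "0 < q" "q \<le> n"
    have "inj_on (itinerary f a n) (set_pmf \<sigma>)"
    proof (rule inj_onI, rule ccontr)
      fix x y assume xy: "x \<in> set_pmf \<sigma>" "y \<in> set_pmf \<sigma>" "itinerary f a n x = itinerary f a n y" "x \<noteq> y"
      then have "y \<in> bowen_ball f n x r"
        using a(2) by (auto simp: itinerary_eq_iff bowen_ball_def)
      then show False using E(3) xy \<sigma>(1) by (auto simp: bowen_separated_def)
    qed
    then have "obs_entropy (measure_pmf \<sigma>) (itinerary f a n) = - (\<Sum>x\<in>E. pmf \<sigma> x * ln (pmf \<sigma> x))"
      using obs_entropy_pmf_inj[OF fin finite_range_itinerary(1)[OF a(1)]] \<sigma>(1) by metis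
    also have "\<dots> = (\<Sum>x\<in>E. pmf \<sigma> x * (?S x + ln Z))"
      unfolding sum_negf[symmetric]
    proof (intro sum.cong refl)
      fix x assume "x \<in> E"
      then have "ln (pmf \<sigma> x) = - ?S x - ln Z" using Z \<sigma>(2) by (simp add: ln_div)
      then show "- (pmf \<sigma> x * ln (pmf \<sigma> x)) = pmf \<sigma> x * (?S x + ln Z)"
        by (simp only:) (simp add: algebra_simps)
    qed
    also have "\<dots> = (\<Sum>x\<in>E. ?S x * pmf \<sigma> x) + (\<Sum>x\<in>E. pmf \<sigma> x) * ln Z"
      by (simp add: distrib_left sum.distrib sum_distrib_left mult.commute)
    also have "(\<Sum>x\<in>E. pmf \<sigma> x) = 1" using sum_pmf_eq_1[of E \<sigma>] E(1) \<sigma>(1) by simp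
    also have "(\<Sum>x\<in>E. ?S x * pmf \<sigma> x) = measure_pmf.expectation \<sigma> ?S"
      using E(1) \<sigma>(1) by (subst integral_measure_pmf_real[of E]) auto
    also have "\<dots> = n * measure_pmf.expectation (orbit_average f n \<sigma>) \<psi>"
      using expectation_orbit_average[OF \<open>n > 0\<close> fin, of f \<psi>] \<open>n > 0\<close> by simp
    finally have H: "obs_entropy (measure_pmf \<sigma>) (itinerary f a n)
        = n * measure_pmf.expectation (orbit_average f n \<sigma>) \<psi> + ln Z" by simp
    have sa: "simple_function (measure_pmf \<sigma>) a" using a(1) by (simp add: simple_function_measure_pmf)
    have "q * obs_entropy (measure_pmf \<sigma>) (itinerary f a n)
      \<le> (\<Sum>i<n. obs_entropy (measure_pmf \<sigma>) (itinerary f a q \<circ> (f ^^ i))) + (real q)\<^sup>2 * ln (card (range a))"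
      by (rule obs_entropy_itinerary_average[OF prob_space_measure_pmf _ _ sa q]) auto
    also have "(\<Sum>i<n. obs_entropy (measure_pmf \<sigma>) (itinerary f a q \<circ> (f ^^ i)))
      \<le> n * obs_entropy (measure_pmf (orbit_average f n \<sigma>)) (itinerary f a q)"
      by (rule obs_entropy_orbit_average[OF \<open>n > 0\<close> fin finite_range_itinerary(1)[OF a(1)]])
    finally show "q * ln (\<Sum>x\<in>E. exp (- ?S x)) / n
        \<le> obs_entropy (measure_pmf (orbit_average f n \<sigma>)) (itinerary f a q)
          - q * measure_pmf.expectation (orbit_average f n \<sigma>) \<psi> + (real q)\<^sup>2 * ln (card (range a)) / n"
      using \<open>n > 0\<close> unfolding H Z_def[symmetric] by (simp add: field_simps)
  qed
qed

section \<open>Limits of orbit averages\<close>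

lemma tendsto_x_ln_x:
  fixes u :: "nat \<Rightarrow> real"
  assumes "u \<longlonglongrightarrow> t" "\<And>n. 0 \<le> u n"
  shows "(\<lambda>n. u n * ln (u n)) \<longlonglongrightarrow> t * ln t"
proof (cases "t = 0")
  case False
  then show ?thesis using assms(1) by (intro tendsto_intros)
next
  case True
  have bound: "\<bar>x * ln x\<bar> \<le> 2 * sqrt x + x\<^sup>2" if "0 \<le> x" for x :: real
  proof (cases "x = 0")
    case False
    define s where "s = sqrt x"
    have s: "s > 0" "x = s * s" using that False by (auto simp: s_def)
    have "- ln s \<le> 1 / s" using ln_le_minus_one[of "1 / s"] s by (simp add: ln_div)
    then have "2 * (s * s) * (- ln s) \<le> 2 * (s * s) * (1 / s)"
      using s by (intro mult_left_mono) auto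
    then have 1: "- (x * ln x) \<le> 2 * sqrt x" using s by (simp add: ln_mult s_def[symmetric])
    have "x * ln x \<le> x * (x - 1)" using that False by (intro mult_left_mono ln_le_minus_one) auto
    then have "x * ln x \<le> x\<^sup>2" using that by (simp add: power2_eq_square algebra_simps)
    moreover have "0 \<le> sqrt x" "0 \<le> x\<^sup>2" using that by simp_all
    ultimately show ?thesis using 1 by (intro abs_leI) linarith+
  qed simp
  have "(\<lambda>n. 2 * sqrt (u n) + (u n)\<^sup>2) \<longlonglongrightarrow> 2 * sqrt 0 + 0\<^sup>2"
    using assms(1) unfolding True by (intro tendsto_intros)
  then have "(\<lambda>n. 2 * sqrt (u n) + (u n)\<^sup>2) \<longlonglongrightarrow> 0" by simp
  from Lim_null_comparison[OF _ this, of "\<lambda>n. u n * ln (u n)"]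
  show ?thesis using bound assms(2) True by simp
qed

lemma tendsto_obs_entropy:
  assumes "finite (range X)" "\<And>v. (\<lambda>n. measure (M n) (X -` {v})) \<longlonglongrightarrow> measure N (X -` {v})"
  shows "(\<lambda>n. obs_entropy (M n) X) \<longlonglongrightarrow> obs_entropy N X"
  unfolding obs_entropy_def
  by (intro tendsto_sum tendsto_minus tendsto_x_ln_x assms(2) measure_nonneg)

text \<open>
  Replacing \<open>\<phi>\<close> by \<open>\<phi> \<circ> f\<close> telescopes in the Birkhoff sum, so the mean of \<open>\<phi>\<close> changes by at most
  \<open>2 / N k\<close>.
\<close>

lemma orbit_average_limit_invariant:
  fixes f :: "'a::metric_space \<Rightarrow> 'a"
  assumes f: "continuous_on UNIV f" and \<nu>: "prob_space \<nu>" "sets \<nu> = sets borel"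
    and N: "filterlim N at_top sequentially" "\<And>k. N k > 0" "\<And>k. finite (set_pmf (\<sigma> k))"
    and lim: "\<And>\<phi> :: 'a \<Rightarrow> real. continuous_on UNIV \<phi> \<Longrightarrow>
      (\<lambda>k. measure_pmf.expectation (orbit_average f (N k) (\<sigma> k)) \<phi>) \<longlonglongrightarrow> (\<integral>x. \<phi> x \<partial>\<nu>)"
  shows "\<nu> \<in> M_inv f"
proof -
  interpret prob_space \<nu> by fact
  have fm: "f \<in> borel_measurable \<nu>"
    using borel_measurable_continuous_onI[OF f] \<nu>(2) by (simp cong: measurable_cong_sets)
  have "distr \<nu> borel f = \<nu>"
  proof (rule borel_measure_eqI)
    show "finite_measure (distr \<nu> borel f)" by (rule finite_measure_distr[OF fm])
    fix \<phi> :: "'a \<Rightarrow> real" assume \<phi>: "continuous_on UNIV \<phi>" "\<And>x. \<bar>\<phi> x\<bar> \<le> 1"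
    let ?e = "\<lambda>k. measure_pmf.expectation (orbit_average f (N k) (\<sigma> k))"
    have \<phi>f: "continuous_on UNIV (\<lambda>x. \<phi> (f x))"
      using continuous_on_compose2[OF \<phi>(1) f] by auto
    have bound: "\<bar>?e k (\<lambda>x. \<phi> (f x)) - ?e k \<phi>\<bar> \<le> 2 / N k" for k
    proof -
      have int: "integrable (measure_pmf (\<sigma> k)) h" for h :: "'a \<Rightarrow> real"
        by (rule integrable_measure_pmf_finite[OF N(3)])
      have shift: "birkhoff_sum f (\<lambda>x. \<phi> (f x)) n x - birkhoff_sum f \<phi> n x = \<phi> ((f ^^ n) x) - \<phi> x" for n x
        by (induction n) (simp_all add: birkhoff_sum_def)
      define D where "D x = \<phi> ((f ^^ N k) x) - \<phi> x" for x
      have "?e k (\<lambda>x. \<phi> (f x)) - ?e k \<phi> = measure_pmf.expectation (\<sigma> k) D / N k"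
        unfolding expectation_orbit_average[OF N(2,3)] D_def shift[symmetric]
        by (subst Bochner_Integration.integral_diff[OF int int]) (simp add: diff_divide_distrib)
      moreover have "\<bar>measure_pmf.expectation (\<sigma> k) D\<bar> \<le> 2"
      proof -
        have "\<bar>measure_pmf.expectation (\<sigma> k) D\<bar> \<le> measure_pmf.expectation (\<sigma> k) (\<lambda>x. \<bar>D x\<bar>)"
          by (rule integral_abs_bound)
        also have "\<dots> \<le> measure_pmf.expectation (\<sigma> k) (\<lambda>x. 2)"
        proof (rule integral_mono[OF int int])
          show "\<bar>D x\<bar> \<le> 2" for x
            using \<phi>(2)[of x] \<phi>(2)[of "(f ^^ N k) x"] unfolding D_def by linarith
        qed
        finally show ?thesis by simp
      qed
      ultimately show ?thesis by (simp add: divide_right_mono)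
    qed
    have "(\<lambda>k. 2 / real (N k)) \<longlonglongrightarrow> 0"
      by (rule real_tendsto_divide_at_top[OF tendsto_const filterlim_compose[OF filterlim_real_sequentially N(1)]])
    then have "(\<lambda>k. ?e k (\<lambda>x. \<phi> (f x)) - ?e k \<phi>) \<longlonglongrightarrow> 0"
      by (rule Lim_null_comparison[OF always_eventually, rotated]) (intro allI, simp only: real_norm_def bound)
    then have "(\<integral>x. \<phi> (f x) \<partial>\<nu>) - (\<integral>x. \<phi> x \<partial>\<nu>) = 0"
      by (rule LIMSEQ_unique[OF tendsto_diff[OF lim[OF \<phi>f] lim[OF \<phi>(1)]]])
    moreover have "(\<integral>x. \<phi> x \<partial>distr \<nu> borel f) = (\<integral>x. \<phi> (f x) \<partial>\<nu>)"
      by (rule integral_distr[OF fm borel_measurable_continuous_onI[OF \<phi>(1)]])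
    ultimately show "(\<integral>x. \<phi> x \<partial>distr \<nu> borel f) = (\<integral>x. \<phi> x \<partial>\<nu>)" by simp
  qed (use \<nu> in \<open>auto intro: prob_space.finite_measure finite_measure_axioms\<close>)
  then show ?thesis using \<nu> by (simp add: M_inv_def)
qed

section \<open>The upper bound\<close>

lemma log_ereal_rate_gt:
  assumes "n > 0" "0 \<le> t" "ereal a < ereal (1 / real n) * log_ereal t"
  shows "exp (a * n) < t"
proof -
  have "t \<noteq> 0" using assms by (auto simp: log_ereal_def)
  then have t: "t > 0" using assms(2) by simp
  then have "a < ln t / n" using assms(3) by (simp add: log_ereal_def)
  then have "a * n < ln t" using assms(1) by (simp add: field_simps)
  then have "exp (a * n) < exp (ln t)" by simp
  then show ?thesis using t by simp
qed

text \<open>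
  The curve \<open>\<gamma>\<close> serves to make the space compact and to give weak limits of discrete measures.
  If the bound failed, there would be infinitely many times at which the mass exceeds
  \<open>exp (a * n)\<close> for some \<open>a\<close> above the supremum. The Gibbs averages of these times have a limit
  \<open>\<nu>\<close>, which enters the supremum; entropy is continuous in the limit for a partition whose atoms
  have \<open>\<nu>\<close>-null boundaries, and this forces \<open>ks_entropy f \<nu> - \<integral>\<psi> d\<nu> \<ge> a\<close>.
\<close>

theorem large_deviation_upper_bound:
  fixes f :: "'a::metric_space \<Rightarrow> 'a" and \<gamma> :: "real \<Rightarrow> 'a"
  assumes \<gamma>: "continuous_on UNIV \<gamma>" "\<gamma> ` {0..1} = UNIV" and f: "continuous_on UNIV f"
    and m: "finite_measure m" "sets m = sets borel"
    and \<phi>: "continuous_on UNIV \<phi>" and \<psi>: "\<psi> \<in> V_plus f m"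
  shows "limsup (\<lambda>n. ereal (1 / real n) * log_ereal (measure m {x. birkhoff_sum f \<phi> n x / real n \<in> {c..}}))
    \<le> (SUP \<nu> \<in> {\<nu> \<in> M_inv f. (\<integral>x. \<phi> x \<partial>\<nu>) \<ge> c}. ks_entropy f \<nu> - ereal (\<integral>x. \<psi> x \<partial>\<nu>))"
    (is "limsup ?L \<le> ?S")
proof (rule ccontr)
  interpret m: finite_measure m by fact
  have compact: "compact (UNIV :: 'a set)"
    using compact_continuous_image[OF continuous_on_subset[OF \<gamma>(1)], of "{0..1}"] \<gamma>(2) by simp
  obtain C r where C: "C > 0" and r: "r > 0" and ball: "\<And>x n. measure m (bowen_ball f n x r) \<le> C * exp (- birkhoff_sum f \<psi> n x)"
    and \<psi>c: "continuous_on UNIV \<psi>"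
    using \<psi> unfolding V_plus_def by blast
  assume "\<not> limsup ?L \<le> ?S"
  then obtain a where a: "?S < ereal a" "ereal a < limsup ?L"
    using ereal_dense2[of ?S "limsup ?L"] by (auto simp: not_le)
  let ?X = "\<lambda>n. {x. birkhoff_sum f \<phi> n x / real n \<in> {c..}}"
  let ?bound = "\<lambda>n \<sigma> h q. q * (a - ln C / n) \<le> obs_entropy (measure_pmf (orbit_average f n \<sigma>)) (itinerary f (h :: 'a \<Rightarrow> 'a) q)
          - q * measure_pmf.expectation (orbit_average f n \<sigma>) \<psi> + (real q)\<^sup>2 * ln (card (range h)) / n"
  have "\<exists>n>k. ereal a < ?L n" for k
  proof (rule ccontr)
    assume none: "\<not> (\<exists>n>k. ereal a < ?L n)"
    have "\<forall>\<^sub>F n in sequentially. ?L n \<le> ereal a"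
    proof (intro eventually_sequentiallyI[of "Suc k"])
      show "?L n \<le> ereal a" if "Suc k \<le> n" for n
        using none that by (meson Suc_le_eq not_less)
    qed
    then have "limsup ?L \<le> ereal a" by (rule Limsup_bounded)
    then show False using a(2) by simp
  qed
  then obtain N where N: "\<And>k. N k > k" "\<And>k. ereal a < ?L (N k)" by metis
  have "\<exists>\<sigma>. finite (set_pmf \<sigma>) \<and> set_pmf \<sigma> \<subseteq> ?X n \<and>
      (\<forall>h q. finite (range h) \<longrightarrow> (\<forall>x y. h x = h y \<longrightarrow> dist x y < r) \<longrightarrow> 0 < q \<longrightarrow> q \<le> n \<longrightarrow> ?bound n \<sigma> h q)"
    if n: "n > 0" "ereal a < ?L n" for n
  proof -
    obtain E where E: "finite E" "E \<subseteq> ?X n" "bowen_separated f n r E" "?X n \<subseteq> (\<Union>x\<in>E. bowen_ball f n x r)"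
      using maximal_bowen_separated[OF compact f r] by blast
    have big: "exp (a * n) < measure m (?X n)"
      using log_ereal_rate_gt[OF n(1) measure_nonneg n(2)] .
    have Bm: "bowen_ball f n x r \<in> sets m" for x
      using open_bowen_ball[OF f] by (simp add: m(2) borel_open)
    have "measure m (?X n) \<le> measure m (\<Union>x\<in>E. bowen_ball f n x r)"
      using E Bm by (intro m.finite_measure_mono sets.finite_UN) auto
    also have "\<dots> \<le> (\<Sum>x\<in>E. measure m (bowen_ball f n x r))"
      using E(1) Bm by (intro m.finite_measure_subadditive_finite) auto
    also have "\<dots> \<le> (\<Sum>x\<in>E. C * exp (- birkhoff_sum f \<psi> n x))"
      by (intro sum_mono ball)
    finally have big': "exp (a * n) < C * (\<Sum>x\<in>E. exp (- birkhoff_sum f \<psi> n x))"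
      using big by (simp add: sum_distrib_left)
    have "E \<noteq> {}"
    proof
      assume "E = {}"
      then have "?X n = {}" using E(4) by simp
      then show False using big by (simp add: not_less)
    qed
    then have Z: "(\<Sum>x\<in>E. exp (- birkhoff_sum f \<psi> n x)) > 0" using E(1) by (intro sum_pos) auto
    have "ln (exp (a * n)) < ln (C * (\<Sum>x\<in>E. exp (- birkhoff_sum f \<psi> n x)))"
      using big' C Z by (subst ln_less_cancel_iff) auto
    then have lnZ: "a * n < ln C + ln (\<Sum>x\<in>E. exp (- birkhoff_sum f \<psi> n x))"
      using C Z by (simp add: ln_mult)
    have low: "q * (a - ln C / n) \<le> q * ln (\<Sum>x\<in>E. exp (- birkhoff_sum f \<psi> n x)) / n" for q :: nat
    proof -
      have "a - ln C / n = (a * n - ln C) / n" using n(1) by (simp add: diff_divide_distrib)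
      also have "\<dots> \<le> ln (\<Sum>x\<in>E. exp (- birkhoff_sum f \<psi> n x)) / n"
        using lnZ by (intro divide_right_mono) auto
      finally have "q * (a - ln C / n) \<le> q * (ln (\<Sum>x\<in>E. exp (- birkhoff_sum f \<psi> n x)) / n)"
        by (intro mult_left_mono) auto
      then show ?thesis by (simp only: times_divide_eq_right)
    qed
    from gibbs_average[OF E(1) \<open>E \<noteq> {}\<close> E(3) n(1), where ?'b = 'a and \<psi> = \<psi>]
    obtain \<sigma> where \<sigma>: "set_pmf \<sigma> = E"
      "\<And>(h :: 'a \<Rightarrow> 'a) q. finite (range h) \<Longrightarrow> (\<And>x y. h x = h y \<Longrightarrow> dist x y < r) \<Longrightarrow> 0 < q \<Longrightarrow> q \<le> n \<Longrightarrow>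
      q * ln (\<Sum>x\<in>E. exp (- birkhoff_sum f \<psi> n x)) / n
        \<le> obs_entropy (measure_pmf (orbit_average f n \<sigma>)) (itinerary f h q)
          - q * measure_pmf.expectation (orbit_average f n \<sigma>) \<psi> + (real q)\<^sup>2 * ln (card (range h)) / n"
      by metis
    show ?thesis
    proof (intro exI[of _ \<sigma>] conjI allI impI)
      fix h :: "'a \<Rightarrow> 'a" and q
      assume h: "finite (range h)" "\<forall>x y. h x = h y \<longrightarrow> dist x y < r" "0 < q" "q \<le> n"
      show "?bound n \<sigma> h q" by (rule order_trans[OF low \<sigma>(2)]) (use h in auto)
    qed (use \<sigma>(1) E in auto)
  qed
  then have "\<exists>\<sigma>. finite (set_pmf \<sigma>) \<and> set_pmf \<sigma> \<subseteq> ?X (N k) \<and>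
      (\<forall>h q. finite (range h) \<longrightarrow> (\<forall>x y. h x = h y \<longrightarrow> dist x y < r) \<longrightarrow> 0 < q \<longrightarrow> q \<le> N k \<longrightarrow> ?bound (N k) \<sigma> h q)" for k
    using N[of k] by simp
  then obtain \<sigma> where \<sigma>: "\<And>k. finite (set_pmf (\<sigma> k))" "\<And>k. set_pmf (\<sigma> k) \<subseteq> ?X (N k)"
    and \<sigma>b: "\<And>k h q. finite (range h) \<Longrightarrow> \<forall>x y. h x = h y \<longrightarrow> dist x y < r \<Longrightarrow> 0 < q \<Longrightarrow> q \<le> N k \<Longrightarrow> ?bound (N k) (\<sigma> k) h q"
    by metis
  define p where "p k = orbit_average f (N k) (\<sigma> k)" for k
  obtain s \<nu> where s: "strict_mono (s :: nat \<Rightarrow> nat)" and \<nu>: "prob_space \<nu>" "sets \<nu> = sets borel"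
    and nb: "\<And>A. A \<in> sets borel \<Longrightarrow> measure \<nu> (frontier A) = 0 \<Longrightarrow>
       (\<lambda>n. measure_pmf.prob (p (s n)) A) \<longlonglongrightarrow> measure \<nu> A"
    and lim: "\<And>\<phi> :: 'a \<Rightarrow> real. continuous_on UNIV \<phi> \<Longrightarrow>
       (\<lambda>n. measure_pmf.expectation (p (s n)) \<phi>) \<longlonglongrightarrow> (\<integral>x. \<phi> x \<partial>\<nu>)"
    using pmf_weak_limit[OF \<gamma>, of p] by metis
  interpret \<nu>: prob_space \<nu> by fact
  have sp: "space \<nu> = UNIV" using sets_eq_imp_space_eq[OF \<nu>(2)] by simp
  have Nge: "N (s k) > k" for k by (rule le_less_trans[OF seq_suble[OF s] N(1)])
  have Ntop: "filterlim (\<lambda>k. N (s k)) at_top sequentially"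
    by (intro filterlim_at_top_mono[OF filterlim_ident] always_eventually allI less_imp_le Nge)
  have N0: "N (s k) > 0" for k using Nge[of k] by simp
  have over_N: "(\<lambda>k. t / real (N (s k))) \<longlonglongrightarrow> 0" for t
    by (rule real_tendsto_divide_at_top[OF tendsto_const filterlim_compose[OF filterlim_real_sequentially Ntop]])
  have inv: "\<nu> \<in> M_inv f"
    by (rule orbit_average_limit_invariant[OF f \<nu> Ntop N0 \<sigma>(1)]) (use lim in \<open>simp add: p_def\<close>)
  then have fd: "distr \<nu> borel f = \<nu>" by (simp add: M_inv_def)
  have fm: "f \<in> measurable \<nu> \<nu>"
    using borel_measurable_continuous_onI[OF f] by (simp cong: measurable_cong_sets add: \<nu>(2))
  have fd': "distr \<nu> \<nu> f = \<nu>" using fd by (simp add: \<nu>(2) cong: distr_cong)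
  have "c \<le> measure_pmf.expectation (p (s k)) \<phi>" for k
  proof -
    have "c = measure_pmf.expectation (\<sigma> (s k)) (\<lambda>_. c)" by simp
    also have "\<dots> \<le> measure_pmf.expectation (\<sigma> (s k)) (\<lambda>x. birkhoff_sum f \<phi> (N (s k)) x / N (s k))"
      using \<sigma>(2)[of "s k"]
      by (intro integral_mono_AE integrable_measure_pmf_finite \<sigma>(1)) (auto simp: AE_measure_pmf_iff)
    also have "\<dots> = measure_pmf.expectation (p (s k)) \<phi>"
      by (simp add: p_def expectation_orbit_average[OF N0 \<sigma>(1)])
    finally show ?thesis .
  qed
  then have \<phi>c: "c \<le> (\<integral>x. \<phi> x \<partial>\<nu>)" using LIMSEQ_le_const[OF lim[OF \<phi>]] by blast
  obtain h :: "'a \<Rightarrow> 'a" where h: "finite (range h)" "\<And>v. null_boundary \<nu> (h -` {v})" "\<And>x y. h x = h y \<Longrightarrow> dist x y < r"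
    using null_boundary_partition[OF compact \<nu>.finite_measure_axioms \<nu>(2) r] by blast
  have hs: "simple_function \<nu> h"
    using h(1,2) by (auto simp: simple_function_def sp \<nu>(2) null_boundary_def)
  have fibre: "null_boundary \<nu> (itinerary f h q -` {w})" for q w
  proof (cases "length w = q")
    case True
    have inv_i: "distr \<nu> borel (f ^^ i) = \<nu>" for i
      using distr_funpow[OF fm fd', of i] by (simp add: \<nu>(2) cong: distr_cong)
    show ?thesis
      unfolding itinerary_vimage[OF True]
      by (intro null_boundary_INT[OF \<nu>.finite_measure_axioms \<nu>(2)]
          null_boundary_vimage[OF \<nu>.finite_measure_axioms \<nu>(2) inv_i continuous_on_funpow[OF f]] h(2)) simp
  next
    case False
    then have "itinerary f h q -` {w} = {}" by auto
    then show ?thesis using null_boundary_Compl[OF null_boundary_UNIV] by simp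
  qed
  have main: "q * a \<le> obs_entropy \<nu> (itinerary f h q) - q * (\<integral>x. \<psi> x \<partial>\<nu>)" if q: "q > 0" for q
  proof -
    let ?l = "\<lambda>k. q * (a - ln C / N (s k))"
    let ?u = "\<lambda>k. obs_entropy (measure_pmf (p (s k))) (itinerary f h q)
          - q * measure_pmf.expectation (p (s k)) \<psi> + (real q)\<^sup>2 * ln (card (range h)) / N (s k)"
    have "?l \<longlonglongrightarrow> q * (a - 0)"
      by (intro tendsto_intros over_N)
    moreover have "(\<lambda>k. obs_entropy (measure_pmf (p (s k))) (itinerary f h q)) \<longlonglongrightarrow> obs_entropy \<nu> (itinerary f h q)"
      using fibre by (intro tendsto_obs_entropy finite_range_itinerary h(1) nb) (auto simp: null_boundary_def)
    then have "?u \<longlonglongrightarrow> obs_entropy \<nu> (itinerary f h q) - q * (\<integral>x. \<psi> x \<partial>\<nu>) + 0"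
      by (intro tendsto_intros over_N lim \<psi>c)
    moreover have "?l k \<le> ?u k" if "k \<ge> q" for k
      unfolding p_def using Nge[of k] that q h by (intro \<sigma>b) auto
    ultimately show ?thesis
      using LIMSEQ_le[of ?l _ ?u] by auto
  qed
  let ?P = "(\<lambda>v. h -` {v}) ` range h"
  have "a + (\<integral>x. \<psi> x \<partial>\<nu>) \<le> entropy_wrt f \<nu> ?P"
  proof (rule LIMSEQ_le_const[OF entropy_wrt_fibres(1)[OF \<nu>(1) sp fm fd' hs]], intro exI[of _ 1] allI impI)
    fix q :: nat assume "1 \<le> q"
    then show "a + (\<integral>x. \<psi> x \<partial>\<nu>) \<le> obs_entropy \<nu> (itinerary f h q) / q"
      using main[of q] by (simp add: field_simps)
  qed
  also have "ereal (entropy_wrt f \<nu> ?P) \<le> ks_entropy f \<nu>"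
    unfolding ks_entropy_def
  proof (rule SUP_upper, intro CollectI conjI)
    show "partition_on UNIV ?P" by (rule partition_onI) (auto simp: disjnt_def)
    show "?P \<subseteq> sets borel" using h(2) by (auto simp: null_boundary_def)
  qed (use h(1) in auto)
  finally have "ereal (a + (\<integral>x. \<psi> x \<partial>\<nu>)) \<le> ks_entropy f \<nu>" by simp
  then have "ereal a \<le> ks_entropy f \<nu> - ereal (\<integral>x. \<psi> x \<partial>\<nu>)"
    by (cases "ks_entropy f \<nu>") auto
  also have "\<dots> \<le> ?S" using inv \<phi>c by (intro SUP_upper) auto
  finally show False using a(1) by simp
qed

section \<open>Typical words\<close>

definition words :: "'a set \<Rightarrow> nat \<Rightarrow> 'a list set" where
  "words A K = {xs. set xs \<subseteq> A \<and> length xs = K}"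

lemma finite_words: "finite A \<Longrightarrow> finite (words A K)"
  unfolding words_def by (rule finite_lists_length_eq)

lemma sum_words_Suc:
  fixes h :: "'a list \<Rightarrow> real"
  shows "(\<Sum>xs\<in>words A (Suc K). h xs) = (\<Sum>a\<in>A. \<Sum>xs\<in>words A K. h (a # xs))"
proof -
  have eq: "words A (Suc K) = (\<lambda>(a, xs). a # xs) ` (A \<times> words A K)"
    by (auto simp: words_def length_Suc_conv image_iff)
  have inj: "inj_on (\<lambda>(a, xs). a # xs) (A \<times> words A K)" by (auto simp: inj_on_def)
  show ?thesis
    unfolding eq by (subst sum.reindex[OF inj]) (simp add: sum.cartesian_product case_prod_beta)
qed

lemma sum_words_weight:
  fixes p :: "'a \<Rightarrow> real"
  assumes "(\<Sum>a\<in>A. p a) = 1"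
  shows "(\<Sum>xs\<in>words A K. prod_list (map p xs)) = 1"
proof (induction K)
  case 0
  have "words A 0 = {[]}" by (auto simp: words_def)
  then show ?case by simp
next
  case (Suc K)
  then show ?case using assms by (simp add: sum_words_Suc flip: sum_distrib_left)
qed

lemma sum_words_mean:
  fixes p g :: "'a \<Rightarrow> real"
  assumes p: "(\<Sum>a\<in>A. p a) = 1" and g: "(\<Sum>a\<in>A. p a * g a) = 0"
  shows "(\<Sum>xs\<in>words A K. prod_list (map p xs) * sum_list (map g xs)) = 0"
proof (induction K)
  case 0
  have "words A 0 = {[]}" by (auto simp: words_def)
  then show ?case by simp
next
  case (Suc K)
  have "(\<Sum>xs\<in>words A (Suc K). prod_list (map p xs) * sum_list (map g xs))
    = (\<Sum>a\<in>A. p a * g a * (\<Sum>xs\<in>words A K. prod_list (map p xs))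
        + p a * (\<Sum>xs\<in>words A K. prod_list (map p xs) * sum_list (map g xs)))"
    unfolding sum_words_Suc by (simp add: sum_distrib_left algebra_simps flip: sum.distrib)
  then show ?case by (simp add: Suc sum_words_weight[OF p] g)
qed

text \<open>
  The letters of a word are independent with distribution \<open>p\<close>, so mixed terms have mean zero.
\<close>

lemma sum_words_variance:
  fixes p g :: "'a \<Rightarrow> real"
  assumes p: "(\<Sum>a\<in>A. p a) = 1" and g: "(\<Sum>a\<in>A. p a * g a) = 0"
  shows "(\<Sum>xs\<in>words A K. prod_list (map p xs) * (sum_list (map g xs))\<^sup>2) = K * (\<Sum>a\<in>A. p a * (g a)\<^sup>2)"
proof (induction K)
  case 0
  have "words A 0 = {[]}" by (auto simp: words_def)
  then show ?case by simp
next
  case (Suc K)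
  have "(\<Sum>xs\<in>words A (Suc K). prod_list (map p xs) * (sum_list (map g xs))\<^sup>2)
    = (\<Sum>a\<in>A. p a * (g a)\<^sup>2 * (\<Sum>xs\<in>words A K. prod_list (map p xs))
        + 2 * (p a * g a) * (\<Sum>xs\<in>words A K. prod_list (map p xs) * sum_list (map g xs))
        + p a * (\<Sum>xs\<in>words A K. prod_list (map p xs) * (sum_list (map g xs))\<^sup>2))"
    unfolding sum_words_Suc
    by (simp add: sum_distrib_left power2_eq_square algebra_simps flip: sum.distrib)
  also have "\<dots> = (\<Sum>a\<in>A. p a * (g a)\<^sup>2) + (\<Sum>a\<in>A. p a) * (K * (\<Sum>a\<in>A. p a * (g a)\<^sup>2))"
    by (simp only: Suc sum_words_weight[OF p] sum_words_mean[OF p g] sum.distrib sum_distrib_right) simp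
  finally show ?case by (simp add: p algebra_simps)
qed

lemma sum_words_chebyshev:
  fixes p g :: "'a \<Rightarrow> real"
  assumes A: "finite A" and pos: "\<And>a. a \<in> A \<Longrightarrow> 0 \<le> p a"
    and p: "(\<Sum>a\<in>A. p a) = 1" and g: "(\<Sum>a\<in>A. p a * g a) = 0" and \<delta>: "\<delta> > 0" and K: "K > 0"
  shows "(\<Sum>xs | xs \<in> words A K \<and> K * \<delta> < \<bar>sum_list (map g xs)\<bar>. prod_list (map p xs))
    \<le> (\<Sum>a\<in>A. p a * (g a)\<^sup>2) / (K * \<delta>\<^sup>2)"
proof -
  let ?B = "{xs \<in> words A K. K * \<delta> < \<bar>sum_list (map g xs)\<bar>}"
  have W: "0 \<le> prod_list (map p xs)" if "xs \<in> words A K" for xs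
    using that pos by (intro prod_list_nonneg) (auto simp: words_def)
  have "(K * \<delta>)\<^sup>2 * (\<Sum>xs\<in>?B. prod_list (map p xs)) = (\<Sum>xs\<in>?B. prod_list (map p xs) * (K * \<delta>)\<^sup>2)"
    by (simp add: sum_distrib_left mult.commute)
  also have "\<dots> \<le> (\<Sum>xs\<in>?B. prod_list (map p xs) * (sum_list (map g xs))\<^sup>2)"
  proof (intro sum_mono mult_left_mono)
    fix xs assume "xs \<in> ?B"
    then show "(K * \<delta>)\<^sup>2 \<le> (sum_list (map g xs))\<^sup>2"
      using \<delta> abs_le_square_iff[of "K * \<delta>" "sum_list (map g xs)"] by simp
  qed (use W in auto)
  also have "\<dots> \<le> (\<Sum>xs\<in>words A K. prod_list (map p xs) * (sum_list (map g xs))\<^sup>2)"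
    using W by (intro sum_mono2 finite_words[OF A]) auto
  also have "\<dots> = K * (\<Sum>a\<in>A. p a * (g a)\<^sup>2)"
    by (rule sum_words_variance[OF p g])
  finally have "K * (K * \<delta>\<^sup>2 * (\<Sum>xs\<in>?B. prod_list (map p xs))) \<le> K * (\<Sum>a\<in>A. p a * (g a)\<^sup>2)"
    by (simp add: power2_eq_square algebra_simps)
  then have "K * \<delta>\<^sup>2 * (\<Sum>xs\<in>?B. prod_list (map p xs)) \<le> (\<Sum>a\<in>A. p a * (g a)\<^sup>2)"
    using K by (simp add: mult_le_cancel_left_pos)
  then show ?thesis using K \<delta> by (simp add: pos_le_divide_eq mult.commute)
qed

text \<open>
  Weigh a word by the product of its letter probabilities. By Chebyshev's inequality, applied to
  \<open>F\<close> and to \<open>- ln p - G\<close>, words of total weight at least \<open>1/2\<close> have nearly the expected sums of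
  both functions. For such a word
  \<open>exp (- \<Sum> G) = weight * exp (\<Sum> (- ln p - G))\<close>, and summing gives the claim. For \<open>G = 0\<close> this
  bounds the number of such words from below.
\<close>

lemma typical_words:
  fixes p F G :: "'a \<Rightarrow> real"
  assumes A: "finite A" and pos: "\<And>a. a \<in> A \<Longrightarrow> 0 < p a" and p: "(\<Sum>a\<in>A. p a) = 1" and \<delta>: "\<delta> > 0"
  obtains K0 where "\<And>K. K \<ge> K0 \<Longrightarrow>
    1/2 * exp (K * ((\<Sum>a\<in>A. - (p a * ln (p a))) - (\<Sum>a\<in>A. p a * G a) - \<delta>))
      \<le> (\<Sum>xs | xs \<in> words A K \<and> K * ((\<Sum>a\<in>A. p a * F a) - \<delta>) \<le> sum_list (map F xs).
            exp (- sum_list (map G xs)))"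
proof -
  define J where "J a = - ln (p a) - G a" for a
  define F0 where "F0 a = F a - (\<Sum>b\<in>A. p b * F b)" for a
  define J0 where "J0 a = J a - (\<Sum>b\<in>A. p b * J b)" for a
  have F0: "(\<Sum>a\<in>A. p a * F0 a) = 0"
    by (simp add: F0_def right_diff_distrib sum_subtractf p flip: sum_distrib_right)
  have J0: "(\<Sum>a\<in>A. p a * J0 a) = 0"
    by (simp add: J0_def right_diff_distrib sum_subtractf p flip: sum_distrib_right)
  have meanJ: "(\<Sum>a\<in>A. p a * J a) = (\<Sum>a\<in>A. - (p a * ln (p a))) - (\<Sum>a\<in>A. p a * G a)"
    by (simp add: J_def right_diff_distrib sum_subtractf)
  define V where "V = (\<Sum>a\<in>A. p a * (F0 a)\<^sup>2) + (\<Sum>a\<in>A. p a * (J0 a)\<^sup>2)"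
  obtain K0 :: nat where K0: "2 * V / \<delta>\<^sup>2 < K0" using reals_Archimedean2 by blast
  show ?thesis
  proof (rule that[of "Suc K0"])
    fix K assume "Suc K0 \<le> K"
    then have K: "K > 0" and KV: "2 * V / \<delta>\<^sup>2 < K" using K0 by auto
    let ?W = "\<lambda>xs. prod_list (map p xs)"
    let ?bad = "\<lambda>g. {xs \<in> words A K. K * \<delta> < \<bar>sum_list (map g xs)\<bar>}"
    let ?T = "{xs \<in> words A K. K * ((\<Sum>a\<in>A. p a * F a) - \<delta>) \<le> sum_list (map F xs)}"
    have fin: "finite (words A K)" by (rule finite_words[OF A])
    have W: "0 < ?W xs" if "xs \<in> words A K" for xs
      using that pos by (induction xs arbitrary: K) (auto simp: words_def)
    have sum_shift: "sum_list (map (\<lambda>a. h a - c) xs) = sum_list (map h xs) - K * c"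
      if "xs \<in> words A K" for h :: "'a \<Rightarrow> real" and c :: real and xs
    proof -
      have "sum_list (map (\<lambda>a. h a - c) xs) = sum_list (map h xs) - length xs * c" for xs
        by (induction xs) (simp_all add: algebra_simps)
      then show ?thesis using that by (simp add: words_def)
    qed
    have "(\<Sum>xs\<in>?bad F0 \<union> ?bad J0. ?W xs) \<le> (\<Sum>xs\<in>?bad F0. ?W xs) + (\<Sum>xs\<in>?bad J0. ?W xs)"
    proof -
      have "(\<Sum>xs\<in>?bad F0 \<inter> ?bad J0. ?W xs) \<ge> 0" using W by (intro sum_nonneg) (auto intro: less_imp_le)
      then show ?thesis using sum.union_inter[of "?bad F0" "?bad J0" ?W] fin by simp
    qed
    also have "\<dots> \<le> (\<Sum>a\<in>A. p a * (F0 a)\<^sup>2) / (K * \<delta>\<^sup>2) + (\<Sum>a\<in>A. p a * (J0 a)\<^sup>2) / (K * \<delta>\<^sup>2)"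
      using pos by (intro add_mono sum_words_chebyshev A p F0 J0 \<delta> K) (auto intro: less_imp_le)
    also have "\<dots> = V / (K * \<delta>\<^sup>2)" by (simp add: V_def add_divide_distrib)
    also have "\<dots> \<le> 1/2" using KV K \<delta> by (simp add: field_simps)
    finally have bad: "(\<Sum>xs\<in>?bad F0 \<union> ?bad J0. ?W xs) \<le> 1/2" .
    define D where "D = words A K - (?bad F0 \<union> ?bad J0)"
    have "(\<Sum>xs\<in>D. ?W xs) = 1 - (\<Sum>xs\<in>?bad F0 \<union> ?bad J0. ?W xs)"
      unfolding D_def using fin by (subst sum_diff) (auto simp: sum_words_weight[OF p])
    with bad have D: "1/2 \<le> (\<Sum>xs\<in>D. ?W xs)" by simp
    have DT: "D \<subseteq> ?T"
    proof
      fix xs assume xs: "xs \<in> D"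
      then have "\<bar>sum_list (map F0 xs)\<bar> \<le> K * \<delta>" "xs \<in> words A K" by (auto simp: D_def)
      then show "xs \<in> ?T" unfolding F0_def[abs_def] using sum_shift[where xs = xs and h = F and c = "\<Sum>b\<in>A. p b * F b"] by (simp add: algebra_simps)
    qed
    let ?M = "(\<Sum>a\<in>A. p a * J a) - \<delta>"
    have each: "?W xs * exp (K * ?M) \<le> exp (- sum_list (map G xs))" if xs: "xs \<in> D" for xs
    proof -
      have "\<bar>sum_list (map J0 xs)\<bar> \<le> K * \<delta>" and w: "xs \<in> words A K" using xs by (auto simp: D_def)
      then have "K * ?M \<le> sum_list (map J xs)"
        unfolding J0_def[abs_def] using sum_shift[where xs = xs and h = J and c = "\<Sum>b\<in>A. p b * J b"] by (simp add: algebra_simps)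
      then have "?W xs * exp (K * ?M) \<le> ?W xs * exp (sum_list (map J xs))"
        using W[OF w] by (intro mult_left_mono) auto
      also have "\<dots> = exp (- sum_list (map G xs))"
      proof -
        have "set xs \<subseteq> A" using w by (simp add: words_def)
        then show ?thesis
        proof (induction xs)
          case (Cons a xs)
          then have "exp (J a) = exp (- G a) / p a" using pos[of a] by (simp add: J_def exp_diff exp_minus divide_inverse mult.commute)
          then show ?case using Cons pos[of a] by (simp add: exp_add exp_diff field_simps exp_minus)
        qed simp
      qed
      finally show ?thesis .
    qed
    have "1/2 * exp (K * ?M) \<le> (\<Sum>xs\<in>D. ?W xs) * exp (K * ?M)"
      using D by (intro mult_right_mono) auto
    also have "\<dots> \<le> (\<Sum>xs\<in>D. exp (- sum_list (map G xs)))"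
      unfolding sum_distrib_right by (intro sum_mono each)
    also have "\<dots> \<le> (\<Sum>xs\<in>?T. exp (- sum_list (map G xs)))"
      using fin DT by (intro sum_mono2) auto
    finally show "1/2 * exp (K * ((\<Sum>a\<in>A. - (p a * ln (p a))) - (\<Sum>a\<in>A. p a * G a) - \<delta>))
      \<le> (\<Sum>xs\<in>?T. exp (- sum_list (map G xs)))"
      unfolding meanJ .
  qed
qed

section \<open>Coding by separated sets\<close>

lemma M_invD:
  assumes "\<nu> \<in> M_inv f" "continuous_on UNIV f"
  shows "prob_space \<nu>" "sets \<nu> = sets borel" "space \<nu> = UNIV"
    "f \<in> measurable \<nu> \<nu>" "distr \<nu> \<nu> f = \<nu>"
proof -
  show "prob_space \<nu>" and sets: "sets \<nu> = sets borel" using assms(1) by (auto simp: M_inv_def)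
  show "space \<nu> = UNIV" using sets_eq_imp_space_eq[OF sets] by simp
  show "f \<in> measurable \<nu> \<nu>"
    using borel_measurable_continuous_onI[OF assms(2)] by (simp cong: measurable_cong_sets add: sets)
  show "distr \<nu> \<nu> f = \<nu>" using assms(1) by (simp add: M_inv_def sets cong: distr_cong)
qed

lemma disjoint_compacts_separated:
  fixes C :: "'b \<Rightarrow> 'a::metric_space set"
  assumes "finite V" and C: "\<And>v. v \<in> V \<Longrightarrow> compact (C v)"
    and disj: "\<And>v w. v \<in> V \<Longrightarrow> w \<in> V \<Longrightarrow> v \<noteq> w \<Longrightarrow> C v \<inter> C w = {}"
  obtains d where "d > 0"
    "\<And>v w x y. v \<in> V \<Longrightarrow> w \<in> V \<Longrightarrow> v \<noteq> w \<Longrightarrow> x \<in> C v \<Longrightarrow> y \<in> C w \<Longrightarrow> d \<le> dist x y"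
proof -
  have "\<exists>d>0. v \<noteq> w \<longrightarrow> (\<forall>x\<in>C v. \<forall>y\<in>C w. d \<le> dist x y)" if vw: "v \<in> V" "w \<in> V" for v w
  proof (cases "v = w")
    case False
    show ?thesis
    proof (cases "C v = {} \<or> C w = {}")
      case nonempty: False
      have "continuous_on (C v) (\<lambda>x. infdist x (C w))" by (intro continuous_intros)
      then obtain x where x: "x \<in> C v" "\<And>z. z \<in> C v \<Longrightarrow> infdist x (C w) \<le> infdist z (C w)"
        using continuous_attains_inf[OF C[OF vw(1)]] nonempty by blast
      have "x \<notin> C w" using x(1) disj[OF vw False] by blast
      then have "infdist x (C w) > 0"
        using in_closed_iff_infdist_zero[OF compact_imp_closed[OF C[OF vw(2)]], of x] infdist_nonneg[of x "C w"] nonempty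
        by force
      moreover have "infdist x (C w) \<le> dist z y" if "z \<in> C v" "y \<in> C w" for z y
        using x(2)[OF that(1)] infdist_le[OF that(2), of z] by linarith
      ultimately show ?thesis by blast
    qed (auto intro: exI[of _ 1])
  qed (auto intro: exI[of _ 1])
  then obtain d where d: "\<And>v w. v \<in> V \<Longrightarrow> w \<in> V \<Longrightarrow> d v w > 0"
    "\<And>v w x y. v \<in> V \<Longrightarrow> w \<in> V \<Longrightarrow> v \<noteq> w \<Longrightarrow> x \<in> C v \<Longrightarrow> y \<in> C w \<Longrightarrow> d v w \<le> dist x y"
    by metis
  let ?D = "insert 1 ((\<lambda>(v, w). d v w) ` (V \<times> V))"
  have fin: "finite ?D" using assms(1) by simp
  show ?thesis
  proof
    show "Min ?D > 0" using fin d(1) by (subst Min_gr_iff) auto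
    fix v w x y assume vw: "v \<in> V" "w \<in> V" "v \<noteq> w" "x \<in> C v" "y \<in> C w"
    then have "Min ?D \<le> d v w" using fin by (intro Min_le) auto
    then show "Min ?D \<le> dist x y" using d(2)[OF vw] by simp
  qed
qed

text \<open>
  Let \<open>e x\<close> follow the orbit of \<open>x\<close> for \<open>M\<close> steps. Choose compact sets inside the fibres of \<open>a\<close>
  that leave out a set of small measure. While the orbit of \<open>x\<close> is in one of these sets, the
  nearby orbit of \<open>e x\<close> determines in which one, and hence the symbol \<open>a\<close>. So the symbol at time
  \<open>i\<close> is a function of \<open>e x\<close> and of a correction that is needed only when \<open>(f ^^ i) x\<close> is in the
  small set; such a correction has small entropy, uniformly in \<open>i\<close> by invariance.
\<close>

lemma itinerary_entropy_le_code:
  fixes f :: "'a::{second_countable_topology, complete_space} \<Rightarrow> 'a" and a :: "'a \<Rightarrow> 'b" and \<delta> :: real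
  assumes \<nu>: "\<nu> \<in> M_inv f" and f: "continuous_on UNIV f" and a: "simple_function \<nu> a" and \<delta>: "\<delta> > 0"
  obtains d where "d > 0"
    "\<And>r M (e :: 'a \<Rightarrow> 'a). 2 * r \<le> d \<Longrightarrow> simple_function \<nu> e \<Longrightarrow>
       (\<And>x i. i < M \<Longrightarrow> dist ((f ^^ i) (e x)) ((f ^^ i) x) < r) \<Longrightarrow>
       obs_entropy \<nu> (itinerary f a M) \<le> obs_entropy \<nu> e + M * \<delta>"
proof -
  note prob = M_invD(1)[OF \<nu> f] and sets = M_invD(2)[OF \<nu> f] and sp = M_invD(3)[OF \<nu> f]
    and fm = M_invD(4)[OF \<nu> f]
  interpret prob_space \<nu> by (rule prob)
  define V where "V = range a"
  have fin: "finite V" and am: "a -` {v} \<in> sets \<nu>" for v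
    using simple_functionD[OF a] sp by (auto simp: V_def)
  define k where "k = card V"
  obtain \<eta> where \<eta>: "\<eta> > 0" "2 * real (Suc k) * sqrt \<eta> + \<eta> \<le> \<delta>"
  proof -
    define t where "t = min 1 (\<delta> / (2 * real (Suc k) + 1))"
    have t: "t > 0" "t \<le> 1" using \<delta> by (auto simp: t_def)
    have "t * t \<le> t" using t by (simp add: mult_left_le)
    then have "2 * real (Suc k) * sqrt (t * t) + t * t \<le> t * (2 * real (Suc k) + 1)"
      using t by (simp add: algebra_simps)
    also have "\<dots> \<le> \<delta> / (2 * real (Suc k) + 1) * (2 * real (Suc k) + 1)"
      by (intro mult_right_mono) (auto simp: t_def)
    also have "\<dots> = \<delta>" by (simp add: field_simps add_nonneg_eq_0_iff)
    finally show ?thesis using that[of "t * t"] t by simp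
  qed
  have "\<exists>C. compact C \<and> C \<subseteq> a -` {v} \<and> measure \<nu> (a -` {v} - C) \<le> \<eta> / Suc k" for v
  proof -
    let ?t = "measure \<nu> (a -` {v}) - \<eta> / Suc k"
    show ?thesis
    proof (cases "?t \<le> 0")
      case True
      then show ?thesis by (intro exI[of _ "{}"]) simp
    next
      case False
      then have "ennreal ?t < emeasure \<nu> (a -` {v})"
        using \<eta>(1) by (simp add: emeasure_eq_measure ennreal_less_iff)
      also have "\<dots> = (SUP K \<in> {K. K \<subseteq> a -` {v} \<and> compact K}. emeasure \<nu> K)"
        using am[of v] by (intro inner_regular) (auto simp: sets)
      finally obtain K where K: "K \<subseteq> a -` {v}" "compact K" "ennreal ?t < emeasure \<nu> K"
        by (auto simp: less_SUP_iff)
      have Km: "K \<in> sets \<nu>" using K(2) by (simp add: sets borel_compact)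
      have "?t < measure \<nu> K"
        using K(3) False by (simp add: emeasure_eq_measure ennreal_less_iff)
      then have "measure \<nu> (a -` {v} - K) \<le> \<eta> / Suc k"
        using finite_measure_Diff[OF am Km K(1)] by simp
      then show ?thesis using K by blast
    qed
  qed
  then obtain C where C: "\<And>v. compact (C v)" "\<And>v. C v \<subseteq> a -` {v}" "\<And>v. measure \<nu> (a -` {v} - C v) \<le> \<eta> / Suc k"
    by metis
  define R where "R = (\<Union>v\<in>V. a -` {v} - C v)"
  have Cm: "C v \<in> sets \<nu>" for v using C(1) by (simp add: sets borel_compact)
  have Rm: "R \<in> sets \<nu>" unfolding R_def using fin am Cm by (intro sets.finite_UN) auto
  have "measure \<nu> R \<le> (\<Sum>v\<in>V. measure \<nu> (a -` {v} - C v))"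
    unfolding R_def using fin am Cm by (intro finite_measure_subadditive_finite) auto
  also have "\<dots> \<le> (\<Sum>v\<in>V. \<eta> / Suc k)" by (intro sum_mono C(3))
  also have "\<dots> \<le> \<eta>" using \<eta>(1) by (simp add: k_def field_simps)
  finally have R: "measure \<nu> R \<le> \<eta>" .
  have Cdisj: "C v \<inter> C w = {}" if "v \<in> V" "w \<in> V" "v \<noteq> w" for v w
    using C(2) that(3) by blast
  obtain d where d: "d > 0" "\<And>v w x y. v \<in> V \<Longrightarrow> w \<in> V \<Longrightarrow> v \<noteq> w \<Longrightarrow> x \<in> C v \<Longrightarrow> y \<in> C w \<Longrightarrow> d \<le> dist x y"
    using disjoint_compacts_separated[of V C, OF fin C(1) Cdisj] by blast
  show ?thesis
  proof (rule that[OF d(1)])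
    fix r M and e :: "'a \<Rightarrow> 'a"
    assume r: "2 * r \<le> d" and e: "simple_function \<nu> e"
      and close: "\<And>x i. i < M \<Longrightarrow> dist ((f ^^ i) (e x)) ((f ^^ i) x) < r"
    define b where "b y = (SOME v. v \<in> V \<and> (\<exists>z\<in>C v. dist y z < r))" for y
    have b: "b ((f ^^ i) (e x)) = a ((f ^^ i) x)" if "i < M" "(f ^^ i) x \<notin> R" for i x
    proof -
      let ?v = "a ((f ^^ i) x)"
      have "?v \<in> V" by (simp add: V_def)
      then have inC: "(f ^^ i) x \<in> C ?v" using that(2) unfolding R_def by blast
      then have "?v \<in> V \<and> (\<exists>z\<in>C ?v. dist ((f ^^ i) (e x)) z < r)"
        using \<open>?v \<in> V\<close> close[OF that(1), of x] by blast
      then have "b ((f ^^ i) (e x)) \<in> V \<and> (\<exists>z\<in>C (b ((f ^^ i) (e x))). dist ((f ^^ i) (e x)) z < r)"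
        unfolding b_def by (rule someI)
      then obtain z where z: "b ((f ^^ i) (e x)) \<in> V" "z \<in> C (b ((f ^^ i) (e x)))" "dist ((f ^^ i) (e x)) z < r" by blast
      have "dist ((f ^^ i) x) z < d"
        using dist_triangle2[of "(f ^^ i) x" z "(f ^^ i) (e x)"] close[OF that(1), of x] z(3) r
        by (simp add: dist_commute)
      then show ?thesis
        using d(2)[OF \<open>?v \<in> V\<close> z(1) _ inC z(2)] by fastforce
    qed
    define D where "D i x = (if a ((f ^^ i) x) = b ((f ^^ i) (e x)) then None else Some (a ((f ^^ i) x)))" for i x
    have Ds: "simple_function \<nu> (D i)" for i
    proof -
      have "simple_function \<nu> (\<lambda>x. a ((f ^^ i) x))"
        using simple_function_comp[OF measurable_funpow[OF fm] a] .
      from simple_function_compose1[OF simple_function_Pair[OF this e], of "\<lambda>(u, v). if u = b ((f ^^ i) v) then None else Some u"]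
      show ?thesis by (simp add: D_def[abs_def])
    qed
    have De: "obs_entropy \<nu> (D i) \<le> \<delta>" if "i < M" for i
    proof -
      have "D i -` (- {None}) \<subseteq> (f ^^ i) -` R"
        using b[OF that] by (auto simp: D_def)
      moreover have "(f ^^ i) -` R \<in> sets \<nu>"
        using measurable_sets[OF measurable_funpow[OF fm] Rm] sp by simp
      ultimately have "measure \<nu> (D i -` (- {None})) \<le> measure \<nu> ((f ^^ i) -` R)"
        by (rule finite_measure_mono)
      also have "\<dots> = measure \<nu> R"
        using measure_distr[OF measurable_funpow[OF fm] Rm, of i] distr_funpow[OF fm M_invD(5)[OF \<nu> f], of i] sp by simp
      finally have rare: "measure \<nu> (D i -` (- {None})) \<le> \<eta>" using R by simp
      have "range (D i) \<subseteq> insert None (Some ` V)" by (auto simp: D_def V_def)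
      then have "card (range (D i)) \<le> card (insert None (Some ` V))"
        using fin by (intro card_mono) auto
      also have "\<dots> \<le> Suc k" using card_image_le[OF fin, of Some] fin by (simp add: card_insert_if k_def)
      finally have "obs_entropy \<nu> (D i) \<le> 2 * real (Suc k) * sqrt \<eta> + \<eta>"
        by (rule obs_entropy_rare_le[OF prob sp Ds rare])
      then show ?thesis using \<eta>(2) by linarith
    qed
    have joint: "simple_function \<nu> (\<lambda>x. (e x, map (\<lambda>i. D i x) [0..<n])) \<and>
        obs_entropy \<nu> (\<lambda>x. (e x, map (\<lambda>i. D i x) [0..<n])) \<le> obs_entropy \<nu> e + n * \<delta>" if "n \<le> M" for n
      using that
    proof (induction n)
      case 0
      have "simple_function \<nu> (\<lambda>x. (e x, [] :: 'b option list))"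
        by (rule simple_function_compose1[OF e])
      moreover have "obs_entropy \<nu> (\<lambda>x. (e x, [] :: 'b option list)) \<le> obs_entropy \<nu> e"
        by (rule obs_entropy_factor_le[OF prob sp e]) simp
      ultimately show ?case by simp
    next
      case (Suc n)
      let ?Y = "\<lambda>x. (e x, map (\<lambda>i. D i x) [0..<n])" and ?Z = "\<lambda>x. (e x, map (\<lambda>i. D i x) [0..<Suc n])"
      have Y: "simple_function \<nu> ?Y" "obs_entropy \<nu> ?Y \<le> obs_entropy \<nu> e + n * \<delta>" using Suc by auto
      have YD: "simple_function \<nu> (\<lambda>x. (?Y x, D n x))" by (rule simple_function_Pair[OF Y(1) Ds])
      have "simple_function \<nu> ?Z"
        using simple_function_compose1[OF YD, of "\<lambda>((u, l), v). (u, l @ [v])"] by simp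
      moreover have "obs_entropy \<nu> ?Z \<le> obs_entropy \<nu> (\<lambda>x. (?Y x, D n x))"
        by (rule obs_entropy_factor_le[OF prob sp YD]) simp
      moreover have "obs_entropy \<nu> (\<lambda>x. (?Y x, D n x)) \<le> obs_entropy \<nu> ?Y + obs_entropy \<nu> (D n)"
        by (rule obs_entropy_Pair_le[OF prob sp Y(1) Ds])
      ultimately show ?case using Y(2) De[of n] Suc.prems by (simp add: algebra_simps)
    qed
    have "obs_entropy \<nu> (itinerary f a M) \<le> obs_entropy \<nu> (\<lambda>x. (e x, map (\<lambda>i. D i x) [0..<M]))"
    proof (rule obs_entropy_factor_le[OF prob sp])
      show "simple_function \<nu> (\<lambda>x. (e x, map (\<lambda>i. D i x) [0..<M]))" using joint[of M] by simp
      fix x y assume eq: "(e x, map (\<lambda>i. D i x) [0..<M]) = (e y, map (\<lambda>i. D i y) [0..<M])"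
      have "a ((f ^^ i) x) = a ((f ^^ i) y)" if "i < M" for i
      proof -
        have "D i x = D i y" "e x = e y" using eq that by (auto simp: list_eq_iff_nth_eq)
        then show ?thesis by (auto simp: D_def split: if_splits)
      qed
      then show "itinerary f a M x = itinerary f a M y" by (simp add: itinerary_eq_iff)
    qed
    then show "obs_entropy \<nu> (itinerary f a M) \<le> obs_entropy \<nu> e + M * \<delta>"
      using joint[of M] by simp
  qed
qed

lemma integral_finite_range:
  fixes g :: "'b \<Rightarrow> real"
  assumes "finite_measure \<nu>" "space \<nu> = UNIV" "simple_function \<nu> e" "finite E" "range e \<subseteq> E"
  shows "integrable \<nu> (\<lambda>x. g (e x))" "(\<integral>x. g (e x) \<partial>\<nu>) = (\<Sum>v\<in>E. measure \<nu> (e -` {v}) * g v)"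
proof -
  interpret finite_measure \<nu> by fact
  have m: "e -` {v} \<in> sets \<nu>" for v using simple_functionD(2)[OF assms(3), of "{v}"] assms(2) by simp
  have eq: "g (e x) = (\<Sum>v\<in>E. g v * indicator (e -` {v}) x)" for x
  proof -
    have "(\<Sum>v\<in>E. g v * indicator (e -` {v}) x) = (\<Sum>v\<in>E. if v = e x then g v else 0)"
      by (intro sum.cong) (auto simp: indicator_def)
    also have "\<dots> = g (e x)" using assms(4,5) by (simp add: sum.delta image_subset_iff)
    finally show ?thesis by simp
  qed
  have int: "integrable \<nu> (\<lambda>x. g v * indicator (e -` {v}) x)" for v
    using m by (intro integrable_mult_right) (simp add: integrable_indicator_iff less_top[symmetric])
  show "integrable \<nu> (\<lambda>x. g (e x))" unfolding eq by (intro Bochner_Integration.integrable_sum int)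
  show "(\<integral>x. g (e x) \<partial>\<nu>) = (\<Sum>v\<in>E. measure \<nu> (e -` {v}) * g v)"
    unfolding eq using m by (subst Bochner_Integration.integral_sum[OF int]) (simp add: mult.commute assms(2))
qed

section \<open>The lower bound\<close>

text \<open>
  Only segments of a common length \<open>M\<close> are glued. The gap \<open>N\<close> depends on the accuracy but neither
  on \<open>M\<close> nor on the number of segments, so that its share in the total time is small for large
  \<open>M\<close>.
\<close>

definition block_specification :: "('a::metric_space \<Rightarrow> 'a) \<Rightarrow> bool" where
  "block_specification f \<longleftrightarrow> (\<forall>r>0. \<exists>N. \<forall>M xs. \<exists>z. \<forall>k<length xs. \<forall>i<M.
     dist ((f ^^ (k * (M + N) + i)) z) ((f ^^ i) (xs ! k)) < r)"

lemma birkhoff_sum_add: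
  "birkhoff_sum f g (m + n) y = birkhoff_sum f g m y + birkhoff_sum f g n ((f ^^ m) y)"
proof -
  have "(\<Sum>i<m + n. g ((f ^^ i) y)) = (\<Sum>i<m. g ((f ^^ i) y)) + (\<Sum>i<n. g ((f ^^ (i + m)) y))"
    by (induction n) (simp_all add: add.commute add.left_commute)
  then show ?thesis by (simp add: birkhoff_sum_def funpow_add)
qed

lemma birkhoff_sum_bound:
  fixes g :: "'a \<Rightarrow> real" and B :: real
  assumes "\<And>x. \<bar>g x\<bar> \<le> B"
  shows "\<bar>birkhoff_sum f g n y\<bar> \<le> n * B"
proof -
  have "\<bar>birkhoff_sum f g n y\<bar> \<le> (\<Sum>i<n. \<bar>g ((f ^^ i) y)\<bar>)"
    unfolding birkhoff_sum_def by (rule sum_abs)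
  also have "\<dots> \<le> (\<Sum>i<n. B)" by (intro sum_mono assms)
  finally show ?thesis by simp
qed

lemma birkhoff_sum_close:
  fixes g :: "'a::metric_space \<Rightarrow> real" and \<delta> :: real
  assumes "\<And>u v. dist u v < \<rho> \<Longrightarrow> \<bar>g u - g v\<bar> \<le> \<delta>"
    and "\<And>i. i < M \<Longrightarrow> dist ((f ^^ i) y) ((f ^^ i) x) < \<rho>"
  shows "\<bar>birkhoff_sum f g M y - birkhoff_sum f g M x\<bar> \<le> M * \<delta>"
proof -
  have "\<bar>birkhoff_sum f g M y - birkhoff_sum f g M x\<bar> \<le> (\<Sum>i<M. \<bar>g ((f ^^ i) y) - g ((f ^^ i) x)\<bar>)"
    unfolding birkhoff_sum_def sum_subtractf[symmetric] by (rule sum_abs)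
  also have "\<dots> \<le> (\<Sum>i<M. \<delta>)" using assms by (intro sum_mono) auto
  finally show ?thesis by simp
qed

text \<open>
  Along an orbit that follows the glued segments the Birkhoff sum is the sum over the segments, up
  to \<open>\<delta>\<close> for every step in a segment and \<open>B\<close> for every step in a gap or in the remainder \<open>q\<close>.
\<close>

lemma birkhoff_sum_blocks:
  fixes g :: "'a::metric_space \<Rightarrow> real" and \<delta> B :: real
  assumes B: "\<And>x. \<bar>g x\<bar> \<le> B" and close: "\<And>u v. dist u v < \<rho> \<Longrightarrow> \<bar>g u - g v\<bar> \<le> \<delta>"
    and "\<And>k i. k < length xs \<Longrightarrow> i < M \<Longrightarrow> dist ((f ^^ (k * (M + N) + i)) y) ((f ^^ i) (xs ! k)) < \<rho>"
  shows "\<bar>birkhoff_sum f g (length xs * (M + N) + q) y - sum_list (map (birkhoff_sum f g M) xs)\<bar>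
    \<le> length xs * (M * \<delta> + N * B) + q * B"
  using assms(3)
proof (induction xs arbitrary: y)
  case Nil
  then show ?case using birkhoff_sum_bound[of g B, OF B] by simp
next
  case (Cons x xs)
  let ?S = "birkhoff_sum f g" and ?n = "length xs * (M + N) + q"
  have split: "?S (length (x # xs) * (M + N) + q) y
      = ?S M y + ?S N ((f ^^ M) y) + ?S ?n ((f ^^ (M + N)) y)"
    using birkhoff_sum_add[of f g "M + N" ?n y] birkhoff_sum_add[of f g M N y] by (simp add: add.assoc)
  have first: "\<bar>?S M y - ?S M x\<bar> \<le> M * \<delta>"
  proof (rule birkhoff_sum_close[OF close])
    show "dist ((f ^^ i) y) ((f ^^ i) x) < \<rho>" if "i < M" for i using Cons.prems[of 0 i] that by simp
  qed
  have gap: "\<bar>?S N ((f ^^ M) y)\<bar> \<le> N * B" by (rule birkhoff_sum_bound[OF B])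
  have rest: "\<bar>?S ?n ((f ^^ (M + N)) y) - sum_list (map (?S M) xs)\<bar> \<le> length xs * (M * \<delta> + N * B) + q * B"
  proof (rule Cons.IH)
    fix k i assume ki: "k < length xs" "i < M"
    have "(f ^^ (Suc k * (M + N) + i)) y = (f ^^ (k * (M + N) + i)) ((f ^^ (M + N)) y)"
      using funpow_add[of "k * (M + N) + i" "M + N" f] by (simp add: algebra_simps)
    then show "dist ((f ^^ (k * (M + N) + i)) ((f ^^ (M + N)) y)) ((f ^^ i) (xs ! k)) < \<rho>"
      using Cons.prems[of "Suc k" i] ki by simp
  qed
  have "real (length (x # xs)) * (M * \<delta> + N * B) + q * B
      = (M * \<delta> + N * B) + (length xs * (M * \<delta> + N * B) + q * B)"
    by (simp add: distrib_right)
  then show ?case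
    unfolding split using first gap rest by (simp only: list.map sum_list.Cons)
qed

lemma integral_birkhoff_sum:
  fixes g :: "'a::metric_space \<Rightarrow> real"
  assumes \<nu>: "\<nu> \<in> M_inv f" and f: "continuous_on UNIV f" and g: "continuous_on UNIV g" "\<And>x. \<bar>g x\<bar> \<le> B"
  shows "integrable \<nu> (birkhoff_sum f g n)" "(\<integral>x. birkhoff_sum f g n x \<partial>\<nu>) = n * (\<integral>x. g x \<partial>\<nu>)"
proof -
  have "prob_space \<nu>" and sets: "sets \<nu> = sets borel" and inv: "distr \<nu> borel f = \<nu>"
    using \<nu> by (auto simp: M_inv_def)
  interpret prob_space \<nu> by fact
  have fm: "f \<in> borel_measurable \<nu>"
    using borel_measurable_continuous_onI[OF f] by (simp cong: measurable_cong_sets add: sets)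
  have gf: "continuous_on UNIV (\<lambda>x. g ((f ^^ i) x))" for i
    using continuous_on_compose2[OF g(1) continuous_on_funpow[OF f]] by auto
  have int: "integrable \<nu> (\<lambda>x. g ((f ^^ i) x))" for i
    using borel_measurable_continuous_onI[OF gf[of i]] g(2)
    by (intro integrable_const_bound[of _ B]) (auto simp: sets cong: measurable_cong_sets)
  show "integrable \<nu> (birkhoff_sum f g n)"
    unfolding birkhoff_sum_def[abs_def] by (intro Bochner_Integration.integrable_sum int)
  have "(\<integral>x. g ((f ^^ i) x) \<partial>\<nu>) = (\<integral>x. g x \<partial>\<nu>)" for i
  proof (induction i)
    case (Suc i)
    have "(\<integral>x. g ((f ^^ i) x) \<partial>\<nu>) = (\<integral>x. g ((f ^^ i) x) \<partial>distr \<nu> borel f)" by (simp only: inv)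
    also have "\<dots> = (\<integral>x. g ((f ^^ i) (f x)) \<partial>\<nu>)"
      by (rule integral_distr[OF fm borel_measurable_continuous_onI[OF gf]])
    finally show ?case using Suc by (simp add: funpow_swap1)
  qed simp
  then show "(\<integral>x. birkhoff_sum f g n x \<partial>\<nu>) = n * (\<integral>x. g x \<partial>\<nu>)"
    unfolding birkhoff_sum_def by (subst Bochner_Integration.integral_sum[OF int]) simp
qed

lemma log_ereal_rate_ge:
  assumes "n > 0" "exp (a * n) \<le> t"
  shows "ereal a \<le> ereal (1 / real n) * log_ereal t"
proof -
  have "t > 0" using assms(2) by (rule less_le_trans[OF exp_gt_zero])
  then have "a * n \<le> ln t" using assms(2) by (simp add: ln_ge_iff)
  then show ?thesis using assms(1) \<open>t > 0\<close> by (simp add: log_ereal_def pos_le_divide_eq)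
qed

text \<open>
  The time is divided as \<open>n = K * R + q\<close> into \<open>K\<close> periods of length \<open>R = M + N\<close>, each a coded
  segment and a gap, and a remainder. All errors are linear in \<open>X * \<delta>\<close> with \<open>X = K * M\<close>, apart
  from terms independent of \<open>n\<close>; the margin \<open>12 * \<delta>\<close> absorbs them.
\<close>

theorem large_deviation_lower_bound:
  fixes f :: "'a::{second_countable_topology, complete_space} \<Rightarrow> 'a"
  assumes compact: "compact (UNIV :: 'a set)" and f: "continuous_on UNIV f" and gluing: "block_specification f"
    and m: "finite_measure m" "sets m = sets borel"
    and \<phi>: "continuous_on UNIV \<phi>" and \<psi>: "\<psi> \<in> V_minus f m"
    and \<nu>: "\<nu> \<in> M_inv f" and c: "c < (\<integral>x. \<phi> x \<partial>\<nu>)"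
  shows "ks_entropy f \<nu> - ereal (\<integral>x. \<psi> x \<partial>\<nu>)
    \<le> liminf (\<lambda>n. ereal (1 / real n) * log_ereal (measure m {x. birkhoff_sum f \<phi> n x / real n \<in> {c<..}}))"
    (is "_ \<le> liminf ?L")
proof (rule ccontr)
  interpret m: finite_measure m by fact
  note prob = M_invD(1)[OF \<nu> f] and sets = M_invD(2)[OF \<nu> f] and sp = M_invD(3)[OF \<nu> f]
    and fm = M_invD(4)[OF \<nu> f] and fd = M_invD(5)[OF \<nu> f]
  interpret \<nu>: prob_space \<nu> by (rule prob)
  have \<psi>c: "continuous_on UNIV \<psi>" using \<psi> by (simp add: V_minus_def)
  have bdd: "\<exists>B. \<forall>x. \<bar>g x\<bar> \<le> B" if "continuous_on UNIV g" for g :: "'a \<Rightarrow> real"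
    using compact_imp_bounded[OF compact_continuous_image[OF that compact]] by (auto simp: bounded_iff)
  let ?I\<phi> = "\<integral>x. \<phi> x \<partial>\<nu>" and ?I\<psi> = "\<integral>x. \<psi> x \<partial>\<nu>"
  assume "\<not> ?thesis"
  then obtain a where a: "liminf ?L < ereal a" "ereal a < ks_entropy f \<nu> - ereal ?I\<psi>"
    using ereal_dense2[of "liminf ?L" "ks_entropy f \<nu> - ereal ?I\<psi>"] by (auto simp: not_le)
  have "ereal (a + ?I\<psi>) < ks_entropy f \<nu>" using a(2) by (cases "ks_entropy f \<nu>") auto
  then obtain P where P: "finite P" "P \<subseteq> sets borel" "partition_on UNIV P" "a + ?I\<psi> < entropy_wrt f \<nu> P"
    unfolding ks_entropy_def by (auto simp: less_SUP_iff)
  define h where "h = entropy_wrt f \<nu> P"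
  obtain u :: "'a \<Rightarrow> 'a set" where u: "P = (\<lambda>v. u -` {v}) ` range u" "range u = P" "\<And>v. v \<in> P \<Longrightarrow> u -` {v} = v"
    using partition_eq_fibres[OF P(3)] by metis
  have us: "simple_function \<nu> u"
    using P(1,2) u(2,3) by (auto simp: simple_function_def sp sets)
  define \<delta> where "\<delta> = min (h - ?I\<psi> - a) (?I\<phi> - c) / 12"
  have \<delta>: "\<delta> > 0" "12 * \<delta> \<le> h - ?I\<psi> - a" "12 * \<delta> \<le> ?I\<phi> - c"
    using P(4) c by (auto simp: \<delta>_def h_def)
  obtain B\<phi> B\<psi> where B0: "\<And>x. \<bar>\<phi> x\<bar> \<le> B\<phi>" "\<And>x. \<bar>\<psi> x\<bar> \<le> B\<psi>" using bdd[OF \<phi>] bdd[OF \<psi>c] by metis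
  define B where "B = \<bar>B\<phi>\<bar> + \<bar>B\<psi>\<bar> + \<bar>a\<bar> + \<bar>c\<bar>"
  have B: "\<bar>\<phi> x\<bar> \<le> B" "\<bar>\<psi> x\<bar> \<le> B" "\<bar>a\<bar> \<le> B" "\<bar>c\<bar> \<le> B" "0 \<le> B" for x
    using B0[of x] by (auto simp: B_def)
  have unif: "\<exists>\<rho>>0. \<forall>x y. dist x y < \<rho> \<longrightarrow> \<bar>g x - g y\<bar> \<le> \<delta>" if gc: "continuous_on UNIV g" for g :: "'a \<Rightarrow> real"
  proof -
    from compact_uniformly_continuous[OF gc compact, unfolded uniformly_continuous_on_def, THEN spec, THEN mp, OF \<delta>(1)]
    obtain \<rho> where "0 < \<rho> \<and> (\<forall>x\<in>UNIV. \<forall>y\<in>UNIV. dist y x < \<rho> \<longrightarrow> dist (g y) (g x) < \<delta>)" ..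
    then have \<rho>: "\<rho> > 0" "\<forall>x\<in>UNIV. \<forall>y\<in>UNIV. dist y x < \<rho> \<longrightarrow> dist (g y) (g x) < \<delta>"
      by simp_all
    have "\<bar>g x - g y\<bar> \<le> \<delta>" if "dist x y < \<rho>" for x y
    proof -
      have "dist (g x) (g y) < \<delta>" using \<rho>(2) that by simp
      then show ?thesis by (simp add: dist_real_def)
    qed
    then show ?thesis using \<rho>(1) by blast
  qed
  obtain \<rho>1 \<rho>2 where \<rho>12: "\<rho>1 > 0" "\<rho>2 > 0" "\<And>x y. dist x y < \<rho>1 \<Longrightarrow> \<bar>\<phi> x - \<phi> y\<bar> \<le> \<delta>"
    "\<And>x y. dist x y < \<rho>2 \<Longrightarrow> \<bar>\<psi> x - \<psi> y\<bar> \<le> \<delta>"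
    using unif[OF \<phi>] unif[OF \<psi>c] by metis
  define \<rho> where "\<rho> = min \<rho>1 \<rho>2"
  have \<rho>: "\<rho> > 0" "\<And>x y. dist x y < \<rho> \<Longrightarrow> \<bar>\<phi> x - \<phi> y\<bar> \<le> \<delta>" "\<And>x y. dist x y < \<rho> \<Longrightarrow> \<bar>\<psi> x - \<psi> y\<bar> \<le> \<delta>"
    using \<rho>12 by (auto simp: \<rho>_def)
  obtain d where d: "d > 0" "\<And>r M (e :: 'a \<Rightarrow> 'a). 2 * r \<le> d \<Longrightarrow> simple_function \<nu> e \<Longrightarrow>
       (\<And>x i. i < M \<Longrightarrow> dist ((f ^^ i) (e x)) ((f ^^ i) x) < r) \<Longrightarrow>
       obs_entropy \<nu> (itinerary f u M) \<le> obs_entropy \<nu> e + M * \<delta>"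
    using itinerary_entropy_le_code[OF \<nu> f us \<delta>(1)] by blast
  \<comment> \<open>Three scales: centres are \<open>4 * r\<close>-separated, glued orbits are \<open>r\<close>-close to their segments, and
    Bowen balls have radius \<open>r\<close>. If balls of different words met, the orbits of two centres would
    be joined by four steps shorter than \<open>r\<close> at all times of a segment; so the balls are disjoint.
    Moreover \<open>8 * r\<close> is below the scales on which \<open>\<phi>\<close>, \<open>\<psi>\<close> and the partition are resolved.\<close>
  have "min \<rho> d / 8 > 0" using \<rho>(1) d(1) by simp
  then obtain r C where r: "r > 0" "r < min \<rho> d / 8" and C: "C > 0"
    and ball: "\<And>x n. C * exp (- birkhoff_sum f \<psi> n x) \<le> measure m (bowen_ball f n x r)"
    using \<psi> unfolding V_minus_def by blast
  obtain N where N: "\<And>M xs. \<exists>z. \<forall>k<length xs. \<forall>i<M. dist ((f ^^ (k * (M + N) + i)) z) ((f ^^ i) (xs ! k)) < r"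
    using gluing r(1) unfolding block_specification_def by blast
  obtain M :: nat where "N * B / \<delta> + 1 < M" using reals_Archimedean2 by blast
  moreover have "0 \<le> N * B / \<delta>" using B(5) \<delta>(1) by simp
  ultimately have "1 < real M" "N * B / \<delta> \<le> M" by linarith+
  then have M: "M \<ge> 1" "N * B \<le> M * \<delta>" using \<delta>(1) by (auto simp: pos_divide_le_eq)
  define R where "R = M + N"
  have R: "R > 0" using M(1) by (simp add: R_def)
  have hM: "M * h \<le> obs_entropy \<nu> (itinerary f u M)"
    using entropy_wrt_fibres(2)[OF prob sp fm fd us, of M] M(1) unfolding h_def u(1)[symmetric]
    by (simp add: field_simps)
  have r4: "4 * r > 0" using r(1) by simp
  obtain E where E: "finite E" "bowen_separated f M (4 * r) E" "UNIV \<subseteq> (\<Union>x\<in>E. bowen_ball f M x (4 * r))"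
  proof (rule maximal_bowen_separated[OF compact f r4, of UNIV M])
    fix E :: "'a set"
    assume "finite E" "bowen_separated f M (4 * r) E" "UNIV \<subseteq> (\<Union>x\<in>E. bowen_ball f M x (4 * r))"
    then show ?thesis by (rule that)
  qed
  obtain e where e: "\<And>x. e x \<in> E" "\<And>x. x \<in> bowen_ball f M (e x) (4 * r)" "simple_function \<nu> e"
  proof (rule cover_selection[OF E(1,3)])
    fix e :: "'a \<Rightarrow> 'a" and J
    assume e: "\<And>x. e x \<in> E" "\<And>x. x \<in> bowen_ball f M (e x) (4 * r)" and J: "\<And>c. finite (J c)"
      "\<And>c. c \<in> E \<Longrightarrow> e -` {c} = bowen_ball f M c (4 * r) \<inter> (\<Inter>j\<in>J c. - bowen_ball f M j (4 * r))"
    have o: "bowen_ball f M j (4 * r) \<in> sets borel" for j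
      using open_bowen_ball[OF f] by (rule borel_open)
    have "e -` {c} \<in> sets borel" for c
    proof (cases "c \<in> E")
      case True
      have "e -` {c} = bowen_ball f M c (4 * r) - (\<Union>j\<in>J c. bowen_ball f M j (4 * r))"
        unfolding J(2)[OF True] by blast
      also have "\<dots> \<in> sets borel" by (intro sets.Diff sets.finite_UN J(1) o)
      finally show ?thesis .
    next
      case False
      then have "e -` {c} = {}" using e(1) by auto
      then show ?thesis by simp
    qed
    then have "simple_function \<nu> e"
      using e(1) finite_subset[OF _ E(1), of "range e"] by (auto simp: simple_function_def sp sets)
    with e show ?thesis by (rule that)
  qed
  have e_close: "dist ((f ^^ i) (e x)) ((f ^^ i) x) < 4 * r" if "i < M" for i x
    using e(2)[of x] that by (simp add: bowen_ball_def)
  have He: "M * h - M * \<delta> \<le> obs_entropy \<nu> e"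
    using d(2)[OF _ e(3) e_close] hM r by fastforce
  \<comment> \<open>Codes of probability zero are removed from the alphabet: \<open>ln (p v)\<close> is to be finite.\<close>
  define p where "p v = measure \<nu> (e -` {v})" for v
  define A where "A = {v \<in> E. p v > 0}"
  have A: "finite A" "\<And>v. v \<in> A \<Longrightarrow> 0 < p v" using E(1) by (auto simp: A_def)
  have sumA: "(\<Sum>v\<in>E. p v * g v) = (\<Sum>v\<in>A. p v * g v)" for g
    by (rule sum.mono_neutral_right[OF E(1)]) (auto simp: A_def p_def not_less measure_le_0_iff)
  have ran: "range e \<subseteq> E" using e(1) by auto
  have mean: "integrable \<nu> (\<lambda>x. g (e x))" "(\<integral>x. g (e x) \<partial>\<nu>) = (\<Sum>v\<in>A. p v * g v)" for g :: "'a \<Rightarrow> real"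
    using integral_finite_range[OF \<nu>.finite_measure_axioms sp e(3) E(1) ran, of g] sumA[of g] by (simp_all add: p_def)
  have p1: "(\<Sum>v\<in>A. p v) = 1" using mean(2)[of "\<lambda>_. 1"] \<nu>.prob_space sp by simp
  have Hp: "obs_entropy \<nu> e = (\<Sum>v\<in>A. - (p v * ln (p v)))"
    using obs_entropy_sum_superset[OF E(1) ran, of \<nu>] sumA[of "\<lambda>v. - ln (p v)"] by (simp add: p_def)
  have mean_close: "\<bar>(\<Sum>v\<in>A. p v * birkhoff_sum f g M v) - M * (\<integral>x. g x \<partial>\<nu>)\<bar> \<le> M * \<delta>"
    if g: "continuous_on UNIV g" "\<And>x. \<bar>g x\<bar> \<le> B" "\<And>x y. dist x y < \<rho> \<Longrightarrow> \<bar>g x - g y\<bar> \<le> \<delta>" for g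
  proof -
    note int = integral_birkhoff_sum[OF \<nu> f g(1,2)]
    have "(\<Sum>v\<in>A. p v * birkhoff_sum f g M v) - M * (\<integral>x. g x \<partial>\<nu>)
        = (\<integral>x. birkhoff_sum f g M (e x) - birkhoff_sum f g M x \<partial>\<nu>)"
      using Bochner_Integration.integral_diff[OF mean(1)[of "birkhoff_sum f g M"] int(1)[of M]]
      by (simp add: mean(2) int(2))
    also have "\<bar>\<dots>\<bar> \<le> (\<integral>x. \<bar>birkhoff_sum f g M (e x) - birkhoff_sum f g M x\<bar> \<partial>\<nu>)"
      by (rule integral_abs_bound)
    also have "\<dots> \<le> (\<integral>x. M * \<delta> \<partial>\<nu>)"
    proof (rule integral_mono)
      show "integrable \<nu> (\<lambda>x. \<bar>birkhoff_sum f g M (e x) - birkhoff_sum f g M x\<bar>)"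
        by (intro integrable_abs Bochner_Integration.integrable_diff mean(1) int(1))
      show "\<bar>birkhoff_sum f g M (e x) - birkhoff_sum f g M x\<bar> \<le> M * \<delta>" for x
      proof (rule birkhoff_sum_close[OF g(3)])
        show "dist ((f ^^ i) (e x)) ((f ^^ i) x) < \<rho>" if "i < M" for i
          using e_close[OF that, of x] r by simp
      qed
    qed simp
    finally show ?thesis using \<nu>.prob_space by simp
  qed
  let ?F = "birkhoff_sum f \<phi> M" and ?G = "birkhoff_sum f \<psi> M"
  have mF: "M * ?I\<phi> - M * \<delta> \<le> (\<Sum>v\<in>A. p v * ?F v)"
    using mean_close[OF \<phi> B(1) \<rho>(2)] by linarith
  have mG: "(\<Sum>v\<in>A. p v * ?G v) \<le> M * ?I\<psi> + M * \<delta>"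
    using mean_close[OF \<psi>c B(2) \<rho>(3)] by linarith
  obtain K0 where K0: "\<And>K. K \<ge> K0 \<Longrightarrow>
    1/2 * exp (K * ((\<Sum>v\<in>A. - (p v * ln (p v))) - (\<Sum>v\<in>A. p v * ?G v) - \<delta>))
      \<le> (\<Sum>xs | xs \<in> words A K \<and> K * ((\<Sum>v\<in>A. p v * ?F v) - \<delta>) \<le> sum_list (map ?F xs).
            exp (- sum_list (map ?G xs)))"
    using typical_words[OF A p1 \<delta>(1), where F = ?F and G = ?G] by blast
  have "\<forall>xs. \<exists>z. \<forall>k<length xs. \<forall>i<M. dist ((f ^^ (k * R + i)) z) ((f ^^ i) (xs ! k)) < r"
    unfolding R_def by (intro allI N)
  from choice[OF this] obtain z
    where zall: "\<forall>xs. \<forall>k<length xs. \<forall>i<M. dist ((f ^^ (k * R + i)) (z xs)) ((f ^^ i) (xs ! k)) < r" ..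
  have z: "dist ((f ^^ (k * R + i)) (z xs)) ((f ^^ i) (xs ! k)) < r" if "k < length xs" "i < M" for k xs i
    using zall that by simp
  \<comment> \<open>From \<open>K1\<close> periods on, the gain \<open>5 * (X * \<delta>)\<close> exceeds the losses independent of \<open>n\<close>, which are
    the incomplete period and the constant \<open>C / 2\<close>.\<close>
  obtain K1 :: nat where K1: "(2 * R * B + \<bar>ln (C / 2)\<bar> + 1) / (5 * M * \<delta>) < K1"
    using reals_Archimedean2 by blast
  define n0 where "n0 = Suc (max K0 K1) * R"
  have key: "ereal a \<le> ?L n" if n: "n \<ge> n0" for n
  proof -
    define K q where "K = n div R" and "q = n mod R"
    have nK: "n = K * R + q" "q < R" using R by (simp_all add: K_def q_def)
    have "Suc (max K0 K1) * R div R \<le> n div R" using n unfolding n0_def by (rule div_le_mono)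
    then have KK: "K \<ge> K0" "K \<ge> K1" "K \<ge> 1" using R by (simp_all add: K_def)
    have n_pos: "n > 0" using KK(3) R unfolding nK(1) by simp
    define X where "X = real K * real M"
    have X: "real K * \<delta> \<le> X * \<delta>" "real K * real N * B \<le> X * \<delta>"
    proof -
      have "real K * (1 * \<delta>) \<le> real K * (real M * \<delta>)"
        using M(1) \<delta>(1) by (intro mult_left_mono mult_right_mono) auto
      then show "real K * \<delta> \<le> X * \<delta>" by (simp add: X_def)
      have "real K * (N * B) \<le> real K * (M * \<delta>)" using M(2) by (intro mult_left_mono) auto
      then show "real K * real N * B \<le> X * \<delta>" by (simp add: X_def mult.assoc)
    qed
    have X\<delta>: "0 \<le> X * \<delta>" using \<delta>(1) by (simp add: X_def)
    have big: "2 * R * B + \<bar>ln (C / 2)\<bar> + 1 < 5 * (X * \<delta>)"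
    proof -
      have "(2 * R * B + \<bar>ln (C / 2)\<bar> + 1) / (5 * M * \<delta>) < K" using K1 KK(2) by linarith
      then show ?thesis using M(1) \<delta>(1) by (simp add: X_def field_simps)
    qed
    have qB: "real q * B \<le> R * B" using nK(2) B(5) by (intro mult_right_mono) auto
    have lin: "real n * t \<le> X * t + X * \<delta> + R * B" if t: "\<bar>t\<bar> \<le> B" for t
    proof -
      have "real K * real N * t \<le> real K * real N * B" using t by (intro mult_left_mono) auto
      moreover have "real q * t \<le> real q * B" using t by (intro mult_left_mono) auto
      moreover have "real n * t = X * t + real K * real N * t + real q * t"
        unfolding nK(1) by (simp add: R_def X_def algebra_simps)
      ultimately show ?thesis using X(2) qB by linarith
    qed
    let ?T = "{xs \<in> words A K. K * ((\<Sum>v\<in>A. p v * ?F v) - \<delta>) \<le> sum_list (map ?F xs)}"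
    let ?ball = "\<lambda>xs. bowen_ball f n (z xs) r"
    have finT: "finite ?T" using finite_words[OF A(1), of K] by simp
    have track: "\<bar>birkhoff_sum f g n y - sum_list (map (birkhoff_sum f g M) xs)\<bar> \<le> 2 * (X * \<delta>) + R * B"
      if g: "\<And>x. \<bar>g x\<bar> \<le> B" "\<And>x y. dist x y < \<rho> \<Longrightarrow> \<bar>g x - g y\<bar> \<le> \<delta>"
        and y: "xs \<in> words A K" "y \<in> ?ball xs" for g y xs
    proof -
      have len: "length xs = K" using y(1) by (simp add: words_def)
      have "dist ((f ^^ (k * (M + N) + i)) y) ((f ^^ i) (xs ! k)) < \<rho>" if ki: "k < length xs" "i < M" for k i
      proof -
        have "k * R + i < Suc k * R" using ki by (simp add: R_def)
        also have "\<dots> \<le> K * R" using ki(1) len by (intro mult_right_mono) auto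
        finally have "k * R + i < n" by (simp add: nK(1))
        then have "dist ((f ^^ (k * R + i)) (z xs)) ((f ^^ (k * R + i)) y) < r"
          using y(2) by (simp add: bowen_ball_def)
        then show ?thesis
          using z[OF ki] r dist_triangle2[of "(f ^^ (k * R + i)) y" "(f ^^ i) (xs ! k)" "(f ^^ (k * R + i)) (z xs)"]
          by (simp add: R_def dist_commute)
      qed
      from birkhoff_sum_blocks[where f = f and xs = xs and M = M and N = N and y = y and q = q, OF g this]
      have "\<bar>birkhoff_sum f g n y - sum_list (map (birkhoff_sum f g M) xs)\<bar> \<le> K * (M * \<delta> + N * B) + q * B"
        by (simp add: len nK(1) R_def)
      also have "K * (M * \<delta> + N * B) = X * \<delta> + real K * real N * B" by (simp add: X_def algebra_simps)
      finally show ?thesis using X(2) qB by linarith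
    qed
    have track\<phi>: "\<bar>birkhoff_sum f \<phi> n y - sum_list (map ?F xs)\<bar> \<le> 2 * (X * \<delta>) + R * B"
      if "xs \<in> words A K" "y \<in> ?ball xs" for xs y
      by (rule track[OF _ _ that]) (fact B(1) \<rho>(2))+
    have track\<psi>: "\<bar>birkhoff_sum f \<psi> n y - sum_list (map ?G xs)\<bar> \<le> 2 * (X * \<delta>) + R * B"
      if "xs \<in> words A K" "y \<in> ?ball xs" for xs y
      by (rule track[OF _ _ that]) (fact B(2) \<rho>(3))+
    have self: "z xs \<in> ?ball xs" for xs by (rule self_in_bowen_ball[OF r(1)])
    have sub: "?ball xs \<subseteq> {x. birkhoff_sum f \<phi> n x / real n \<in> {c<..}}" if xs: "xs \<in> ?T" for xs
    proof
      fix y assume "y \<in> ?ball xs"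
      then have "sum_list (map ?F xs) - 2 * (X * \<delta>) - R * B \<le> birkhoff_sum f \<phi> n y"
        using track\<phi>[OF _ \<open>y \<in> ?ball xs\<close>] xs by auto
      moreover have "K * (M * ?I\<phi> - M * \<delta> - \<delta>) \<le> sum_list (map ?F xs)"
        using xs mF mult_left_mono[of "M * ?I\<phi> - M * \<delta> - \<delta>" "(\<Sum>v\<in>A. p v * ?F v) - \<delta>" "real K"] by auto
      moreover have "K * (M * ?I\<phi> - M * \<delta> - \<delta>) = X * ?I\<phi> - X * \<delta> - real K * \<delta>"
        by (simp add: X_def algebra_simps)
      moreover have "X * (c + 12 * \<delta>) \<le> X * ?I\<phi>" using \<delta>(3) by (intro mult_left_mono) (auto simp: X_def)
      then have "X * c + 12 * (X * \<delta>) \<le> X * ?I\<phi>" by (simp add: algebra_simps)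
      ultimately have "real n * c < birkhoff_sum f \<phi> n y"
        using lin[OF B(4)] X(1) big X\<delta> by linarith
      then show "y \<in> {x. birkhoff_sum f \<phi> n x / real n \<in> {c<..}}"
        using n_pos by (simp add: field_simps)
    qed
    have disj: "disjoint_family_on ?ball ?T"
      unfolding disjoint_family_on_def
    proof (intro ballI impI, rule ccontr)
      fix xs ys assume xs: "xs \<in> ?T" and ys: "ys \<in> ?T" and ne: "xs \<noteq> ys" and "?ball xs \<inter> ?ball ys \<noteq> {}"
      then obtain y where y: "y \<in> ?ball xs" "y \<in> ?ball ys" by blast
      have len: "length xs = K" "length ys = K" using xs ys by (auto simp: words_def)
      then obtain k where k: "k < K" "xs ! k \<noteq> ys ! k" using ne by (metis nth_equalityI)
      have "xs ! k \<in> E" "ys ! k \<in> E" using xs ys k(1) len nth_mem by (auto simp: words_def A_def subset_eq)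
      then obtain i where i: "i < M" "4 * r \<le> dist ((f ^^ i) (xs ! k)) ((f ^^ i) (ys ! k))"
        using E(2) k(2) unfolding bowen_separated_def bowen_ball_def by (auto simp: not_less)
      have "k * R + i < Suc k * R" using i by (simp add: R_def)
      also have "\<dots> \<le> K * R" using k(1) by (intro mult_right_mono) auto
      finally have "k * R + i < n" by (simp add: nK(1))
      then have "dist ((f ^^ (k * R + i)) (z xs)) ((f ^^ (k * R + i)) y) < r"
        "dist ((f ^^ (k * R + i)) (z ys)) ((f ^^ (k * R + i)) y) < r"
        using y by (auto simp: bowen_ball_def)
      moreover have "dist ((f ^^ (k * R + i)) (z xs)) ((f ^^ i) (xs ! k)) < r"
        "dist ((f ^^ (k * R + i)) (z ys)) ((f ^^ i) (ys ! k)) < r"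
        using z[of k xs i] z[of k ys i] k(1) i(1) len by auto
      moreover have "dist ((f ^^ i) (xs ! k)) ((f ^^ i) (ys ! k))
          \<le> dist ((f ^^ (k * R + i)) (z xs)) ((f ^^ i) (xs ! k)) + dist ((f ^^ (k * R + i)) (z xs)) ((f ^^ (k * R + i)) y)
          + (dist ((f ^^ (k * R + i)) (z ys)) ((f ^^ (k * R + i)) y) + dist ((f ^^ (k * R + i)) (z ys)) ((f ^^ i) (ys ! k)))"
        using dist_triangle[of "(f ^^ i) (xs ! k)" "(f ^^ i) (ys ! k)" "(f ^^ (k * R + i)) (z xs)"]
          dist_triangle[of "(f ^^ (k * R + i)) (z xs)" "(f ^^ i) (ys ! k)" "(f ^^ (k * R + i)) y"]
          dist_triangle[of "(f ^^ (k * R + i)) y" "(f ^^ i) (ys ! k)" "(f ^^ (k * R + i)) (z ys)"]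
        by (simp only: dist_commute[of _ "(f ^^ (k * R + i)) (z xs)"] dist_commute[of _ "(f ^^ (k * R + i)) (z ys)"])
      ultimately show False using i(2) by linarith
    qed
    have Bm: "?ball xs \<in> sets m" for xs using open_bowen_ball[OF f] by (simp add: m(2) borel_open)
    have Xm: "{x. birkhoff_sum f \<phi> n x / real n \<in> {c<..}} \<in> sets m"
    proof -
      have "open {x. c < birkhoff_sum f \<phi> n x / real n}"
        using n_pos by (intro open_Collect_less continuous_on_const continuous_on_divide continuous_on_birkhoff_sum f \<phi>) auto
      then show ?thesis by (simp add: m(2) borel_open)
    qed
    have "C * exp (- 2 * (X * \<delta>) - R * B) * (1/2 * exp (K * (obs_entropy \<nu> e - (\<Sum>v\<in>A. p v * ?G v) - \<delta>)))
        \<le> C * exp (- 2 * (X * \<delta>) - R * B) * (\<Sum>xs\<in>?T. exp (- sum_list (map ?G xs)))"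
      using K0[OF KK(1)] C unfolding Hp by (intro mult_left_mono) auto
    also have "\<dots> = (\<Sum>xs\<in>?T. C * exp (- sum_list (map ?G xs) - 2 * (X * \<delta>) - R * B))"
      unfolding sum_distrib_left by (intro sum.cong refl) (simp add: exp_add[symmetric] mult.assoc)
    also have "\<dots> \<le> (\<Sum>xs\<in>?T. measure m (?ball xs))"
    proof (rule sum_mono)
      fix xs assume "xs \<in> ?T"
      then have "birkhoff_sum f \<psi> n (z xs) \<le> sum_list (map ?G xs) + 2 * (X * \<delta>) + R * B"
        using track\<psi>[OF _ self[of xs]] by auto
      then have "C * exp (- sum_list (map ?G xs) - 2 * (X * \<delta>) - R * B) \<le> C * exp (- birkhoff_sum f \<psi> n (z xs))"
        using C by (intro mult_left_mono) auto
      also have "\<dots> \<le> measure m (?ball xs)" by (rule ball)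
      finally show "C * exp (- sum_list (map ?G xs) - 2 * (X * \<delta>) - R * B) \<le> measure m (?ball xs)" .
    qed
    also have "\<dots> = measure m (\<Union>xs\<in>?T. ?ball xs)"
      using Bm by (intro m.finite_measure_finite_Union[symmetric] finT disj) auto
    also have "\<dots> \<le> measure m {x. birkhoff_sum f \<phi> n x / real n \<in> {c<..}}"
      using sub by (intro m.finite_measure_mono Xm) blast
    finally have meas: "C * exp (- 2 * (X * \<delta>) - R * B) * (1/2 * exp (K * (obs_entropy \<nu> e - (\<Sum>v\<in>A. p v * ?G v) - \<delta>)))
        \<le> measure m {x. birkhoff_sum f \<phi> n x / real n \<in> {c<..}}" .
    have "a * n \<le> ln (C / 2) + (- 2 * (X * \<delta>) - R * B) + K * (obs_entropy \<nu> e - (\<Sum>v\<in>A. p v * ?G v) - \<delta>)"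
    proof -
      have "K * (M * (h - ?I\<psi>) - 2 * (M * \<delta>) - \<delta>) \<le> K * (obs_entropy \<nu> e - (\<Sum>v\<in>A. p v * ?G v) - \<delta>)"
        using He mG by (intro mult_left_mono) (auto simp: algebra_simps)
      moreover have "K * (M * (h - ?I\<psi>) - 2 * (M * \<delta>) - \<delta>) = X * (h - ?I\<psi>) - 2 * (X * \<delta>) - real K * \<delta>"
        by (simp add: X_def algebra_simps)
      moreover have "X * (a + 12 * \<delta>) \<le> X * (h - ?I\<psi>)" using \<delta>(2) by (intro mult_left_mono) (auto simp: X_def)
      then have "X * a + 12 * (X * \<delta>) \<le> X * (h - ?I\<psi>)" by (simp add: algebra_simps)
      ultimately show ?thesis using lin[OF B(3)] X(1) big X\<delta> by (simp only: mult.commute[of a])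
    qed
    then have "exp (a * n) \<le> exp (ln (C / 2) + (- 2 * (X * \<delta>) - R * B) + K * (obs_entropy \<nu> e - (\<Sum>v\<in>A. p v * ?G v) - \<delta>))"
      by simp
    also have "\<dots> = C * exp (- 2 * (X * \<delta>) - R * B) * (1/2 * exp (K * (obs_entropy \<nu> e - (\<Sum>v\<in>A. p v * ?G v) - \<delta>)))"
      using C by (simp add: exp_add)
    finally show ?thesis using meas by (intro log_ereal_rate_ge[OF n_pos]) linarith
  qed
  have "ereal a \<le> liminf ?L"
    by (rule Liminf_bounded, rule eventually_sequentiallyI[of n0]) (rule key)
  then show False using a(1) by simp
qed

section \<open>A space-filling curve\<close>

lemma dist_tor_le: "dist (tor v) (tor w) \<le> dist v w"
proof (rule ccontr)
  assume "\<not> ?thesis"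
  then have "\<exists>v' w'. tor v' = tor v \<and> tor w' = tor w \<and> dist v' w' < dist (tor v) (tor w)"
    by (intro exI[of _ v] exI[of _ w]) simp
  then have "dist (tor v) (tor w) < dist (tor v) (tor w)" by (simp only: dist_torus_less_iff[symmetric])
  then show False by simp
qed

lemma continuous_on_tor: "continuous_on UNIV tor"
proof (rule continuous_onI)
  show "\<exists>d>0. \<forall>x'\<in>UNIV. dist x' x < d \<longrightarrow> dist (tor x') (tor x) \<le> e" if "e > 0" for x e
    using that dist_tor_le by (meson less_imp_le order_trans)
qed

text \<open>
  A continuous function of period \<open>2\<close> that is \<open>0\<close> within distance \<open>1/3\<close> of the even integers and
  \<open>1\<close> within distance \<open>1/3\<close> of the odd integers. For a point \<open>t\<close> of the Cantor set
  its value at \<open>3 ^ j * t\<close> tells whether the ternary digit of \<open>t\<close> at \<open>1 / 3 ^ Suc j\<close> is \<open>0\<close> or \<open>2\<close>.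
\<close>

definition digit_wave :: "real \<Rightarrow> real" where
  "digit_wave t = max 0 (min 1 (1/2 - cos (pi * t)))"

lemma digit_wave_bounds: "0 \<le> digit_wave t" "digit_wave t \<le> 1"
  by (auto simp: digit_wave_def)

lemma digit_wave_shift: "digit_wave (2 * of_int m + s) = digit_wave s"
proof -
  have "cos (pi * (2 * of_int m + s)) = cos (pi * s + of_int m * (2 * pi))" by (simp add: algebra_simps)
  also have "\<dots> = cos (pi * s)" using cos.plus_of_int[of "pi * s" m] by simp
  finally show ?thesis by (simp add: digit_wave_def)
qed

lemma digit_wave_0:
  assumes "0 \<le> s" "s \<le> 1/3"
  shows "digit_wave s = 0"
proof -
  have "cos (pi / 3) \<le> cos (pi * s)" using assms pi_gt_zero by (intro cos_monotone_0_pi_le) (auto simp: field_simps)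
  then show ?thesis by (simp add: digit_wave_def cos_60)
qed

lemma digit_wave_1:
  assumes "2/3 \<le> s" "s \<le> 1"
  shows "digit_wave s = 1"
proof -
  have "cos (pi * s) \<le> cos (2 * pi / 3)" using assms pi_gt_zero by (intro cos_monotone_0_pi_le) (auto simp: field_simps)
  also have "cos (2 * pi / 3) = - 1/2" using cos_120 by simp
  finally show ?thesis by (simp add: digit_wave_def)
qed

text \<open>
  In \<open>3 ^ j * t\<close> the digits before the \<open>j\<close>-th one add up to an even integer, and those after it
  contribute at most \<open>1/3\<close>.
\<close>

lemma digit_wave_ternary:
  fixes a :: "nat \<Rightarrow> nat"
  assumes a: "\<And>i. a i \<le> 1"
  defines "t \<equiv> (\<Sum>i. 2 * real (a i) / 3 ^ Suc i)"
  shows "0 \<le> t" "t \<le> 1" "digit_wave (3 ^ j * t) = a j"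
proof -
  have geo: "(\<lambda>i. 2 * (1/3) ^ Suc i) sums (1 :: real)"
    using sums_mult[OF geometric_sums[of "1/3 :: real"], of "2/3"] by (simp add: mult.commute)
  have bound: "2 * real (b i) / 3 ^ Suc i \<le> 2 * (1/3) ^ Suc i" if "b i \<le> 1" for b :: "nat \<Rightarrow> nat" and i
  proof -
    have "2 * real (b i) / 3 ^ Suc i \<le> 2 * 1 / 3 ^ Suc i" using that by (intro divide_right_mono) auto
    also have "2 * 1 / 3 ^ Suc i = 2 * (1/3 :: real) ^ Suc i" by (simp only: power_one_over times_divide_eq_right)
    finally show ?thesis .
  qed
  have summ: "summable (\<lambda>i. 2 * real (b i) / 3 ^ Suc i)" if "\<And>i. b i \<le> 1" for b :: "nat \<Rightarrow> nat"
  proof (rule summable_comparison_test'[OF sums_summable[OF geo], of 0])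
    fix i
    have "0 \<le> 2 * real (b i) / 3 ^ Suc i" by simp
    then show "norm (2 * real (b i) / 3 ^ Suc i) \<le> 2 * (1/3) ^ Suc i"
      using bound[where b = b and i = i, OF that] by (simp only: real_norm_def abs_of_nonneg)
  qed
  have range: "0 \<le> (\<Sum>i. 2 * real (b i) / 3 ^ Suc i)" "(\<Sum>i. 2 * real (b i) / 3 ^ Suc i) \<le> 1"
    if "\<And>i. b i \<le> 1" for b :: "nat \<Rightarrow> nat"
  proof -
    show "0 \<le> (\<Sum>i. 2 * real (b i) / 3 ^ Suc i)" by (intro suminf_nonneg summ that) auto
    have "(\<Sum>i. 2 * real (b i) / 3 ^ Suc i) \<le> (\<Sum>i. 2 * (1/3) ^ Suc i)"
      by (rule suminf_le[OF bound summ sums_summable[OF geo]]) (rule that)+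
    then show "(\<Sum>i. 2 * real (b i) / 3 ^ Suc i) \<le> 1" using sums_unique[OF geo] by simp
  qed
  show "0 \<le> t" "t \<le> 1" unfolding t_def using range[of a] a by auto
  define T where "T = (\<Sum>i. 2 * real (a (i + Suc j)) / 3 ^ Suc i)"
  have T: "0 \<le> T" "T \<le> 1" unfolding T_def using range[of "\<lambda>i. a (i + Suc j)"] a by auto
  have "t = (\<Sum>i. 2 * real (a (i + Suc j)) / 3 ^ Suc (i + Suc j)) + (\<Sum>i<Suc j. 2 * real (a i) / 3 ^ Suc i)"
    unfolding t_def by (rule suminf_split_initial_segment[OF summ[OF a]])
  also have "(\<Sum>i. 2 * real (a (i + Suc j)) / 3 ^ Suc (i + Suc j)) = T / 3 ^ Suc j"
    unfolding T_def using suminf_divide[OF summ[of "\<lambda>i. a (i + Suc j)"], of "3 ^ Suc j"] a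
    by (simp add: power_add mult.commute mult.left_commute)
  finally have "3 ^ j * t = 3 ^ j * (\<Sum>i<j. 2 * real (a i) / 3 ^ Suc i) + (2 * real (a j) / 3 + T / 3)"
    by (simp add: algebra_simps)
  also have "3 ^ j * (\<Sum>i<j. 2 * real (a i) / 3 ^ Suc i) = 2 * of_int (\<Sum>i<j. int (a i) * 3 ^ (j - Suc i))"
  proof -
    have "3 ^ j * (2 * real (a i) / 3 ^ Suc i) = 2 * of_int (int (a i) * 3 ^ (j - Suc i))" if "i < j" for i
    proof -
      have "(3 :: real) ^ j = 3 ^ (Suc i + (j - Suc i))" using that by simp
      also have "\<dots> = 3 ^ Suc i * 3 ^ (j - Suc i)" by (rule power_add)
      finally have "(3 :: real) ^ j = 3 ^ Suc i * 3 ^ (j - Suc i)" .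
      then show ?thesis by simp
    qed
    then show ?thesis by (simp add: sum_distrib_left)
  qed
  finally have "digit_wave (3 ^ j * t) = digit_wave (2 * real (a j) / 3 + T / 3)"
    by (simp only: digit_wave_shift)
  also have "\<dots> = a j"
  proof (cases "a j = 0")
    case True
    then show ?thesis using T by (simp add: digit_wave_0)
  next
    case False
    then have "a j = 1" using a[of j] by simp
    then show ?thesis using T by (simp add: digit_wave_1)
  qed
  finally show "digit_wave (3 ^ j * t) = a j" .
qed

text \<open>
  The digits are differences of \<open>\<lfloor>2 ^ k * x\<rfloor>\<close>, so the partial sums are \<open>\<lfloor>2 ^ n * x\<rfloor> / 2 ^ n\<close>.
\<close>

lemma binary_digits:
  fixes x :: real
  assumes "0 \<le> x" "x < 1"
  obtains b :: "nat \<Rightarrow> nat" where "\<And>k. b k \<le> 1" "(\<lambda>k. real (b k) / 2 ^ Suc k) sums x"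
proof
  define F where "F k = \<lfloor>2 ^ k * x\<rfloor>" for k
  have F: "2 * F k \<le> F (Suc k)" "F (Suc k) \<le> 2 * F k + 1" for k
  proof -
    show "2 * F k \<le> F (Suc k)"
      unfolding F_def by (simp add: le_floor_iff mult.assoc)
    have "2 ^ Suc k * x < of_int (2 * F k + 2)"
      using real_of_int_floor_add_one_gt[of "2 ^ k * x"] by (simp only: F_def power_Suc mult.assoc)
    then show "F (Suc k) \<le> 2 * F k + 1" unfolding F_def[of "Suc k"] by (simp add: floor_le_iff)
  qed
  define b where "b k = nat (F (Suc k) - 2 * F k)" for k
  show "b k \<le> 1" for k using F[of k] by (simp add: b_def)
  have "F 0 = 0" using assms by (simp add: F_def floor_eq_iff)
  have partial: "(\<Sum>k<n. real (b k) / 2 ^ Suc k) = F n / 2 ^ n" for n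
  proof (induction n)
    case 0
    then show ?case using \<open>F 0 = 0\<close> by simp
  next
    case (Suc n)
    have "real (b n) = F (Suc n) - 2 * F n" using F[of n] by (simp add: b_def)
    then show ?case using Suc by (simp add: field_simps)
  qed
  have "(\<lambda>n. F n / 2 ^ n) \<longlonglongrightarrow> x"
  proof (rule tendsto_sandwich)
    have "(\<lambda>n. x - (1/2) ^ n) \<longlonglongrightarrow> x - 0" by (intro tendsto_intros LIMSEQ_power_zero) auto
    then show "(\<lambda>n. x - (1/2) ^ n) \<longlonglongrightarrow> x" by simp
    show "\<forall>\<^sub>F n in sequentially. x - (1/2) ^ n \<le> F n / 2 ^ n"
    proof (intro always_eventually allI)
      fix n
      have "2 ^ n * x < F n + 1" using real_of_int_floor_add_one_gt[of "2 ^ n * x"] by (simp add: F_def)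
      then have "x \<le> (F n + 1) / 2 ^ n" by (simp add: pos_le_divide_eq mult.commute)
      then show "x - (1/2) ^ n \<le> F n / 2 ^ n" by (simp add: add_divide_distrib power_one_over)
    qed
    show "\<forall>\<^sub>F n in sequentially. F n / 2 ^ n \<le> x"
    proof (intro always_eventually allI)
      fix n
      have "F n \<le> 2 ^ n * x" by (simp add: F_def)
      then show "F n / 2 ^ n \<le> x" by (simp add: field_simps)
    qed
  qed simp
  then show "(\<lambda>k. real (b k) / 2 ^ Suc k) sums x" unfolding sums_def partial .
qed

text \<open>
  The coordinates \<open>l = 0\<close> and \<open>l = 1\<close> of Schoenberg's space-filling curve: the binary digits of the
  first coordinate are read from the even ternary digits of \<open>t\<close>, those of the second from the odd
  ones.
\<close>

definition schoenberg :: "nat \<Rightarrow> real \<Rightarrow> real" where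
  "schoenberg l t = (\<Sum>k. digit_wave (3 ^ (2 * k + l) * t) / 2 ^ Suc k)"

lemma continuous_on_schoenberg: "continuous_on UNIV (schoenberg l)"
proof -
  have "uniform_limit UNIV (\<lambda>n t. \<Sum>k<n. digit_wave (3 ^ (2 * k + l) * t) / 2 ^ Suc k) (schoenberg l) sequentially"
    unfolding schoenberg_def[abs_def]
  proof (rule Weierstrass_m_test)
    show "norm (digit_wave (3 ^ (2 * k + l) * t) / 2 ^ Suc k) \<le> (1/2) ^ k" for k t
    proof -
      have "digit_wave (3 ^ (2 * k + l) * t) / 2 ^ Suc k \<le> 1 / 2 ^ k"
        using digit_wave_bounds[of "3 ^ (2 * k + l) * t"] by (intro frac_le) auto
      then show ?thesis using digit_wave_bounds by (simp add: power_one_over)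
    qed
    show "summable (\<lambda>k. (1/2 :: real) ^ k)" by (simp add: summable_geometric)
  qed
  note ul = this
  have ct: "continuous_on UNIV (\<lambda>t. \<Sum>k<n. digit_wave (3 ^ (2 * k + l) * t) / 2 ^ Suc k)" for n
    unfolding digit_wave_def by (intro continuous_intros) auto
  show ?thesis
    by (rule uniform_limit_theorem[OF always_eventually[OF allI[OF ct]] ul]) simp
qed

lemma schoenberg_surj:
  assumes "0 \<le> x" "x < 1" "0 \<le> y" "y < 1"
  obtains t where "t \<in> {0..1}" "schoenberg 0 t = x" "schoenberg 1 t = y"
proof -
  obtain b where b: "\<And>k. b k \<le> 1" "(\<lambda>k. real (b k) / 2 ^ Suc k) sums x"
    using binary_digits[OF assms(1,2)] by blast
  obtain c where c: "\<And>k. c k \<le> 1" "(\<lambda>k. real (c k) / 2 ^ Suc k) sums y"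
    using binary_digits[OF assms(3,4)] by blast
  define a where "a i = (if even i then b (i div 2) else c (i div 2))" for i
  have a: "a i \<le> 1" for i using b(1) c(1) by (simp add: a_def)
  define t where "t = (\<Sum>i. 2 * real (a i) / 3 ^ Suc i)"
  note w = digit_wave_ternary[of a, OF a, folded t_def]
  show ?thesis
  proof
    show "t \<in> {0..1}" using w by simp
    show "schoenberg 0 t = x"
      using sums_unique[OF b(2)] by (simp only: schoenberg_def w(3)) (simp add: a_def)
    show "schoenberg 1 t = y"
      using sums_unique[OF c(2)] by (simp only: schoenberg_def w(3)) (simp add: a_def)
  qed
qed

definition torus_curve :: "real \<Rightarrow> torus" where
  "torus_curve t = tor (vector [schoenberg 0 t, schoenberg 1 t])"

lemma continuous_on_torus_curve: "continuous_on UNIV torus_curve"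
proof -
  have "continuous_on UNIV (\<lambda>t. \<chi> i :: 2. if i = 1 then schoenberg 0 t else schoenberg 1 t)"
  proof (intro continuous_on_vec_lambda)
    show "continuous_on UNIV (\<lambda>t. if i = 1 then schoenberg 0 t else schoenberg 1 t)" for i :: 2
      by (cases "i = 1") (simp_all add: continuous_on_schoenberg)
  qed
  moreover have "(\<chi> i :: 2. if i = 1 then schoenberg 0 t else schoenberg 1 t) = (vector [schoenberg 0 t, schoenberg 1 t] :: real ^ 2)" for t
    by (simp add: vec_eq_iff forall_2)
  ultimately have "continuous_on UNIV (\<lambda>t. vector [schoenberg 0 t, schoenberg 1 t] :: real ^ 2)" by simp
  then show ?thesis
    unfolding torus_curve_def[abs_def] by (rule continuous_on_compose2[OF continuous_on_tor]) auto
qed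

lemma torus_curve_surj: "torus_curve ` {0..1} = UNIV"
proof (intro set_eqI iffI UNIV_I)
  fix p :: torus
  define v where "v = rep_torus p"
  obtain t where t: "t \<in> {0..1}" "schoenberg 0 t = frac (v $ 1)" "schoenberg 1 t = frac (v $ 2)"
    using schoenberg_surj[of "frac (v $ 1)" "frac (v $ 2)"] frac_ge_0 frac_lt_1 by metis
  have "torus_curve t = tor v"
    unfolding torus_curve_def tor_eq_iff t by (simp add: forall_2 frac_def)
  then show "p \<in> torus_curve ` {0..1}" using t(1) by (auto simp: v_def)
qed

lemma compact_torus: "compact (UNIV :: torus set)"
  using compact_continuous_image[OF continuous_on_subset[OF continuous_on_torus_curve], of "{0..1}"]
  by (simp add: torus_curve_surj)

section \<open>The torus as a compact metric space\<close>

lemma open_image_tor: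
  assumes "open U"
  shows "open (tor ` U)"
  unfolding open_dist
proof
  fix x assume "x \<in> tor ` U"
  then obtain v where v: "v \<in> U" "x = tor v" by auto
  then obtain e where e: "e > 0" "\<And>w. dist w v < e \<Longrightarrow> w \<in> U" using assms unfolding open_dist by blast
  have "y \<in> tor ` U" if yx: "dist y x < e" for y
  proof -
    obtain w' v' where wv: "tor w' = y" "tor v' = x" "dist w' v' < e"
      using yx dist_torus_less_iff[of y x e] by blast
    have y: "tor (w' + (v - v')) = y" using tor_translate[of v v' w'] wv v by simp
    have "dist (w' + (v - v')) v = dist w' v'" by (simp add: dist_norm algebra_simps)
    then have "w' + (v - v') \<in> U" using wv(3) by (intro e(2)) simp
    then have "tor (w' + (v - v')) \<in> tor ` U" by (rule imageI)
    then show ?thesis by (simp only: y)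
  qed
  with e(1) show "\<exists>e>0. \<forall>y. dist y x < e \<longrightarrow> y \<in> tor ` U" by blast
qed

instance torus :: second_countable_topology
proof
  obtain B :: "(real ^ 2) set set" where B: "countable B" "topological_basis B"
    using ex_countable_basis by blast
  have "topological_basis ((`) tor ` B)"
  proof (rule topological_basisI)
    fix T assume "T \<in> (`) tor ` B"
    then show "open T" using open_image_tor topological_basis_open[OF B(2)] by auto
  next
    fix U x assume U: "open U" "(x :: torus) \<in> U"
    have "open (tor -` U)" by (rule open_vimage[OF U(1) continuous_on_tor])
    moreover have "rep_torus x \<in> tor -` U" using U(2) by simp
    ultimately obtain T where T: "T \<in> B" "rep_torus x \<in> T" "T \<subseteq> tor -` U"
      using topological_basisE[OF B(2)] by blast
    from imageI[OF T(2), of tor] have "x \<in> tor ` T" by simp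
    moreover have "tor ` T \<subseteq> U" using T(3) by auto
    moreover have "tor ` T \<in> (`) tor ` B" using T(1) by (rule imageI)
    ultimately show "\<exists>T\<in>(`) tor ` B. x \<in> T \<and> T \<subseteq> U" by (intro bexI conjI)
  qed
  then show "\<exists>B :: torus set set. countable B \<and> open = generate_topology B"
    using B(1) by (intro exI[of _ "(`) tor ` B"]) (auto intro: topological_basis_imp_subbasis)
qed

instance torus :: complete_space
proof
  fix X :: "nat \<Rightarrow> torus" assume "Cauchy X"
  then show "convergent X"
    using compact_imp_complete[OF compact_torus] by (auto simp: complete_def convergent_def)
qed

section \<open>Specification for the cat map\<close>

lemma eigen_decomposition: "w = (w \<bullet> e_unstable) *\<^sub>R e_unstable + (w \<bullet> e_stable) *\<^sub>R e_stable"
proof -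
  have N: "golden\<^sup>2 + 1 > 0" by (simp add: add_nonneg_pos)
  define c where "c = 1 / sqrt (golden\<^sup>2 + 1)"
  have "c\<^sup>2 = 1 / (golden\<^sup>2 + 1)" unfolding c_def power_divide using N by simp
  then have c: "c * c * (golden * golden + 1) = 1" using N by (simp add: power2_eq_square)
  have e: "e_unstable $ 1 = c * golden" "e_unstable $ 2 = c" "e_stable $ 1 = - c" "e_stable $ 2 = c * golden"
    by (simp_all add: e_unstable_def e_stable_def c_def)
  have "w $ 1 = w $ 1 * (c * c * (golden * golden + 1))" "w $ 2 = w $ 2 * (c * c * (golden * golden + 1))"
    by (simp_all only: c)
  then show ?thesis
    by (simp add: vec_eq_iff forall_2 inner_vec_def sum_2 e algebra_simps)
qed

definition cat_lift :: "nat \<Rightarrow> real ^ 2 \<Rightarrow> real ^ 2" where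
  "cat_lift n = ((*v) cat_matrix) ^^ n"

lemma cat_map_funpow: "(cat_map ^^ n) (tor v) = tor (cat_lift n v)"
  by (induction n) (simp_all add: cat_lift_def cat_map.abs_eq)

lemma cat_lift_linear:
  "cat_lift n (v + w) = cat_lift n v + cat_lift n w" "cat_lift n (t *\<^sub>R v) = t *\<^sub>R cat_lift n v"
  by (induction n) (simp_all add: cat_lift_def matrix_vector_right_distrib matrix_vector_mult_scaleR)

lemma cat_lift_unstable: "cat_lift n (v + t *\<^sub>R e_unstable) = cat_lift n v + (t * cat_lambda ^ n) *\<^sub>R e_unstable"
proof -
  have "cat_lift n e_unstable = cat_lambda ^ n *\<^sub>R e_unstable"
    by (induction n) (simp_all add: cat_lift_def eigenvectors matrix_vector_mult_scaleR mult.commute)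
  then show ?thesis by (simp add: cat_lift_linear)
qed

lemma cat_lift_stable: "cat_lift n (v + t *\<^sub>R e_stable) = cat_lift n v + (t / cat_lambda ^ n) *\<^sub>R e_stable"
proof -
  have "cat_lift n e_stable = inverse cat_lambda ^ n *\<^sub>R e_stable"
    by (induction n) (simp_all add: cat_lift_def eigenvectors matrix_vector_mult_scaleR mult.commute)
  then show ?thesis by (simp add: cat_lift_linear divide_inverse power_inverse)
qed

lemma cat_lift_Ints:
  assumes "\<forall>i. v $ i \<in> \<int>"
  shows "\<forall>i. cat_lift n v $ i \<in> \<int>"
proof (induction n)
  case (Suc n)
  have "2 * cat_lift n v $ 1 + cat_lift n v $ 2 \<in> \<int>" "cat_lift n v $ 1 + cat_lift n v $ 2 \<in> \<int>"
    using Suc by (auto intro: Ints_add Ints_mult)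
  then show ?case
    by (simp add: cat_lift_def forall_2 cat_matrix_def matrix_vector_mult_def sum_2)
qed (use assms in \<open>simp add: cat_lift_def\<close>)

lemma cat_lambda_gt_2: "cat_lambda > 2"
proof -
  have "sqrt 5 > 1" by simp
  then show ?thesis by (simp add: cat_lambda_def)
qed

text \<open>
  The unstable segment at \<open>v\<close>, carried \<open>2 * n\<close> steps ahead, meets the stable segment at \<open>w\<close>. Let \<open>d\<close>
  be the displacement from the image of \<open>v\<close> to \<open>w\<close>, and pull it back by \<open>n\<close> steps. The result \<open>d'\<close>
  differs from an integer vector \<open>k\<close> by a vector \<open>e\<close> of length at most \<open>2\<close>. Carried forward again, the
  stable part of \<open>e\<close> shrinks by \<open>cat_lambda ^ n\<close>, its unstable part grows by that factor and so is
  \<open>2 * n\<close> steps earlier smaller by that factor, and \<open>k\<close> remains an integer vector, invisible on the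
  torus.
\<close>

lemma cat_map_crossing:
  obtains t s where "\<bar>t\<bar> \<le> 2 / cat_lambda ^ n" "\<bar>s\<bar> \<le> 2 / cat_lambda ^ n"
    "tor (cat_lift (2 * n) (v + t *\<^sub>R e_unstable)) = tor (w + s *\<^sub>R e_stable)"
proof -
  let ?L = "cat_lambda ^ n"
  have l: "?L > 0" "cat_lambda \<noteq> 0" using cat_lambda_gt_2 by simp_all
  define d where "d = w - cat_lift (2 * n) v"
  define d' where "d' = (d \<bullet> e_unstable / ?L) *\<^sub>R e_unstable + (?L * (d \<bullet> e_stable)) *\<^sub>R e_stable"
  have d': "cat_lift n d' = d"
  proof -
    have "cat_lift n d' = (d \<bullet> e_unstable) *\<^sub>R e_unstable + (d \<bullet> e_stable) *\<^sub>R e_stable"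
      using cat_lift_stable[of n "(d \<bullet> e_unstable / ?L) *\<^sub>R e_unstable" "?L * (d \<bullet> e_stable)"]
        cat_lift_unstable[of n 0 "d \<bullet> e_unstable / ?L"] l
      by (simp add: d'_def cat_lift_linear(2)[of n 0 0, simplified])
    then show ?thesis using eigen_decomposition[of d] by simp
  qed
  define k :: "real ^ 2" where "k = (\<chi> i. of_int \<lfloor>d' $ i\<rfloor>)"
  define e where "e = d' - k"
  have "norm e \<le> (\<Sum>i\<in>UNIV. \<bar>e $ i\<bar>)" by (rule norm_le_l1_cart)
  also have "\<dots> \<le> (\<Sum>i\<in>(UNIV :: 2 set). 1)"
    by (intro sum_mono) (simp add: e_def k_def abs_le_iff, linarith)
  finally have e: "norm e \<le> 2" by simp
  define a b where "a = e \<bullet> e_unstable" and "b = e \<bullet> e_stable"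
  have ab: "\<bar>a\<bar> \<le> 2" "\<bar>b\<bar> \<le> 2"
    using Cauchy_Schwarz_ineq2[of e e_unstable] Cauchy_Schwarz_ineq2[of e e_stable] e
    by (simp_all add: a_def b_def eigenvectors_orthonormal)
  have "d = cat_lift n k + (a * ?L) *\<^sub>R e_unstable + (b / ?L) *\<^sub>R e_stable"
  proof -
    have "d' = k + a *\<^sub>R e_unstable + b *\<^sub>R e_stable"
      using eigen_decomposition[of e] by (simp add: a_def b_def e_def algebra_simps)
    then show ?thesis using d' by (metis cat_lift_stable cat_lift_unstable)
  qed
  moreover have "a / ?L * cat_lambda ^ (2 * n) = a * ?L" using l by (simp add: mult_2 power_add)
  ultimately have "cat_lift (2 * n) (v + (a / ?L) *\<^sub>R e_unstable) = (w + (- (b / ?L)) *\<^sub>R e_stable) - cat_lift n k"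
    unfolding cat_lift_unstable d_def by (simp add: algebra_simps)
  moreover have "\<forall>i. cat_lift n k $ i \<in> \<int>" by (rule cat_lift_Ints) (simp add: k_def)
  ultimately have "tor (cat_lift (2 * n) (v + (a / ?L) *\<^sub>R e_unstable)) = tor (w + (- (b / ?L)) *\<^sub>R e_stable)"
    by (simp add: tor_eq_iff)
  moreover have "\<bar>a / ?L\<bar> \<le> 2 / ?L" "\<bar>- (b / ?L)\<bar> \<le> 2 / ?L"
    using ab l by (simp_all add: abs_divide divide_right_mono)
  ultimately show ?thesis by (rule that[rotated 2])
qed

text \<open>
  Move \<open>(cat_map ^^ M) x\<close> along the unstable direction so that \<open>2 * n\<close> steps later it is on the
  stable line of \<open>y\<close>. The orbit before time \<open>M\<close> is changed by less than at time \<open>M\<close>, and the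
  distance to the orbit of \<open>y\<close> decays from then on.
\<close>

lemma cat_map_prepend:
  assumes n: "2 / cat_lambda ^ n \<le> \<epsilon>"
  obtains z where "\<And>i. i \<le> M \<Longrightarrow> dist ((cat_map ^^ i) z) ((cat_map ^^ i) x) \<le> \<epsilon>"
    "\<And>j. dist ((cat_map ^^ j) ((cat_map ^^ (M + 2 * n)) z)) ((cat_map ^^ j) y) \<le> \<epsilon> / 2 ^ j"
proof -
  define p q where "p = rep_torus x" and "q = rep_torus y"
  have pq: "tor p = x" "tor q = y" by (simp_all add: p_def q_def)
  obtain t s where t: "\<bar>t\<bar> \<le> 2 / cat_lambda ^ n" and s: "\<bar>s\<bar> \<le> 2 / cat_lambda ^ n"
    and eq: "tor (cat_lift (2 * n) (cat_lift M p + t *\<^sub>R e_unstable)) = tor (q + s *\<^sub>R e_stable)"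
    using cat_map_crossing[of n "cat_lift M p" q] by blast
  have l: "cat_lambda > 0" "cat_lambda \<ge> 2" using cat_lambda_gt_2 by simp_all
  define z where "z = tor (p + (t / cat_lambda ^ M) *\<^sub>R e_unstable)"
  show ?thesis
  proof
    fix i assume i: "i \<le> M"
    have "dist ((cat_map ^^ i) z) ((cat_map ^^ i) x)
        \<le> dist (cat_lift i p + (t / cat_lambda ^ M * cat_lambda ^ i) *\<^sub>R e_unstable) (cat_lift i p)"
      unfolding z_def pq(1)[symmetric] cat_map_funpow cat_lift_unstable by (rule dist_tor_le)
    also have "\<dots> = \<bar>t\<bar> * (cat_lambda ^ i / cat_lambda ^ M)"
      using l by (simp add: dist_norm eigenvectors_orthonormal abs_mult)
    also have "\<dots> \<le> \<bar>t\<bar> * 1"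
      using l i by (intro mult_left_mono) (auto intro!: power_increasing)
    finally show "dist ((cat_map ^^ i) z) ((cat_map ^^ i) x) \<le> \<epsilon>" using t n by linarith
  next
    fix j
    have "(cat_map ^^ (M + 2 * n)) z = (cat_map ^^ (2 * n)) ((cat_map ^^ M) z)"
      using funpow_add[of "2 * n" M cat_map] by (simp add: add.commute)
    also have "(cat_map ^^ M) z = tor (cat_lift M p + t *\<^sub>R e_unstable)"
      using l unfolding z_def cat_map_funpow cat_lift_unstable by simp
    also have "(cat_map ^^ (2 * n)) \<dots> = tor (q + s *\<^sub>R e_stable)"
      unfolding cat_map_funpow by (rule eq)
    finally have "dist ((cat_map ^^ j) ((cat_map ^^ (M + 2 * n)) z)) ((cat_map ^^ j) y)
        \<le> dist (cat_lift j q + (s / cat_lambda ^ j) *\<^sub>R e_stable) (cat_lift j q)"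
      using dist_tor_le[of "cat_lift j (q + s *\<^sub>R e_stable)" "cat_lift j q"]
      by (simp add: cat_map_funpow cat_lift_stable flip: pq(2))
    also have "\<dots> = \<bar>s\<bar> / cat_lambda ^ j"
      using l by (simp add: dist_norm eigenvectors_orthonormal)
    also have "\<dots> \<le> \<epsilon> / 2 ^ j"
      using s n l by (intro frac_le power_mono) auto
    finally show "dist ((cat_map ^^ j) ((cat_map ^^ (M + 2 * n)) z)) ((cat_map ^^ j) y) \<le> \<epsilon> / 2 ^ j" .
  qed
qed

text \<open>
  Segments are prepended one by one. A segment is followed up to \<open>\<epsilon>\<close> when it is prepended, and the
  \<open>k\<close>-th prepending after that, counted from \<open>0\<close>, disturbs it by at most \<open>\<epsilon> / 2 ^ k\<close>. These errors
  add up to less than \<open>3 * \<epsilon>\<close>.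
\<close>

lemma block_specification_cat_map: "block_specification cat_map"
  unfolding block_specification_def
proof (intro allI impI)
  fix r :: real assume "r > 0"
  define \<epsilon> where "\<epsilon> = r / 4"
  have \<epsilon>: "\<epsilon> > 0" using \<open>r > 0\<close> by (simp add: \<epsilon>_def)
  obtain n0 where n0: "2 / \<epsilon> < cat_lambda ^ n0"
    using real_arch_pow[of cat_lambda] cat_lambda_gt_2 by auto
  define n where "n = Suc n0"
  have "cat_lambda ^ n0 \<le> cat_lambda ^ n" using cat_lambda_gt_2 by (intro power_increasing) (auto simp: n_def)
  then have "2 / \<epsilon> < cat_lambda ^ n" using n0 by linarith
  then have n: "2 / cat_lambda ^ n \<le> \<epsilon>" using \<epsilon> cat_lambda_gt_2 by (simp add: field_simps)
  show "\<exists>N. \<forall>M xs. \<exists>z. \<forall>k<length xs. \<forall>i<M. dist ((cat_map ^^ (k * (M + N) + i)) z) ((cat_map ^^ i) (xs ! k)) < r"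
  proof (intro exI[of _ "2 * n"] allI)
    fix M and xs :: "torus list"
    let ?R = "M + 2 * n"
    have R: "?R \<ge> 1" by (simp add: n_def)
    \<comment> \<open>The bounds satisfy \<open>3 - 2 / 2 ^ 0 = 1\<close> and increase by \<open>1 / 2 ^ k\<close> from \<open>k\<close> to \<open>k + 1\<close>.\<close>
    have "\<exists>z. \<forall>k<length xs. \<forall>i<M. dist ((cat_map ^^ (k * ?R + i)) z) ((cat_map ^^ i) (xs ! k)) \<le> \<epsilon> * (3 - 2 / 2 ^ k)"
    proof (induction xs)
      case (Cons x xs)
      then obtain z' where z': "\<And>k i. k < length xs \<Longrightarrow> i < M \<Longrightarrow>
        dist ((cat_map ^^ (k * ?R + i)) z') ((cat_map ^^ i) (xs ! k)) \<le> \<epsilon> * (3 - 2 / 2 ^ k)" by blast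
      obtain z where z: "\<And>i. i \<le> M \<Longrightarrow> dist ((cat_map ^^ i) z) ((cat_map ^^ i) x) \<le> \<epsilon>"
        "\<And>j. dist ((cat_map ^^ j) ((cat_map ^^ ?R) z)) ((cat_map ^^ j) z') \<le> \<epsilon> / 2 ^ j"
        using cat_map_prepend[OF n, of M x z'] by blast
      show ?case
      proof (intro exI[of _ z] allI impI)
        fix k i assume k: "k < length (x # xs)" and i: "i < M"
        show "dist ((cat_map ^^ (k * ?R + i)) z) ((cat_map ^^ i) ((x # xs) ! k)) \<le> \<epsilon> * (3 - 2 / 2 ^ k)"
        proof (cases k)
          case 0
          then show ?thesis using z(1)[of i] i by simp
        next
          case (Suc l)
          let ?j = "l * ?R + i"
          have "(cat_map ^^ (k * ?R + i)) z = (cat_map ^^ ?j) ((cat_map ^^ ?R) z)"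
            using funpow_add[of ?j ?R cat_map] by (simp add: Suc algebra_simps)
          then have "dist ((cat_map ^^ (k * ?R + i)) z) ((cat_map ^^ i) (xs ! l))
              \<le> dist ((cat_map ^^ ?j) ((cat_map ^^ ?R) z)) ((cat_map ^^ ?j) z')
                + dist ((cat_map ^^ ?j) z') ((cat_map ^^ i) (xs ! l))"
            by (simp only: dist_triangle)
          also have "\<dots> \<le> \<epsilon> / 2 ^ ?j + \<epsilon> * (3 - 2 / 2 ^ l)"
            using z(2) z'[of l i] k i Suc by (intro add_mono) auto
          also have "\<epsilon> / 2 ^ ?j \<le> \<epsilon> / 2 ^ l"
          proof -
            have "l * 1 \<le> l * ?R" using R by (intro mult_left_mono) auto
            then have "l \<le> ?j" by (simp only: mult_1_right trans_le_add1)
            then show ?thesis using \<epsilon> by (intro divide_left_mono power_increasing) auto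
          qed
          also have "\<epsilon> / 2 ^ l + \<epsilon> * (3 - 2 / 2 ^ l) = \<epsilon> * (3 - 2 / 2 ^ k)"
            by (simp add: Suc field_simps)
          finally show ?thesis by (simp add: Suc)
        qed
      qed
    qed simp
    then obtain z where z: "\<And>k i. k < length xs \<Longrightarrow> i < M \<Longrightarrow>
        dist ((cat_map ^^ (k * ?R + i)) z) ((cat_map ^^ i) (xs ! k)) \<le> \<epsilon> * (3 - 2 / 2 ^ k)" by blast
    have "\<epsilon> * (3 - 2 / 2 ^ k) < r" for k :: nat
    proof -
      have "\<epsilon> * (3 - 2 / 2 ^ k) \<le> \<epsilon> * 3" using \<epsilon> by (intro mult_left_mono) auto
      also have "\<dots> < r" using \<open>r > 0\<close> by (simp add: \<epsilon>_def)
      finally show ?thesis .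
    qed
    then show "\<exists>z. \<forall>k<length xs. \<forall>i<M. dist ((cat_map ^^ (k * ?R + i)) z) ((cat_map ^^ i) (xs ! k)) < r"
      using z by (intro exI[of _ z]) (meson le_less_trans)
  qed
qed

lemma block_specification_conjugate:
  fixes g :: "'a::metric_space \<Rightarrow> 'a" and f :: "'b::metric_space \<Rightarrow> 'b"
  assumes g: "block_specification g" and compact: "compact (UNIV :: 'a set)"
    and h: "homeomorphism UNIV UNIV \<pi> \<pi>'" and conj: "\<pi> \<circ> g = f \<circ> \<pi>"
  shows "block_specification f"
  unfolding block_specification_def
proof (intro allI impI)
  have it: "\<pi> ((g ^^ n) x) = (f ^^ n) (\<pi> x)" for n x
    using conj by (induction n) (simp_all add: fun_eq_iff)
  have inv: "\<pi> (\<pi>' y) = y" for y using h by (simp add: homeomorphism_def)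
  have "uniformly_continuous_on UNIV \<pi>"
    using h compact by (intro compact_uniformly_continuous) (auto simp: homeomorphism_def)
  fix r :: real assume "r > 0"
  then obtain d where d: "d > 0" "\<And>x y. dist x y < d \<Longrightarrow> dist (\<pi> x) (\<pi> y) < r"
    using \<open>uniformly_continuous_on UNIV \<pi>\<close> unfolding uniformly_continuous_on_def by (meson UNIV_I)
  then obtain N where N: "\<And>M xs. \<exists>z. \<forall>k<length xs. \<forall>i<M. dist ((g ^^ (k * (M + N) + i)) z) ((g ^^ i) (xs ! k)) < d"
    using g unfolding block_specification_def by blast
  show "\<exists>N. \<forall>M xs. \<exists>z. \<forall>k<length xs. \<forall>i<M. dist ((f ^^ (k * (M + N) + i)) z) ((f ^^ i) (xs ! k)) < r"
  proof (intro exI[of _ N] allI)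
    fix M and xs :: "'b list"
    obtain z where z: "\<forall>k<length (map \<pi>' xs). \<forall>i<M. dist ((g ^^ (k * (M + N) + i)) z) ((g ^^ i) (map \<pi>' xs ! k)) < d"
      using N[of "map \<pi>' xs" M] ..
    have "dist ((f ^^ (k * (M + N) + i)) (\<pi> z)) ((f ^^ i) (xs ! k)) < r" if "k < length xs" "i < M" for k i
      using d(2)[of "(g ^^ (k * (M + N) + i)) z" "(g ^^ i) (\<pi>' (xs ! k))"] z that by (simp add: it inv)
    then show "\<exists>z. \<forall>k<length xs. \<forall>i<M. dist ((f ^^ (k * (M + N) + i)) z) ((f ^^ i) (xs ! k)) < r" by blast
  qed
qed

lemma continuous_on_cat_map: "continuous_on UNIV cat_map"
proof -
  have "open (cat_map -` U)" if U: "open U" for U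
  proof -
    have "cat_map -` U = tor ` ((\<lambda>v. tor (cat_matrix *v v)) -` U)"
    proof (intro set_eqI iffI)
      fix x assume "x \<in> cat_map -` U"
      then have "rep_torus x \<in> (\<lambda>v. tor (cat_matrix *v v)) -` U"
        using cat_map.abs_eq[of "rep_torus x"] by simp
      from imageI[OF this, of tor] show "x \<in> tor ` ((\<lambda>v. tor (cat_matrix *v v)) -` U)" by simp
    qed (auto simp: cat_map.abs_eq)
    moreover have "continuous_on UNIV (\<lambda>v. tor (cat_matrix *v v))"
      by (rule continuous_on_compose2[OF continuous_on_tor]) (auto intro: continuous_intros)
    ultimately show ?thesis using open_image_tor[OF open_vimage[OF U]] by simp
  qed
  then show ?thesis by (simp add: continuous_on_open_vimage)
qed

theorem corollary4p1:
  fixes f :: "torus \<Rightarrow> torus" and \<nu>\<^sub>0 :: "torus measure" and \<beta> :: real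
  assumes "katok_diffeo f" and "katok_measure f \<nu>\<^sub>0" and "\<beta> > 0"
  shows "\<exists>\<epsilon>\<^sub>0>0. \<forall>(\<epsilon> :: real) (m :: torus measure).
    0 < \<epsilon> \<and> \<epsilon> < \<epsilon>\<^sub>0 \<and> finite_measure m \<and> sets m = sets borel \<and>
    (\<exists>U. openin (weak_star f) U \<and> \<nu>\<^sub>0 \<in> U \<and>
       (\<forall>\<nu>\<in>U. ergodic f \<nu> \<longrightarrow> \<nu> \<in> M_inv_on (pesin_set f \<nu>\<^sub>0 \<beta> \<beta> \<epsilon>) f)) \<longrightarrow>
    (\<forall>(\<phi> :: torus \<Rightarrow> real) (c :: real). continuous_on UNIV \<phi> \<longrightarrow>
       (\<forall>\<psi> \<in> V_plus f m.
          limsup (\<lambda>n. ereal (1 / real n) *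
              log_ereal (measure m {x. birkhoff_sum f \<phi> n x / real n \<in> {c..}}))
          \<le> (SUP \<nu> \<in> {\<nu> \<in> M_inv f. (\<integral>x. \<phi> x \<partial>\<nu>) \<ge> c}.
               ks_entropy f \<nu> - ereal (\<integral>x. \<psi> x \<partial>\<nu>))) \<and>
       (\<forall>\<psi> \<in> V_minus f m.
          liminf (\<lambda>n. ereal (1 / real n) *
              log_ereal (measure m {x. birkhoff_sum f \<phi> n x / real n \<in> {c<..}}))
          \<ge> (SUP \<nu> \<in> {\<nu> \<in> M_inv_on (pesin_set f \<nu>\<^sub>0 \<beta> \<beta> \<epsilon>) f. (\<integral>x. \<phi> x \<partial>\<nu>) > c}.
               ks_entropy f \<nu> - ereal (\<integral>x. \<psi> x \<partial>\<nu>))))"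
proof -
  obtain \<pi> \<pi>' where h: "homeomorphism UNIV UNIV \<pi> \<pi>'" and conj: "\<pi> \<circ> cat_map = f \<circ> \<pi>"
    using assms(2) unfolding katok_measure_def by blast
  have spec: "block_specification f"
    by (rule block_specification_conjugate[OF block_specification_cat_map compact_torus h conj])
  have "f = (\<lambda>x. \<pi> (cat_map (\<pi>' x)))"
    using conj h by (auto simp: fun_eq_iff homeomorphism_def)
  moreover have "continuous_on UNIV \<pi>" "continuous_on UNIV \<pi>'"
    using h by (simp_all add: homeomorphism_def)
  then have "continuous_on UNIV (\<lambda>x. \<pi> (cat_map (\<pi>' x)))"
    by (rule continuous_on_compose2[OF _ continuous_on_compose2[OF continuous_on_cat_map]]) simp_all
  ultimately have f: "continuous_on UNIV f" by simp
  show ?thesis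
  proof (intro exI[of _ 1] conjI allI impI ballI; (elim conjE)?)
    fix \<epsilon> :: real and m :: "torus measure" and \<phi> \<psi> :: "torus \<Rightarrow> real" and c
    assume m: "finite_measure m" "sets m = sets borel" and \<phi>: "continuous_on UNIV \<phi>"
    {
      assume "\<psi> \<in> V_plus f m"
      then show "limsup (\<lambda>n. ereal (1 / real n) *
              log_ereal (measure m {x. birkhoff_sum f \<phi> n x / real n \<in> {c..}}))
          \<le> (SUP \<nu> \<in> {\<nu> \<in> M_inv f. (\<integral>x. \<phi> x \<partial>\<nu>) \<ge> c}.
               ks_entropy f \<nu> - ereal (\<integral>x. \<psi> x \<partial>\<nu>))"
        by (rule large_deviation_upper_bound[OF continuous_on_torus_curve torus_curve_surj f m \<phi>])
    next
      assume \<psi>: "\<psi> \<in> V_minus f m"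
      show "liminf (\<lambda>n. ereal (1 / real n) *
              log_ereal (measure m {x. birkhoff_sum f \<phi> n x / real n \<in> {c<..}}))
          \<ge> (SUP \<nu> \<in> {\<nu> \<in> M_inv_on (pesin_set f \<nu>\<^sub>0 \<beta> \<beta> \<epsilon>) f. (\<integral>x. \<phi> x \<partial>\<nu>) > c}.
               ks_entropy f \<nu> - ereal (\<integral>x. \<psi> x \<partial>\<nu>))"
        by (intro SUP_least large_deviation_lower_bound[OF compact_torus f spec m \<phi> \<psi>])
          (auto simp: M_inv_on_def)
    }
  qed simp
qed

end
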